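(* Let $\mu_0=\mathcal N(m_0,C_0)$ be fixed. The map $(m,X)\mapsto\mathrm{OT}^\epsilon_{d^2}(\mu_0,\mathcal N(m,X))$ is convex on $\mathcal H\times(\mathrm{Sym}^+(\mathcal H)\cap\mathrm{Tr}(\mathcal H))$ (and symmetrically in the first argument). In particular, for fixed $C_0\in\mathrm{Sym}^+(\mathcal H)\cap\mathrm{Tr}(\mathcal H)$, the function $F_E(X)=\mathrm{OT}^\epsilon_{d^2}(\mathcal N(0,C_0),\mathcal N(0,X))$ is convex on $\mathrm{Sym}^+(\mathcal H)\cap\mathrm{Tr}(\mathcal H)$, and it is strictly convex if $\ker(C_0)=\{0\}$.
   Context: $\mathcal H$ real separable Hilbert space; $\mathrm{Sym}^+(\mathcal H)$ bounded self-adjoint positive operators; $\mathrm{Tr}(\mathcal H)$ trace class operators. $\mathcal N(m,C)$ Gaussian measure with mean $m$, covariance $C$. $\mathrm{OT}^\epsilon_{d^2}(\mu_0,\mu_1)=\min_{\gamma\in\mathrm{Joint}(\mu_0,\mu_1)}\{\int\|x-y\|^2d\gamma+\epsilon\mathrm{KL}(\gamma\|\mu_0\otimes\mu_1)\}$, $\epsilon>0$ fixed, where $\mathrm{Joint}(\mu_0,\mu_1)$ is the set of couplings and $\mathrm{KL}$ the Kullback–Leibler divergence. *)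

theory Defs
  imports "HOL-Probability.Probability"
begin

text \<open>The ambient real separable Hilbert space is a type of class
  real_inner + complete_space + second_countable_topology.\<close>

definition sym_pos_op :: "('a::real_inner \<Rightarrow>\<^sub>L 'a) \<Rightarrow> bool" where
  "sym_pos_op C \<longleftrightarrow> (\<forall>x y. inner (blinfun_apply C x) y = inner x (blinfun_apply C y))
                    \<and> (\<forall>x. 0 \<le> inner (blinfun_apply C x) x)"

definition orthonormal_basis :: "'a::real_inner set \<Rightarrow> bool" where
  "orthonormal_basis B \<longleftrightarrow> (\<forall>e\<in>B. norm e = 1) \<and> (\<forall>e\<in>B. \<forall>f\<in>B. e \<noteq> f \<longrightarrow> inner e f = 0)
                         \<and> closure (span B) = UNIV"

definition trace_class_pos :: "('a::real_inner \<Rightarrow>\<^sub>L 'a) \<Rightarrow> bool" where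
  "trace_class_pos C \<longleftrightarrow> (\<exists>B. orthonormal_basis B \<and> (\<lambda>e. inner (blinfun_apply C e) e) summable_on B)"

definition SymTr :: "('a::real_inner \<Rightarrow>\<^sub>L 'a) set" where
  "SymTr = {C. sym_pos_op C \<and> trace_class_pos C}"

definition is_gaussian :: "'a::{real_inner,second_countable_topology} \<Rightarrow> ('a \<Rightarrow>\<^sub>L 'a) \<Rightarrow> 'a measure \<Rightarrow> bool" where
  "is_gaussian m C \<mu> \<longleftrightarrow> sets \<mu> = sets borel \<and> prob_space \<mu> \<and>
     (\<forall>h. distr \<mu> borel (\<lambda>x. inner h x) =
            (let v = inner (blinfun_apply C h) h in
             if v = 0 then return borel (inner h m)
             else density lborel (normal_density (inner h m) (sqrt v))))"

definition couplings :: "'a measure \<Rightarrow> 'b measure \<Rightarrow> ('a \<times> 'b) measure set" where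
  "couplings \<mu> \<nu> = {\<gamma>. sets \<gamma> = sets (\<mu> \<Otimes>\<^sub>M \<nu>) \<and> prob_space \<gamma> \<and>
                       distr \<gamma> \<mu> fst = \<mu> \<and> distr \<gamma> \<nu> snd = \<nu>}"

definition xlogx :: "real \<Rightarrow> real" where
  "xlogx x = (if x = 0 then 0 else x * ln x)"

text \<open>KL(\<gamma> || \<nu>) = \<integral> f log f d\<nu> with f = d\<gamma>/d\<nu>, written with the nonnegative integrand
  f log f - f + 1 (whose extra terms integrate to 0 for probability measures), and +\<infinity>
  if \<gamma> is not absolutely continuous w.r.t. \<nu>.\<close>
definition KL :: "'a measure \<Rightarrow> 'a measure \<Rightarrow> ennreal" where
  "KL \<gamma> \<nu> = (if absolutely_continuous \<nu> \<gamma> \<and> sets \<gamma> = sets \<nu> then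
      (\<integral>\<^sup>+ z. ennreal (let f = enn2real (RN_deriv \<nu> \<gamma> z) in xlogx f - f + 1) \<partial>\<nu>)
    else \<infinity>)"

definition OT_eps :: "real \<Rightarrow> 'a::real_normed_vector measure \<Rightarrow> 'a measure \<Rightarrow> ennreal" where
  "OT_eps \<epsilon> \<mu>0 \<mu>1 = (INF \<gamma>\<in>couplings \<mu>0 \<mu>1.
      (\<integral>\<^sup>+ z. ennreal ((norm (fst z - snd z))\<^sup>2) \<partial>\<gamma>) + ennreal \<epsilon> * KL \<gamma> (\<mu>0 \<Otimes>\<^sub>M \<mu>1))"

end

(* The Schroedinger potentials between Gaussians are quadratic, so weak duality yields a lower bound
   for OT that is affine in the target covariance, up to the squared distance of the means, and tight
   at one prescribed covariance.  An affine minorant touching at every point gives convexity.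

   No operator calculus is needed: choose finitely many vectors u_i that are orthonormal for the
   covariance C0 of the fixed marginal and diagonalise the form (x, y) |-> (X C0 x, C0 y).  With
   xi_i = (u_i, x - m0) and eta_i = (C0 u_i, y - m) the kernel G = sum_i log_kernel (xi_i, eta_i) has
   the property that |x - y|^2 + eps * G contains no product xi_i * eta_i, hence has the same integral
   under all couplings up to a term in the residual x' = (x - m0) - sum_i xi_i C0 u_i, which is small
   when the u_i span enough.  Integrating exp G over either variable gives 1 at the touching covariance,
   so exp G is the density of a coupling.

   For strictness, G is perturbed by kappa * cos of a linear functional in the dual bound.  At a
   covariance other than the touching one, the first marginal of exp G differs from the fixed marginal
   in that direction, which produces a gain that does not depend on the number of vectors. *)

theory Submission
  imports Defs
begin

section \<open>Entropic transport cost and relative entropy\<close>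

text \<open>A trace-class \<open>C\<^sub>0\<close> has no bounded inverse in infinite dimension, so
  only finitely many modes are used and the minorant touches up to an error \<open>\<delta>\<close>.
  Convexity survives letting \<open>\<delta>\<close> tend to 0. A strict inequality needs a gain
  fixed before \<open>\<delta>\<close>, hence before the number of modes; this is why
  \<open>1 / s i\<close> is bounded through operator norms. Each mode is a bivariate Gaussian with
  variances 1 and \<open>w i\<close>. Conditioning the first coordinate on the second leaves
  variance \<open>s i\<close>, and the correct first marginal forces
  \<open>\<beta>\<^sup>2 * w i * (s i)\<^sup>2 + s i = 1\<close>. The integral over the source is 1
  for every target, so the dual bound carries no normalising constant away from the touching
  covariance. The dual is used without logarithm, as \<open>G - exp G + 1\<close>, so that a
  perturbed potential can be inserted without renormalising. A cosine is taken because it is bounded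
  and its integrals are characteristic functions. The potential is recentred at the mean of each
  target, so means enter only through \<open>norm (m\<^sub>0 - m)\<close>.\<close>

lemma KL_ge_exponential_dual:
  assumes "prob_space N" "prob_space \<gamma>"
    and G [measurable]: "G \<in> borel_measurable N"
    and intG: "integrable \<gamma> G"
    and expG: "integrable N (\<lambda>z. exp (G z))"
  shows "ennreal ((\<integral>z. G z \<partial>\<gamma>) - (\<integral>z. exp (G z) \<partial>N) + 1) \<le> KL \<gamma> N"
proof (cases "absolutely_continuous N \<gamma> \<and> sets \<gamma> = sets N")
  case True
  interpret N: prob_space N by fact
  interpret \<gamma>: prob_space \<gamma> by fact
  define f where "f z = enn2real (RN_deriv N \<gamma> z)" for z
  have [measurable]: "f \<in> borel_measurable N" unfolding f_def by measurable
  have f0: "f z \<ge> 0" for z unfolding f_def by simp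
  have sig: "sigma_finite_measure \<gamma>" by unfold_locales
  have i1: "integrable N (\<lambda>z. f z * G z)"
    unfolding f_def using N.RN_deriv_integrable[OF sig, of G] True intG by auto
  have e1: "(\<integral>z. f z * G z \<partial>N) = (\<integral>z. G z \<partial>\<gamma>)"
    unfolding f_def using N.RN_deriv_integral[OF sig, of G] True G by auto
  \<comment> \<open>Fenchel-Young duality between \<open>x * ln x - x\<close> and
    \<open>exp\<close>, obtained from \<open>1 + x \<le> exp x\<close> at
    \<open>x = G z - ln (f z)\<close>.\<close>
  have young: "f z * G z - exp (G z) + 1 \<le> xlogx (f z) - f z + 1" for z
  proof (cases "f z = 0")
    case True
    then show ?thesis by (simp add: xlogx_def)
  next
    case False
    with f0[of z] have p: "f z > 0" by simp
    have "1 + (G z - ln (f z)) \<le> exp (G z - ln (f z))" by (rule exp_ge_add_one_self)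
    also have "\<dots> = exp (G z) / f z" using p by (simp add: exp_diff)
    finally have "f z * (1 + (G z - ln (f z))) \<le> exp (G z)"
      using p by (simp add: pos_le_divide_eq mult.commute)
    then show ?thesis using False by (simp add: xlogx_def algebra_simps)
  qed
  have iI: "integrable N (\<lambda>z. f z * G z - exp (G z) + 1)" using i1 expG by simp
  have "(\<integral>z. G z \<partial>\<gamma>) - (\<integral>z. exp (G z) \<partial>N) + 1 = (\<integral>z. f z * G z - exp (G z) + 1 \<partial>N)"
    using i1 expG e1 by (simp add: N.prob_space)
  also have "ennreal \<dots> \<le> (\<integral>\<^sup>+z. ennreal (f z * G z - exp (G z) + 1) \<partial>N)"
  proof -
    have "(\<integral>z. f z * G z - exp (G z) + 1 \<partial>N) \<le> (\<integral>z. max 0 (f z * G z - exp (G z) + 1) \<partial>N)"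
      using iI by (intro integral_mono) auto
    then have "ennreal (\<integral>z. f z * G z - exp (G z) + 1 \<partial>N) \<le> ennreal (\<integral>z. max 0 (f z * G z - exp (G z) + 1) \<partial>N)"
      by (rule ennreal_leI)
    also have "\<dots> = (\<integral>\<^sup>+z. ennreal (max 0 (f z * G z - exp (G z) + 1)) \<partial>N)"
      using iI by (intro nn_integral_eq_integral[symmetric]) auto
    also have "\<dots> = (\<integral>\<^sup>+z. ennreal (f z * G z - exp (G z) + 1) \<partial>N)"
      by (intro nn_integral_cong) (simp add: max_def ennreal_neg)
    finally show ?thesis .
  qed
  also have "\<dots> \<le> (\<integral>\<^sup>+z. ennreal (xlogx (f z) - f z + 1) \<partial>N)"
    by (intro nn_integral_mono ennreal_leI young)
  also have "\<dots> = KL \<gamma> N"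
    using True by (simp add: KL_def f_def Let_def)
  finally show ?thesis .
qed (auto simp: KL_def)

text \<open>Equality case of the preceding bound: the density is \<open>exp G\<close> itself.
  Nonnegativity is recorded because \<open>ennreal\<close> sends negative reals to 0 and would
  otherwise lose the value.\<close>

lemma KL_density_exp:
  assumes "prob_space N" and G [measurable]: "G \<in> borel_measurable N"
    and expG: "(\<integral>\<^sup>+z. ennreal (exp (G z)) \<partial>N) = 1"
    and intG: "integrable (density N (\<lambda>z. ennreal (exp (G z)))) G"
  shows "KL (density N (\<lambda>z. ennreal (exp (G z)))) N
      = ennreal (\<integral>z. G z \<partial>density N (\<lambda>z. ennreal (exp (G z))))"
    and "0 \<le> (\<integral>z. G z \<partial>density N (\<lambda>z. ennreal (exp (G z))))"
proof -
  interpret N: prob_space N by fact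
  let ?D = "density N (\<lambda>z. ennreal (exp (G z)))"
  have ac: "absolutely_continuous N ?D"
    by (intro absolutely_continuousI_density) measurable
  have rn: "AE z in N. ennreal (exp (G z)) = RN_deriv N ?D z"
    by (intro N.RN_deriv_unique) auto
  have ie: "integrable N (\<lambda>z. exp (G z))"
    using expG by (intro integrableI_nonneg) auto
  have ee: "(\<integral>z. exp (G z) \<partial>N) = 1"
    using expG by (simp add: integral_eq_nn_integral)
  have ig: "integrable N (\<lambda>z. exp (G z) * G z)"
    using intG by (simp add: integrable_real_density integrable_density)
  have eg: "(\<integral>z. exp (G z) * G z \<partial>N) = (\<integral>z. G z \<partial>?D)"
    by (simp add: integral_density)
  have nn: "0 \<le> exp (G z) * G z - exp (G z) + 1" for z
  proof -
    have "exp (G z) * (1 + - G z) \<le> exp (G z) * exp (- G z)"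
      by (intro mult_left_mono exp_ge_add_one_self) auto
    then show ?thesis by (simp add: exp_minus algebra_simps)
  qed
  have "KL ?D N = (\<integral>\<^sup>+ z. ennreal (let f = enn2real (RN_deriv N ?D z) in xlogx f - f + 1) \<partial>N)"
    using ac by (simp add: KL_def)
  also have "\<dots> = (\<integral>\<^sup>+ z. ennreal (exp (G z) * G z - exp (G z) + 1) \<partial>N)"
  proof (rule nn_integral_cong_AE, use rn in eventually_elim)
    fix z assume "ennreal (exp (G z)) = RN_deriv N ?D z"
    then have "enn2real (RN_deriv N ?D z) = exp (G z)" by (metis enn2real_ennreal exp_ge_zero)
    then show "ennreal (let f = enn2real (RN_deriv N ?D z) in xlogx f - f + 1)
      = ennreal (exp (G z) * G z - exp (G z) + 1)" by (simp add: xlogx_def Let_def)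
  qed
  also have "\<dots> = ennreal (\<integral>z. exp (G z) * G z - exp (G z) + 1 \<partial>N)"
    using ig ie nn by (intro nn_integral_eq_integral) auto
  also have e: "(\<integral>z. exp (G z) * G z - exp (G z) + 1 \<partial>N) = (\<integral>z. G z \<partial>?D)"
    using ig ie eg ee by (simp add: N.prob_space)
  finally show "KL ?D N = ennreal (\<integral>z. G z \<partial>?D)" .
  show "0 \<le> (\<integral>z. G z \<partial>?D)" unfolding e[symmetric] using nn by (intro Bochner_Integration.integral_nonneg) auto
qed

text \<open>The measurable left inverse \<open>T'\<close> carries the Radon-Nikodym derivative along
  \<open>T\<close>. When absolute continuity fails, the right-hand side is infinite.\<close>

lemma KL_distr_iso:
  assumes "prob_space N" "prob_space \<gamma>" and sets: "sets \<gamma> = sets N"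
    and T [measurable]: "T \<in> measurable N M'" and T' [measurable]: "T' \<in> measurable M' N"
    and inv: "\<And>z. z \<in> space N \<Longrightarrow> T' (T z) = z"
  shows "KL (distr \<gamma> M' T) (distr N M' T) \<le> KL \<gamma> N"
proof (cases "absolutely_continuous N \<gamma>")
  case True
  interpret N: prob_space N by fact
  interpret \<gamma>: prob_space \<gamma> by fact
  have [simp]: "measurable \<gamma> X = measurable N X" for X by (intro measurable_cong_sets sets) simp
  have spc: "space \<gamma> = space N" by (rule sets_eq_imp_space_eq[OF sets])
  have ac: "absolutely_continuous (distr N M' T) (distr \<gamma> M' T)"
    unfolding absolutely_continuous_def
  proof
    fix A assume "A \<in> null_sets (distr N M' T)"
    then have A: "A \<in> sets M'" "emeasure N (T -` A \<inter> space N) = 0"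
      by (auto simp: null_sets_def emeasure_distr)
    then have "T -` A \<inter> space N \<in> null_sets N" by (auto simp: null_sets_def)
    then have "T -` A \<inter> space N \<in> null_sets \<gamma>" using True by (auto simp: absolutely_continuous_def)
    then show "A \<in> null_sets (distr \<gamma> M' T)" using A by (auto simp: null_sets_def emeasure_distr spc)
  qed
  have ae: "AE x in N. RN_deriv (distr N M' T) (distr \<gamma> M' T) (T x) = RN_deriv N \<gamma> x"
    by (intro N.RN_deriv_distr[OF T T' _ ac sets]) (auto simp: inv)
  have "KL (distr \<gamma> M' T) (distr N M' T)
     = (\<integral>\<^sup>+ z. ennreal (let f = enn2real (RN_deriv (distr N M' T) (distr \<gamma> M' T) (T z)) in xlogx f - f + 1) \<partial>N)"
    using ac unfolding KL_def xlogx_def Let_def by (simp add: nn_integral_distr)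
  also have "\<dots> = KL \<gamma> N"
    using ae True sets unfolding KL_def by (auto intro!: nn_integral_cong_AE)
  finally show ?thesis by simp
qed (auto simp: KL_def sets)

text \<open>Couplings are pushed forward under the exchange of coordinates. Since the inequality
  covers all pairs, applying it twice gives equality.\<close>

lemma OT_eps_swap_le:
  fixes \<mu> \<nu> :: "'a::{real_normed_vector,second_countable_topology} measure"
  assumes "prob_space \<mu>" "prob_space \<nu>" and s: "sets \<mu> = sets borel" "sets \<nu> = sets borel"
  shows "OT_eps \<epsilon> \<nu> \<mu> \<le> OT_eps \<epsilon> \<mu> \<nu>"
  unfolding OT_eps_def
proof (rule INF_greatest)
  fix \<gamma> assume g: "\<gamma> \<in> couplings \<mu> \<nu>"
  interpret \<mu>: prob_space \<mu> by fact
  interpret \<nu>: prob_space \<nu> by fact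
  interpret P: pair_prob_space \<mu> \<nu> by unfold_locales
  interpret Q: pair_prob_space \<nu> \<mu> by unfold_locales
  from g have sg: "sets \<gamma> = sets (\<mu> \<Otimes>\<^sub>M \<nu>)" and "prob_space \<gamma>"
    and d: "distr \<gamma> \<mu> fst = \<mu>" "distr \<gamma> \<nu> snd = \<nu>" by (auto simp: couplings_def)
  interpret \<gamma>: prob_space \<gamma> by fact
  have mg [simp]: "measurable \<gamma> X = measurable (\<mu> \<Otimes>\<^sub>M \<nu>) X" for X
    by (intro measurable_cong_sets sg) simp
  let ?T = "\<lambda>(x, y). (y, x)"
  define \<gamma>' where "\<gamma>' = distr \<gamma> (\<nu> \<Otimes>\<^sub>M \<mu>) ?T"
  have c: "\<gamma>' \<in> couplings \<nu> \<mu>"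
    unfolding couplings_def \<gamma>'_def
    by (auto simp: distr_distr o_def case_prod_beta d intro!: \<gamma>.prob_space_distr)
  have N: "distr (\<mu> \<Otimes>\<^sub>M \<nu>) (\<nu> \<Otimes>\<^sub>M \<mu>) ?T = \<nu> \<Otimes>\<^sub>M \<mu>"
    using Q.distr_pair_swap by simp
  have k: "KL \<gamma>' (\<nu> \<Otimes>\<^sub>M \<mu>) \<le> KL \<gamma> (\<mu> \<Otimes>\<^sub>M \<nu>)"
    unfolding \<gamma>'_def
    by (subst (2) N[symmetric])
      (rule KL_distr_iso[where T'="?T"], auto simp: sg intro: P.prob_space_axioms \<open>prob_space \<gamma>\<close>)
  have "sets (borel \<Otimes>\<^sub>M borel :: ('a \<times> 'a) measure) = sets (\<nu> \<Otimes>\<^sub>M \<mu>)"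
    by (intro sets_pair_measure_cong) (simp_all add: s)
  then have mm: "(\<lambda>z. (norm (fst z - snd z))\<^sup>2) \<in> borel_measurable (\<nu> \<Otimes>\<^sub>M \<mu>)"
    by (subst measurable_cong_sets[of _ "borel \<Otimes>\<^sub>M borel", OF _ refl]) (auto, measurable)
  have i: "(\<integral>\<^sup>+ z. ennreal ((norm (fst z - snd z))\<^sup>2) \<partial>\<gamma>') = (\<integral>\<^sup>+ z. ennreal ((norm (fst z - snd z))\<^sup>2) \<partial>\<gamma>)"
    unfolding \<gamma>'_def using mm
    by (subst nn_integral_distr) (auto simp: case_prod_beta norm_minus_commute)
  have "(INF \<gamma>\<in>couplings \<nu> \<mu>. (\<integral>\<^sup>+ z. ennreal ((norm (fst z - snd z))\<^sup>2) \<partial>\<gamma>) + ennreal \<epsilon> * KL \<gamma> (\<nu> \<Otimes>\<^sub>M \<mu>))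
    \<le> (\<integral>\<^sup>+ z. ennreal ((norm (fst z - snd z))\<^sup>2) \<partial>\<gamma>') + ennreal \<epsilon> * KL \<gamma>' (\<nu> \<Otimes>\<^sub>M \<mu>)"
    by (rule INF_lower[OF c])
  also have "\<dots> \<le> (\<integral>\<^sup>+ z. ennreal ((norm (fst z - snd z))\<^sup>2) \<partial>\<gamma>) + ennreal \<epsilon> * KL \<gamma> (\<mu> \<Otimes>\<^sub>M \<nu>)"
    unfolding i by (intro add_left_mono mult_left_mono k) auto
  finally show "(INF \<gamma>\<in>couplings \<nu> \<mu>. (\<integral>\<^sup>+ z. ennreal ((norm (fst z - snd z))\<^sup>2) \<partial>\<gamma>) + ennreal \<epsilon> * KL \<gamma> (\<nu> \<Otimes>\<^sub>M \<mu>))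
    \<le> (\<integral>\<^sup>+ z. ennreal ((norm (fst z - snd z))\<^sup>2) \<partial>\<gamma>) + ennreal \<epsilon> * KL \<gamma> (\<mu> \<Otimes>\<^sub>M \<nu>)" .
qed

lemma OT_eps_swap:
  fixes \<mu> \<nu> :: "'a::{real_normed_vector,second_countable_topology} measure"
  assumes "prob_space \<mu>" "prob_space \<nu>" "sets \<mu> = sets borel" "sets \<nu> = sets borel"
  shows "OT_eps \<epsilon> \<nu> \<mu> = OT_eps \<epsilon> \<mu> \<nu>"
  using OT_eps_swap_le[of \<mu> \<nu> \<epsilon>] OT_eps_swap_le[of \<nu> \<mu> \<epsilon>] assms by (intro antisym) auto

section \<open>Independence from characteristic functions\<close>

lemma integral_indicator_vimage:
  fixes X :: "'a \<Rightarrow> 'b::topological_space"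
  assumes "X \<in> borel_measurable M" "A \<in> sets borel"
  shows "(LINT \<omega>|M. indicator A (X \<omega>)) = measure M (X -` A \<inter> space M)"
proof -
  have "(LINT \<omega>|M. indicator A (X \<omega>) :: real) = (LINT \<omega>|M. indicator (X -` A \<inter> space M) \<omega>)"
    by (intro Bochner_Integration.integral_cong) (auto simp: indicator_def)
  then show ?thesis by simp
qed

text \<open>\<open>W\<close> may change sign, so it is shifted and scaled to a probability density
  \<open>w\<close>. The hypothesis then says that \<open>X\<close> has the same characteristic
  function under the tilted measure as under \<open>M\<close>, and Levy's theorem identifies the two
  laws.\<close>

lemma (in prob_space) weighted_law_eqI_char:
  fixes X :: "'a \<Rightarrow> real" and W :: "'a \<Rightarrow> real"
  assumes X [measurable]: "X \<in> borel_measurable M" and W [measurable]: "W \<in> borel_measurable M"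
    and bd: "\<And>\<omega>. \<bar>W \<omega>\<bar> \<le> K"
    and ch: "\<And>u. (CLINT \<omega>|M. W \<omega> * iexp (u * X \<omega>)) = (LINT \<omega>|M. W \<omega>) * (CLINT \<omega>|M. iexp (u * X \<omega>))"
    and A [measurable]: "A \<in> sets borel"
  shows "(LINT \<omega>|M. W \<omega> * indicator A (X \<omega>)) = (LINT \<omega>|M. W \<omega>) * (LINT \<omega>|M. indicator A (X \<omega>))"
proof -
  have iW: "integrable M W" using bd by (intro integrable_const_bound[of _ K]) auto
  have iX: "integrable M (\<lambda>\<omega>. iexp (u * X \<omega>))" for u
    by (intro integrable_const_bound[of _ 1]) auto
  have iWX: "integrable M (\<lambda>\<omega>. W \<omega> * iexp (u * X \<omega>))" for u
    using bd by (intro integrable_const_bound[of _ K]) (auto simp: norm_mult)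
  have K0: "0 \<le> K" using bd order_trans[OF abs_ge_zero] by blast
  \<comment> \<open>Adding \<open>K\<close> makes the weight nonnegative; the extra 1 keeps the mean
    \<open>c\<close> positive even if \<open>W = - K\<close> almost surely.\<close>
  define c where "c = expectation W + K + 1"
  have "- K \<le> expectation W"
  proof -
    have "expectation (\<lambda>_. - K) \<le> expectation W"
      using iW bd by (intro integral_mono) (auto simp: abs_le_iff, metis minus_le_iff)
    then show ?thesis by (simp add: prob_space)
  qed
  then have c: "c > 0" unfolding c_def by simp
  define w where "w \<omega> = (W \<omega> + K + 1) / c" for \<omega>
  have [measurable]: "w \<in> borel_measurable M" unfolding w_def by measurable
  have w0: "w \<omega> \<ge> 0" for \<omega>
  proof -
    have "- K \<le> W \<omega>" using bd[of \<omega>] by linarith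
    then show ?thesis unfolding w_def using c by simp
  qed
  have iw: "integrable M w" unfolding w_def using iW by simp
  have ew: "expectation w = 1" unfolding w_def using iW c by (simp add: prob_space c_def)
  define D where "D = density M (\<lambda>\<omega>. ennreal (w \<omega>))"
  have "emeasure D (space D) = 1"
    unfolding D_def using nn_integral_eq_integral[OF iw] w0 ew
    by (simp add: emeasure_density cong: nn_integral_cong)
  then interpret D: prob_space D by (rule prob_spaceI)
  have [simp]: "measurable D N = measurable M N" for N :: "'z measure" by (intro measurable_cong_sets) (simp_all add: D_def)
  have sp: "space D = space M" by (simp add: D_def)
  have "distr D borel X = distr M borel X"
  proof (rule Levy_uniqueness)
    show "real_distribution (distr D borel X)" "real_distribution (distr M borel X)"
      by (auto intro!: D.real_distribution_distr real_distribution_distr)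
    show "char (distr D borel X) = char (distr M borel X)"
    proof
      fix u
      have "char (distr D borel X) u = (CLINT \<omega>|D. iexp (u * X \<omega>))"
        by (simp add: char_def integral_distr)
      also have "\<dots> = (CLINT \<omega>|M. w \<omega> *\<^sub>R iexp (u * X \<omega>))"
        unfolding D_def using w0 by (subst integral_density) auto
      also have "\<dots> = (CLINT \<omega>|M. (W \<omega> * iexp (u * X \<omega>) + (K + 1) * iexp (u * X \<omega>)) / c)"
        by (intro Bochner_Integration.integral_cong)
          (auto simp: w_def scaleR_conv_of_real field_simps add_divide_distrib)
      also have "\<dots> = (complex_of_real (expectation W) * (CLINT \<omega>|M. iexp (u * X \<omega>))
          + (K + 1) * (CLINT \<omega>|M. iexp (u * X \<omega>))) / c"
        using iX iWX ch[of u] by simp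
      also have "\<dots> = (CLINT \<omega>|M. iexp (u * X \<omega>)) * ((expectation W + K + 1) / c)"
        by (simp add: field_simps add_divide_distrib)
      also have "\<dots> = char (distr M borel X) u"
        using c by (simp add: c_def char_def integral_distr)
      finally show "char (distr D borel X) u = char (distr M borel X) u" .
    qed
  qed
  then have "measure (distr D borel X) A = measure (distr M borel X) A" by simp
  moreover have "measure (distr D borel X) A = (LINT \<omega>|D. indicator A (X \<omega>))"
    by (subst integral_indicator_vimage) (auto simp: measure_distr sp)
  moreover have "(LINT \<omega>|D. indicator A (X \<omega>)) = (LINT \<omega>|M. w \<omega> * indicator A (X \<omega>))"
    unfolding D_def using w0 by (subst integral_density) auto
  moreover have "measure (distr M borel X) A = (LINT \<omega>|M. indicator A (X \<omega>))"
    by (subst integral_indicator_vimage) (auto simp: measure_distr)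
  moreover have iI: "integrable M (\<lambda>\<omega>. indicator A (X \<omega>) :: real)"
    by (intro integrable_const_bound[of _ 1]) auto
  moreover have iWI: "integrable M (\<lambda>\<omega>. W \<omega> * indicator A (X \<omega>))"
    using bd K0 by (intro integrable_const_bound[of _ K]) (auto simp: indicator_def)
  moreover have "(LINT \<omega>|M. w \<omega> * indicator A (X \<omega>))
      = ((LINT \<omega>|M. W \<omega> * indicator A (X \<omega>)) + (K + 1) * (LINT \<omega>|M. indicator A (X \<omega>))) / c"
  proof -
    have "(LINT \<omega>|M. w \<omega> * indicator A (X \<omega>))
      = (LINT \<omega>|M. (W \<omega> * indicator A (X \<omega>) + (K + 1) * indicator A (X \<omega>)) / c)"
      by (intro Bochner_Integration.integral_cong) (auto simp: w_def field_simps)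
    then show ?thesis using iI iWI by simp
  qed
  ultimately show ?thesis using c by (simp add: field_simps c_def)
qed

text \<open>Conjugating the hypothesis at \<open>- u\<close> shows that \<open>cnj Z\<close>
  satisfies it too; half-sums and half-differences then reduce the claim to the real weights
  \<open>Re Z\<close> and \<open>Im Z\<close>.\<close>

lemma (in prob_space) weighted_law_eqI_char_complex:
  fixes X :: "'a \<Rightarrow> real" and Z :: "'a \<Rightarrow> complex"
  assumes X [measurable]: "X \<in> borel_measurable M" and Z [measurable]: "Z \<in> borel_measurable M"
    and bd: "\<And>\<omega>. norm (Z \<omega>) \<le> K"
    and ch: "\<And>u. (CLINT \<omega>|M. Z \<omega> * iexp (u * X \<omega>)) = (CLINT \<omega>|M. Z \<omega>) * (CLINT \<omega>|M. iexp (u * X \<omega>))"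
    and A [measurable]: "A \<in> sets borel"
  shows "(CLINT \<omega>|M. Z \<omega> * indicator A (X \<omega>)) = (CLINT \<omega>|M. Z \<omega>) * of_real (LINT \<omega>|M. indicator A (X \<omega>))"
proof -
  have iZ: "integrable M Z" using bd by (intro integrable_const_bound[of _ K]) auto
  have iZX: "integrable M (\<lambda>\<omega>. Z \<omega> * iexp (u * X \<omega>))" for u
    using bd by (intro integrable_const_bound[of _ K]) (auto simp: norm_mult)
  have [measurable]: "(\<lambda>\<omega>. cnj (Z \<omega>)) \<in> borel_measurable M"
    using iZ by (intro borel_measurable_integrable integrable_cnj)
  have ch': "(CLINT \<omega>|M. cnj (Z \<omega>) * iexp (u * X \<omega>)) = cnj (CLINT \<omega>|M. Z \<omega>) * (CLINT \<omega>|M. iexp (u * X \<omega>))" for u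
  proof -
    have "(CLINT \<omega>|M. cnj (Z \<omega>) * iexp (u * X \<omega>)) = cnj (CLINT \<omega>|M. Z \<omega> * iexp (- u * X \<omega>))"
      by (subst Bochner_Integration.integral_cnj[symmetric]) (simp add: exp_cnj)
    also have "\<dots> = cnj (CLINT \<omega>|M. Z \<omega>) * cnj (CLINT \<omega>|M. iexp (- u * X \<omega>))"
      by (subst ch) simp
    also have "cnj (CLINT \<omega>|M. iexp (- u * X \<omega>)) = (CLINT \<omega>|M. iexp (u * X \<omega>))"
      by (subst Bochner_Integration.integral_cnj[symmetric]) (simp add: exp_cnj)
    finally show ?thesis .
  qed
  have iZX': "integrable M (\<lambda>\<omega>. cnj (Z \<omega>) * iexp (u * X \<omega>))" for u
    using bd by (intro integrable_const_bound[of _ K]) (auto simp: norm_mult)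
  have re: "(LINT \<omega>|M. Re (Z \<omega>) * indicator A (X \<omega>)) = (LINT \<omega>|M. Re (Z \<omega>)) * (LINT \<omega>|M. indicator A (X \<omega>))"
  proof (rule weighted_law_eqI_char[where K=K])
    show "\<bar>Re (Z \<omega>)\<bar> \<le> K" for \<omega> using abs_Re_le_cmod[of "Z \<omega>"] bd[of \<omega>] by linarith
    fix u
    have "(CLINT \<omega>|M. Re (Z \<omega>) * iexp (u * X \<omega>))
        = (CLINT \<omega>|M. (Z \<omega> * iexp (u * X \<omega>) + cnj (Z \<omega>) * iexp (u * X \<omega>)) / 2)"
      by (intro Bochner_Integration.integral_cong) (auto simp: complex_eq_iff field_simps)
    also have "\<dots> = ((CLINT \<omega>|M. Z \<omega>) + cnj (CLINT \<omega>|M. Z \<omega>)) / 2 * (CLINT \<omega>|M. iexp (u * X \<omega>))"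
      by (subst integral_divide_zero, subst Bochner_Integration.integral_add[OF iZX iZX'], subst ch, subst ch')
        (simp add: field_simps)
    also have "((CLINT \<omega>|M. Z \<omega>) + cnj (CLINT \<omega>|M. Z \<omega>)) / 2 = (LINT \<omega>|M. Re (Z \<omega>))"
      using iZ by (simp add: complex_eq_iff)
    finally show "(CLINT \<omega>|M. Re (Z \<omega>) * iexp (u * X \<omega>)) = (LINT \<omega>|M. Re (Z \<omega>)) * (CLINT \<omega>|M. iexp (u * X \<omega>))" .
  qed (auto)
  have im: "(LINT \<omega>|M. Im (Z \<omega>) * indicator A (X \<omega>)) = (LINT \<omega>|M. Im (Z \<omega>)) * (LINT \<omega>|M. indicator A (X \<omega>))"
  proof (rule weighted_law_eqI_char[where K=K])
    show "\<bar>Im (Z \<omega>)\<bar> \<le> K" for \<omega> using abs_Im_le_cmod[of "Z \<omega>"] bd[of \<omega>] by linarith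
    fix u
    have "(CLINT \<omega>|M. Im (Z \<omega>) * iexp (u * X \<omega>))
        = (CLINT \<omega>|M. (Z \<omega> * iexp (u * X \<omega>) - cnj (Z \<omega>) * iexp (u * X \<omega>)) / (2 * \<i>))"
      by (intro Bochner_Integration.integral_cong) (auto simp: complex_diff_cnj left_diff_distrib[symmetric] complex_eq_iff)
    also have "\<dots> = ((CLINT \<omega>|M. Z \<omega>) - cnj (CLINT \<omega>|M. Z \<omega>)) / (2 * \<i>) * (CLINT \<omega>|M. iexp (u * X \<omega>))"
      by (subst integral_divide_zero, subst Bochner_Integration.integral_diff[OF iZX iZX'], subst ch, subst ch')
        (simp add: field_simps)
    also have "((CLINT \<omega>|M. Z \<omega>) - cnj (CLINT \<omega>|M. Z \<omega>)) / (2 * \<i>) = (LINT \<omega>|M. Im (Z \<omega>))"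
      using iZ by (simp add: complex_diff_cnj complex_eq_iff)
    finally show "(CLINT \<omega>|M. Im (Z \<omega>) * iexp (u * X \<omega>)) = (LINT \<omega>|M. Im (Z \<omega>)) * (CLINT \<omega>|M. iexp (u * X \<omega>))" .
  qed (auto)
  have iZI: "integrable M (\<lambda>\<omega>. Z \<omega> * indicator A (X \<omega>))"
    using bd order_trans[OF norm_ge_zero bd] by (intro integrable_const_bound[of _ K]) (auto simp: indicator_def)
  have r: "Re (indicator A x) = indicator A x" "Im (indicator A x) = 0" for x
    by (auto simp: indicator_def)
  show ?thesis
    using re im iZ iZI by (simp add: complex_eq_iff r flip: Bochner_Integration.integral_Re Bochner_Integration.integral_Im)
qed

text \<open>Kac's criterion. Exponentials are exchanged for indicators one index at a time; at each
  exchange the remaining factors form a bounded complex weight for the preceding lemma.\<close>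

lemma (in prob_space) indep_varsI_char:
  fixes X :: "'i \<Rightarrow> 'a \<Rightarrow> real"
  assumes fin: "finite I" and rv: "\<And>i. i \<in> I \<Longrightarrow> random_variable borel (X i)"
    and ch: "\<And>c. (CLINT \<omega>|M. iexp (\<Sum>i\<in>I. c i * X i \<omega>)) = (\<Prod>i\<in>I. CLINT \<omega>|M. iexp (c i * X i \<omega>))"
  shows "indep_vars (\<lambda>_. borel) X I"
proof (cases "I = {}")
  case True
  then show ?thesis by (simp add: indep_vars_def indep_sets_def)
next
  case False
  define P where "P i B = (LINT \<omega>|M. indicator B (X i \<omega>) :: real)" for i B
  have Pp: "P i B = prob (X i -` B \<inter> space M)" if "i \<in> I" "B \<in> sets borel" for i B
    unfolding P_def using that rv by (intro integral_indicator_vimage) auto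
  \<comment> \<open>\<open>J\<close> holds the indices that already carry indicators. The
    coefficients are arbitrary in the induction because its step uses them at
    \<open>c(k := u)\<close> for every \<open>u\<close>.\<close>
  have main: "(CLINT \<omega>|M. (\<Prod>i\<in>J. indicator (A i) (X i \<omega>)) * iexp (\<Sum>i\<in>I-J. c i * X i \<omega>))
      = (\<Prod>i\<in>J. of_real (P i (A i))) * (\<Prod>i\<in>I-J. CLINT \<omega>|M. iexp (c i * X i \<omega>))"
    if "finite J" "J \<subseteq> I" and A: "\<And>i. i \<in> I \<Longrightarrow> A i \<in> sets borel" for J A c
    using \<open>finite J\<close> \<open>J \<subseteq> I\<close>
  proof (induction J arbitrary: c rule: finite_induct)
    case empty
    then show ?case using ch[of c] by simp
  next
    case (insert k J)
    then have kI: "k \<in> I" and JI: "J \<subseteq> I" by auto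
    have [measurable]: "X k \<in> borel_measurable M" "A k \<in> sets borel" using kI rv A by auto
    have rvI [measurable]: "X i \<in> borel_measurable M" if "i \<in> J" for i using that rv JI by auto
    have rvI' [measurable]: "X i \<in> borel_measurable M" if "i \<in> I - insert k J" for i using that rv by auto
    have AI [measurable]: "A i \<in> sets borel" if "i \<in> J" for i using that A JI by auto
    let ?R = "I - insert k J"
    define Z where "Z \<omega> = (\<Prod>i\<in>J. indicator (A i) (X i \<omega>)) * iexp (\<Sum>i\<in>?R. c i * X i \<omega>)" for \<omega>
    have split: "I - J = insert k ?R" "k \<notin> ?R" "finite ?R" using kI insert.hyps fin by auto
    have IH: "(CLINT \<omega>|M. Z \<omega> * iexp (u * X k \<omega>)) = (\<Prod>i\<in>J. of_real (P i (A i))) *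
        ((CLINT \<omega>|M. iexp (u * X k \<omega>)) * (\<Prod>i\<in>?R. CLINT \<omega>|M. iexp (c i * X i \<omega>)))" for u
    proof -
      have s: "(\<Sum>i\<in>I-J. (c(k:=u)) i * X i \<omega>) = u * X k \<omega> + (\<Sum>i\<in>?R. c i * X i \<omega>)" for \<omega>
        unfolding split(1) using split(2,3) by (subst sum.insert) (auto intro!: sum.cong)
      have p: "(\<Prod>i\<in>I-J. CLINT \<omega>|M. iexp ((c(k:=u)) i * X i \<omega>))
          = (CLINT \<omega>|M. iexp (u * X k \<omega>)) * (\<Prod>i\<in>?R. CLINT \<omega>|M. iexp (c i * X i \<omega>))"
        unfolding split(1) using split(2,3) by (subst prod.insert) (auto intro!: prod.cong)
      have "(CLINT \<omega>|M. Z \<omega> * iexp (u * X k \<omega>))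
          = (CLINT \<omega>|M. (\<Prod>i\<in>J. indicator (A i) (X i \<omega>)) * iexp (\<Sum>i\<in>I-J. (c(k:=u)) i * X i \<omega>))"
        by (intro Bochner_Integration.integral_cong) (auto simp: Z_def s[simplified] exp_add ring_distribs)
      then show ?thesis using insert.IH[OF JI, of "c(k:=u)"] unfolding p by simp
    qed
    have Z0: "(CLINT \<omega>|M. Z \<omega>) = (\<Prod>i\<in>J. of_real (P i (A i))) * (\<Prod>i\<in>?R. CLINT \<omega>|M. iexp (c i * X i \<omega>))"
      using IH[of 0] by (simp add: prob_space)
    have "(CLINT \<omega>|M. Z \<omega> * indicator (A k) (X k \<omega>)) = (CLINT \<omega>|M. Z \<omega>) * of_real (P k (A k))"
      unfolding P_def
    proof (rule weighted_law_eqI_char_complex[where K=1])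
      show "Z \<in> borel_measurable M" unfolding Z_def by measurable
      show "norm (Z \<omega>) \<le> 1" for \<omega>
        unfolding Z_def by (auto simp: norm_mult prod_norm[symmetric] indicator_def intro!: prod_le_1)
      show "(CLINT \<omega>|M. Z \<omega> * iexp (u * X k \<omega>)) = (CLINT \<omega>|M. Z \<omega>) * (CLINT \<omega>|M. iexp (u * X k \<omega>))" for u
        unfolding IH Z0 by (simp add: ac_simps)
    qed auto
    then show ?case using insert.hyps unfolding Z0 by (simp add: Z_def ac_simps)
  qed
  show ?thesis
  proof (subst indep_vars_finite[where E="\<lambda>_. sets borel"])
    show "Int_stable (sets (borel :: real measure))" by (auto simp: Int_stable_def)
    show "\<forall>A\<in>\<Pi> i\<in>I. sets borel. prob (\<Inter>j\<in>I. X j -` A j \<inter> space M) = (\<Prod>j\<in>I. prob (X j -` A j \<inter> space M))"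
    proof
      fix A assume A: "A \<in> (\<Pi> i\<in>I. sets (borel :: real measure))"
      have [measurable]: "A i \<in> sets borel" "X i \<in> borel_measurable M" if "i \<in> I" for i
        using A that rv by auto
      have ind: "indicator (\<Inter>j\<in>I. X j -` A j \<inter> space M) \<omega> = (\<Prod>i\<in>I. indicator (A i) (X i \<omega>) :: real)"
        if "\<omega> \<in> space M" for \<omega>
        using that fin False by (auto simp: indicator_def prod_eq_1_iff)
      have "(\<Inter>j\<in>I. X j -` A j \<inter> space M) \<in> sets M"
        using fin False by (intro sets.finite_INT measurable_sets[OF rv]) (use A in auto)
      then have "prob (\<Inter>j\<in>I. X j -` A j \<inter> space M) = (LINT \<omega>|M. indicator (\<Inter>j\<in>I. X j -` A j \<inter> space M) \<omega>)"
        by simp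
      also have "\<dots> = (LINT \<omega>|M. (\<Prod>i\<in>I. indicator (A i) (X i \<omega>)))"
        by (intro Bochner_Integration.integral_cong ind) auto
      finally have "complex_of_real (prob (\<Inter>j\<in>I. X j -` A j \<inter> space M)) = (CLINT \<omega>|M. of_real (\<Prod>i\<in>I. indicator (A i) (X i \<omega>)))"
        by (simp only: integral_complex_of_real)
      also have "\<dots> = (CLINT \<omega>|M. (\<Prod>i\<in>I. indicator (A i) (X i \<omega>)))"
        by (intro Bochner_Integration.integral_cong) (auto simp: of_real_prod indicator_def intro!: prod.cong)
      also have "\<dots> = complex_of_real (\<Prod>i\<in>I. P i (A i))"
        using main[of I A "\<lambda>_. 0"] A fin by (auto simp: of_real_prod)
      finally show "prob (\<Inter>j\<in>I. X j -` A j \<inter> space M) = (\<Prod>j\<in>I. prob (X j -` A j \<inter> space M))"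
        using A by (simp only: of_real_eq_iff) (auto intro!: prod.cong Pp)
    qed
  qed (use fin False rv in \<open>auto simp: sets.sigma_sets_eq[of borel, simplified]\<close>)
qed

section \<open>Gaussian measures\<close>

lemma char_normal_density:
  assumes "\<sigma> > 0"
  shows "(CLINT x|density lborel (normal_density a \<sigma>). iexp (t * x)) = iexp (t * a) * exp (- (t * \<sigma>)\<^sup>2 / 2)"
proof -
  interpret prob_space std_normal_distribution by (rule prob_space_normal_density) simp
  have "distributed std_normal_distribution lborel (\<lambda>x. x) (normal_density 0 1)"
    by (auto simp: distributed_def distr_id2)
  from normal_density_affine[OF this, of \<sigma> a] assms
  have "distributed std_normal_distribution lborel (\<lambda>x. a + \<sigma> * x) (normal_density a \<sigma>)" by simp
  then have d: "density lborel (normal_density a \<sigma>) = distr std_normal_distribution lborel (\<lambda>x. a + \<sigma> * x)"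
    by (simp add: distributed_def)
  have "(CLINT x|density lborel (normal_density a \<sigma>). iexp (t * x)) = (CLINT x|std_normal_distribution. iexp (t * (a + \<sigma> * x)))"
    unfolding d by (subst integral_distr) auto
  also have "\<dots> = (CLINT x|std_normal_distribution. iexp (t * a) * iexp ((t * \<sigma>) * x))"
    by (intro Bochner_Integration.integral_cong) (auto simp: exp_add[symmetric] algebra_simps)
  also have "\<dots> = iexp (t * a) * char std_normal_distribution (t * \<sigma>)"
    unfolding char_def by (rule integral_mult_right_zero)
  finally show ?thesis by (simp add: char_std_normal_distribution)
qed

locale gaussian_measure =
  fixes m :: "'a::{real_inner,second_countable_topology}" and C :: "'a \<Rightarrow>\<^sub>L 'a" and \<mu> :: "'a measure"
  assumes gaussian: "is_gaussian m C \<mu>" and sym_pos: "sym_pos_op C"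
begin

sublocale prob_space \<mu> using gaussian by (simp add: is_gaussian_def)

lemma sets_eq [simp, measurable_cong]: "sets \<mu> = sets borel"
  using gaussian by (simp add: is_gaussian_def)

lemma space_eq [simp]: "space \<mu> = UNIV"
  using sets_eq_imp_space_eq[OF sets_eq] by simp

lemma variance_nonneg [simp]: "0 \<le> inner (C h) h"
  using sym_pos unfolding sym_pos_op_def by blast

lemma symmetric: "inner (C x) y = inner (C y) x"
  using sym_pos unfolding sym_pos_op_def by (metis inner_commute)

lemma distr_centered:
  "distr \<mu> borel (\<lambda>x. inner h (x - m)) =
    (if inner (C h) h = 0 then return borel 0 else density lborel (normal_density 0 (sqrt (inner (C h) h))))"
proof -
  let ?v = "inner (C h) h"
  let ?D = "distr \<mu> borel (\<lambda>x. inner h x)"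
  have d: "?D = (if ?v = 0 then return borel (inner h m) else density lborel (normal_density (inner h m) (sqrt ?v)))"
    using gaussian by (simp add: is_gaussian_def Let_def)
  have e: "distr \<mu> borel (\<lambda>x. inner h (x - m)) = distr ?D borel (\<lambda>r. r - inner h m)"
    by (subst distr_distr) (auto simp: o_def inner_diff_right)
  show ?thesis
  proof (cases "?v = 0")
    case True
    then show ?thesis unfolding e d by (simp add: distr_return)
  next
    case False
    then have v: "sqrt ?v > 0" by (metis less_eq_real_def real_sqrt_gt_0_iff variance_nonneg)
    interpret D: prob_space "density lborel (normal_density (inner h m) (sqrt ?v))"
      by (rule prob_space_normal_density) fact
    have "distributed (density lborel (normal_density (inner h m) (sqrt ?v))) lborel (\<lambda>x. x) (normal_density (inner h m) (sqrt ?v))"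
      by (auto simp: distributed_def distr_id2)
    from D.normal_density_affine[OF this v, of 1 "- inner h m"]
    have "distr (density lborel (normal_density (inner h m) (sqrt ?v))) lborel (\<lambda>x. - inner h m + x)
      = density lborel (normal_density 0 (sqrt ?v))" by (simp add: distributed_def)
    moreover have "distr (density lborel (normal_density (inner h m) (sqrt ?v))) lborel (\<lambda>x. - inner h m + x)
      = distr (density lborel (normal_density (inner h m) (sqrt ?v))) borel (\<lambda>x. - inner h m + x)"
      by (intro distr_cong) auto
    ultimately show ?thesis unfolding e d using False by simp
  qed
qed

text \<open>\<open>is_gaussian\<close> prescribes one-dimensional marginals only; this formula,
  valid for every \<open>h\<close>, is what yields the joint laws of several functionals.\<close>

lemma char_centered: "(CLINT x|\<mu>. iexp (inner h (x - m))) = of_real (exp (- inner (C h) h / 2))"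
proof -
  have "(CLINT x|\<mu>. iexp (inner h (x - m))) = (CLINT r|distr \<mu> borel (\<lambda>x. inner h (x - m)). iexp r)"
    by (subst integral_distr) auto
  also have "\<dots> = of_real (exp (- inner (C h) h / 2))"
  proof (cases "inner (C h) h = 0")
    case True
    then show ?thesis unfolding distr_centered by (simp add: integral_return)
  next
    case False
    then have "sqrt (inner (C h) h) > 0" by (metis less_eq_real_def real_sqrt_gt_0_iff variance_nonneg)
    from char_normal_density[OF this, where t=1 and a=0] False show ?thesis
      unfolding distr_centered by (simp add: exp_of_real)
  qed
  finally show ?thesis .
qed

lemma second_moment_bochner:
  "has_bochner_integral \<mu> (\<lambda>x. inner h (x - m)) 0"
  "has_bochner_integral \<mu> (\<lambda>x. (inner h (x - m))\<^sup>2) (inner (C h) h)"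
proof -
  let ?v = "inner (C h) h"
  have "has_bochner_integral (distr \<mu> borel (\<lambda>x. inner h (x - m))) (\<lambda>r. r) 0 \<and>
    has_bochner_integral (distr \<mu> borel (\<lambda>x. inner h (x - m))) (\<lambda>r. r\<^sup>2) ?v"
  proof (cases "?v = 0")
    case True
    then show ?thesis unfolding distr_centered
      by (auto simp: has_bochner_integral_iff integral_return integrable_iff_bounded nn_integral_return)
  next
    case False
    then have v: "sqrt ?v > 0" by (metis less_eq_real_def real_sqrt_gt_0_iff variance_nonneg)
    show ?thesis unfolding distr_centered
      using normal_moment_even[OF v, of 0 1] normal_moment_odd[OF v, of 0 0] False
      by (auto intro!: has_bochner_integral_density)
  qed
  then show "has_bochner_integral \<mu> (\<lambda>x. inner h (x - m)) 0"
    "has_bochner_integral \<mu> (\<lambda>x. (inner h (x - m))\<^sup>2) ?v"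
    by (auto simp: has_bochner_integral_iff integrable_distr_eq integral_distr)
qed

lemma integrable_linear [simp, intro]: "integrable \<mu> (\<lambda>x. inner h (x - m))"
  and integral_linear [simp]: "(\<integral>x. inner h (x - m) \<partial>\<mu>) = 0"
  and integrable_square [simp, intro]: "integrable \<mu> (\<lambda>x. (inner h (x - m))\<^sup>2)"
  and integral_square [simp]: "(\<integral>x. (inner h (x - m))\<^sup>2 \<partial>\<mu>) = inner (C h) h"
  using second_moment_bochner[of h] by (auto simp: has_bochner_integral_iff)

text \<open>The exponent of the characteristic functional at a linear combination is a quadratic
  form without mixed terms, so the functional factorises as \<open>indep_varsI_char\<close>
  asks.\<close>

lemma indep_vars_uncorrelated:
  assumes fin: "finite I" and u: "\<And>i j. i \<in> I \<Longrightarrow> j \<in> I \<Longrightarrow> i \<noteq> j \<Longrightarrow> inner (C (u i)) (u j) = 0"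
  shows "indep_vars (\<lambda>_. borel) (\<lambda>i x. inner (u i) (x - m)) I"
proof (rule indep_varsI_char[OF fin])
  fix c :: "_ \<Rightarrow> real"
  have q: "inner (C (\<Sum>i\<in>I. c i *\<^sub>R u i)) (\<Sum>i\<in>I. c i *\<^sub>R u i) = (\<Sum>i\<in>I. (c i)\<^sup>2 * inner (C (u i)) (u i))"
  proof -
    have "inner (C (\<Sum>i\<in>I. c i *\<^sub>R u i)) (\<Sum>i\<in>I. c i *\<^sub>R u i)
        = (\<Sum>i\<in>I. \<Sum>j\<in>I. c i * (c j * inner (C (u i)) (u j)))"
      by (simp only: blinfun.sum_right blinfun.scaleR_right inner_sum_left)
        (simp add: inner_sum_right sum_distrib_left mult.left_commute)
    also have "\<dots> = (\<Sum>i\<in>I. \<Sum>j\<in>I. if i = j then (c i)\<^sup>2 * inner (C (u i)) (u i) else 0)"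
      by (intro sum.cong) (auto simp: u power2_eq_square)
    also have "\<dots> = (\<Sum>i\<in>I. (c i)\<^sup>2 * inner (C (u i)) (u i))" using fin by simp
    finally show ?thesis .
  qed
  have "(CLINT x|\<mu>. iexp (\<Sum>i\<in>I. c i * inner (u i) (x - m))) = (CLINT x|\<mu>. iexp (inner (\<Sum>i\<in>I. c i *\<^sub>R u i) (x - m)))"
    by (simp only: inner_sum_left inner_scaleR_left)
  also have "\<dots> = of_real (exp (- (\<Sum>i\<in>I. (c i)\<^sup>2 * inner (C (u i)) (u i)) / 2))"
    unfolding char_centered q ..
  also have "\<dots> = (\<Prod>i\<in>I. of_real (exp (- ((c i)\<^sup>2 * inner (C (u i)) (u i)) / 2)))"
    using fin by (simp add: exp_sum[symmetric] sum_negf sum_divide_distrib flip: of_real_prod)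
  also have "\<dots> = (\<Prod>i\<in>I. CLINT x|\<mu>. iexp (c i * inner (u i) (x - m)))"
  proof (rule prod.cong[OF refl])
    fix i
    have "(CLINT x|\<mu>. iexp (c i * inner (u i) (x - m))) = (CLINT x|\<mu>. iexp (inner (c i *\<^sub>R u i) (x - m)))"
      by (simp only: inner_scaleR_left)
    then show "of_real (exp (- ((c i)\<^sup>2 * inner (C (u i)) (u i)) / 2)) = (CLINT x|\<mu>. iexp (c i * inner (u i) (x - m)))"
      by (simp only: char_centered) (simp add: blinfun.scaleR_right power2_eq_square mult.assoc)
  qed
  finally show "(CLINT x|\<mu>. iexp (\<Sum>i\<in>I. c i * inner (u i) (x - m))) = (\<Prod>i\<in>I. CLINT x|\<mu>. iexp (c i * inner (u i) (x - m)))" .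
qed auto

end

section \<open>Orthonormal bases and traces\<close>

text \<open>Distinct basis vectors have distance sqrt 2, so the balls of radius 1/2 around them are
  disjoint open sets, of which a second countable space has only countably many.\<close>

lemma orthonormal_basis_countable:
  fixes B :: "'a::{real_inner,second_countable_topology} set"
  assumes "orthonormal_basis B"
  shows "countable B"
proof -
  have far: "dist e f \<ge> 1" if "e \<in> B" "f \<in> B" "e \<noteq> f" for e f
  proof -
    have "(norm (e - f))\<^sup>2 = 2"
      using that assms by (simp add: orthonormal_basis_def power2_norm_eq_inner inner_diff inner_commute norm_eq_1)
    then have "1 \<le> (norm (e - f))\<^sup>2" by simp
    then show ?thesis by (simp add: dist_norm power2_nonneg_ge_1_iff)
  qed
  have disj: "ball e (1/2) \<inter> ball f (1/2) = {}" if "e \<in> B" "f \<in> B" "e \<noteq> f" for e f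
  proof -
    { fix x assume "dist e x < 1/2" "dist f x < 1/2"
      then have "dist e f < 1" using dist_triangle2[of e f x] by linarith
      with far[OF that] have False by simp }
    then show ?thesis by auto
  qed
  have "countable ((\<lambda>e. ball e (1/2)) ` B)"
  proof (rule countable_disjoint_open_subsets)
    show "disjoint ((\<lambda>e. ball e (1/2)) ` B)"
      unfolding pairwise_def disjnt_def using disj by blast
  qed auto
  moreover have "inj_on (\<lambda>e. ball e (1/2)) B"
    by (intro inj_onI) (metis disj Int_absorb ball_eq_empty not_le half_gt_zero_iff zero_less_one)
  ultimately show ?thesis by (rule countable_image_inj_on)
qed

text \<open>Basis sums are treated as limits along one increasing sequence of finite sets, so that
  the traces of several operators can be compared partial sum by partial sum.\<close>

definition exhausts :: "(nat \<Rightarrow> 'a set) \<Rightarrow> 'a set \<Rightarrow> bool" where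
  "exhausts F B \<longleftrightarrow> (\<forall>n. finite (F n)) \<and> incseq F \<and> (\<Union>n. F n) = B"

lemma countable_exhausts:
  assumes "countable B"
  obtains F where "exhausts F B"
proof
  let ?F = "\<lambda>n. {e \<in> B. to_nat_on B e < n}"
  have "finite (?F n)" for n
  proof (rule finite_imageD)
    show "finite (to_nat_on B ` ?F n)" by (rule finite_subset[of _ "{..<n}"]) auto
    show "inj_on (to_nat_on B) (?F n)" using inj_on_to_nat_on[OF assms] by (rule inj_on_subset) auto
  qed
  moreover have "incseq ?F" by (auto simp: incseq_def)
  moreover have "(\<Union>n. ?F n) = B" by auto
  ultimately show "exhausts ?F B" by (simp add: exhausts_def)
qed

lemma orthonormal_expansion_inner:
  assumes "orthonormal_basis B" "finite F" "F \<subseteq> B" "f \<in> F"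
  shows "inner f (x - (\<Sum>e\<in>F. inner e x *\<^sub>R e)) = 0"
proof -
  have "inner f e = (if e = f then 1 else 0)" if "e \<in> F" for e
    using assms that unfolding orthonormal_basis_def norm_eq_1 by (metis subsetD)
  then have "(\<Sum>e\<in>F. inner e x * inner f e) = (\<Sum>e\<in>F. if e = f then inner f x else 0)"
    by (intro sum.cong) auto
  then show ?thesis using assms by (simp add: inner_diff_right inner_sum_right)
qed

lemma bessel_identity:
  assumes "orthonormal_basis B" "finite F" "F \<subseteq> B"
  shows "(norm (x - (\<Sum>e\<in>F. inner e x *\<^sub>R e)))\<^sup>2 = (norm x)\<^sup>2 - (\<Sum>e\<in>F. (inner e x)\<^sup>2)"
proof -
  let ?r = "x - (\<Sum>e\<in>F. inner e x *\<^sub>R e)"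
  have "inner (\<Sum>e\<in>F. inner e x *\<^sub>R e) ?r = 0"
    unfolding inner_sum_left inner_scaleR_left
    by (intro sum.neutral ballI) (simp add: orthonormal_expansion_inner[OF assms])
  then have "(norm ?r)\<^sup>2 = inner x ?r"
    by (simp add: power2_norm_eq_inner inner_diff_left)
  then show ?thesis
    by (simp add: inner_diff_right inner_sum_right dot_square_norm power2_eq_square inner_commute)
qed

lemma bessel_inequality:
  assumes "orthonormal_basis B" "finite F" "F \<subseteq> B"
  shows "(\<Sum>e\<in>F. (inner e x)\<^sup>2) \<le> (norm x)\<^sup>2"
  using bessel_identity[OF assms, of x] zero_le_power2[of "norm (x - (\<Sum>e\<in>F. inner e x *\<^sub>R e))"] by linarith

lemma orthonormal_best_approximation:
  assumes "orthonormal_basis B" "finite F" "F \<subseteq> B" and y: "y \<in> span F"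
  shows "norm (x - (\<Sum>e\<in>F. inner e x *\<^sub>R e)) \<le> norm (x - y)"
proof -
  let ?p = "\<Sum>e\<in>F. inner e x *\<^sub>R e"
  have "inner z (x - ?p) = 0" if "z \<in> span F" for z
    using that
  proof (induction rule: span_induct_alt)
    case (step c b w)
    then show ?case using orthonormal_expansion_inner[OF assms(1-3)] by (simp add: inner_add_left)
  qed simp
  moreover have "?p - y \<in> span F"
    using y by (intro span_diff span_sum span_scale) (auto intro: span_base)
  ultimately have "inner (?p - y) (x - ?p) = 0" by blast
  then have "orthogonal (x - ?p) (?p - y)" unfolding orthogonal_def by (subst inner_commute)
  then have "(norm (x - y))\<^sup>2 = (norm (x - ?p))\<^sup>2 + (norm (?p - y))\<^sup>2"
    using norm_add_Pythagorean[of "x - ?p" "?p - y"] by simp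
  then show ?thesis by (simp add: power2_le_imp_le)
qed

text \<open>A point of \<open>span B\<close> near \<open>x\<close> uses finitely many basis vectors,
  so it lies in \<open>span (F N)\<close> for some \<open>N\<close>. The orthogonal projection is at
  least as close, and Bessel's identity turns its distance into the missing part of the sum.\<close>

lemma parseval_tendsto:
  assumes B: "orthonormal_basis B" and F: "exhausts F B"
  shows "(\<lambda>n. \<Sum>e\<in>F n. (inner e x)\<^sup>2) \<longlonglongrightarrow> (norm x)\<^sup>2"
proof (rule LIMSEQ_I)
  fix r :: real assume r: "r > 0"
  have FB: "finite (F n)" "F n \<subseteq> B" for n using F by (auto simp: exhausts_def)
  have "x \<in> closure (span B)" using B by (simp add: orthonormal_basis_def)
  then have "\<exists>y\<in>span B. dist y x < sqrt r" using r by (simp add: closure_approachable)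
  then obtain y where y: "y \<in> span B" "dist y x < sqrt r" by blast
  from y(1) obtain T where T: "finite T" "T \<subseteq> B" "y \<in> span T"
    by (auto simp: span_explicit)
  have "\<exists>N. T \<subseteq> F N"
    using T(1,2)
  proof (induction T rule: finite_induct)
    case (insert t T)
    then obtain N where N: "T \<subseteq> F N" by auto
    from insert.prems F obtain M where M: "t \<in> F M" by (auto simp: exhausts_def)
    have "F N \<subseteq> F (max N M)" "F M \<subseteq> F (max N M)"
      using F by (auto simp: exhausts_def incseq_def)
    with N M show ?case by (intro exI[of _ "max N M"]) auto
  qed simp
  then obtain N where N: "T \<subseteq> F N" ..
  show "\<exists>N. \<forall>n\<ge>N. norm ((\<Sum>e\<in>F n. (inner e x)\<^sup>2) - (norm x)\<^sup>2) < r"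
  proof (intro exI[of _ N] allI impI)
    fix n assume "N \<le> n"
    then have "F N \<subseteq> F n" using F by (auto simp: exhausts_def incseq_def)
    then have "y \<in> span (F n)" using T(3) N span_mono[of T "F n"] by auto
    then have "norm (x - (\<Sum>e\<in>F n. inner e x *\<^sub>R e)) \<le> norm (x - y)"
      by (rule orthonormal_best_approximation[OF B FB])
    also have "\<dots> < sqrt r" using y(2) by (simp add: dist_norm norm_minus_commute)
    finally have "(norm (x - (\<Sum>e\<in>F n. inner e x *\<^sub>R e)))\<^sup>2 < (sqrt r)\<^sup>2"
      by (intro power_strict_mono) auto
    then show "norm ((\<Sum>e\<in>F n. (inner e x)\<^sup>2) - (norm x)\<^sup>2) < r"
      using r bessel_inequality[OF B FB(1)[of n] FB(2)[of n], of x] by (simp add: bessel_identity[OF B FB])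
  qed
qed

text \<open>Monotone convergence applied to Parseval's identity, with \<open>S\<close> supplying
  integrability. It serves for traces, with \<open>\<Phi> x = x - m\<close>, and for the unresolved
  part \<open>resid\<close> of the source.\<close>

lemma parseval_integral:
  fixes \<Phi> :: "'b \<Rightarrow> 'a::{real_inner,second_countable_topology}"
  assumes B: "orthonormal_basis B" and F: "exhausts F B"
    and meas [measurable]: "\<Phi> \<in> borel_measurable M"
    and int: "\<And>e. e \<in> B \<Longrightarrow> integrable M (\<lambda>\<omega>. (inner e (\<Phi> \<omega>))\<^sup>2)"
    and bd: "\<And>n. (\<Sum>e\<in>F n. \<integral>\<omega>. (inner e (\<Phi> \<omega>))\<^sup>2 \<partial>M) \<le> S"
  shows "integrable M (\<lambda>\<omega>. (norm (\<Phi> \<omega>))\<^sup>2)" (is ?int)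
    and "(\<integral>\<omega>. (norm (\<Phi> \<omega>))\<^sup>2 \<partial>M) \<le> S" (is ?le)
    and "(\<lambda>n. \<Sum>e\<in>F n. \<integral>\<omega>. (inner e (\<Phi> \<omega>))\<^sup>2 \<partial>M) \<longlonglongrightarrow> (\<integral>\<omega>. (norm (\<Phi> \<omega>))\<^sup>2 \<partial>M)" (is ?lim)
proof -
  let ?s = "\<lambda>n. \<Sum>e\<in>F n. \<integral>\<omega>. (inner e (\<Phi> \<omega>))\<^sup>2 \<partial>M"
  have FB: "finite (F n)" "F n \<subseteq> B" for n using F by (auto simp: exhausts_def)
  have inc: "F n \<subseteq> F k" if "n \<le> k" for n k using F that by (auto simp: exhausts_def incseq_def)
  have "incseq ?s"
    by (intro monoI sum_mono2 FB inc) auto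
  then obtain L where L: "?s \<longlonglongrightarrow> L" using bd by (blast elim: incseq_convergent)
  have intn: "integrable M (\<lambda>\<omega>. \<Sum>e\<in>F n. (inner e (\<Phi> \<omega>))\<^sup>2)" for n
    using int FB by (intro Bochner_Integration.integrable_sum) auto
  have sn: "(\<integral>\<omega>. (\<Sum>e\<in>F n. (inner e (\<Phi> \<omega>))\<^sup>2) \<partial>M) = ?s n" for n
    using int FB by (intro Bochner_Integration.integral_sum) auto
  have mono: "mono (\<lambda>n. \<Sum>e\<in>F n. (inner e (\<Phi> \<omega>))\<^sup>2)" for \<omega>
    by (intro monoI sum_mono2 FB inc) auto
  have *: ?int "(\<integral>\<omega>. (norm (\<Phi> \<omega>))\<^sup>2 \<partial>M) = L"
    using integral_monotone_convergence_nonneg[of M "\<lambda>n \<omega>. \<Sum>e\<in>F n. (inner e (\<Phi> \<omega>))\<^sup>2" "\<lambda>\<omega>. (norm (\<Phi> \<omega>))\<^sup>2" L]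
    by (auto simp: intn sn L mono sum_nonneg parseval_tendsto[OF B F])
  show ?int by fact
  show ?lim using L * by simp
  show ?le using LIMSEQ_le_const2[OF L] bd *(2) by auto
qed

section \<open>The trace of the covariance as a second moment\<close>

context gaussian_measure
begin

lemma trace_partial_sum:
  assumes "orthonormal_basis B" "exhausts F B" "integrable \<mu> (\<lambda>x. (norm (x - m))\<^sup>2)"
  shows "(\<Sum>e\<in>F n. inner (C e) e) \<le> (\<integral>x. (norm (x - m))\<^sup>2 \<partial>\<mu>)"
proof -
  have FB: "finite (F n)" "F n \<subseteq> B" using assms(2) by (auto simp: exhausts_def)
  have "(\<Sum>e\<in>F n. inner (C e) e) = (\<integral>x. (\<Sum>e\<in>F n. (inner e (x - m))\<^sup>2) \<partial>\<mu>)"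
    by (subst Bochner_Integration.integral_sum) auto
  also have "\<dots> \<le> (\<integral>x. (norm (x - m))\<^sup>2 \<partial>\<mu>)"
    using assms(3) bessel_inequality[OF assms(1) FB] by (intro integral_mono Bochner_Integration.integrable_sum) auto
  finally show ?thesis .
qed

text \<open>The limit does not involve the basis. Thus the trace is basis independent, although
  \<open>trace_class_pos\<close> may provide a different basis for each operator.\<close>

lemma trace_tendsto:
  assumes "orthonormal_basis B" "exhausts F B" "integrable \<mu> (\<lambda>x. (norm (x - m))\<^sup>2)"
  shows "(\<lambda>n. \<Sum>e\<in>F n. inner (C e) e) \<longlonglongrightarrow> (\<integral>x. (norm (x - m))\<^sup>2 \<partial>\<mu>)"
  using parseval_integral(3)[OF assms(1,2), where \<Phi>="\<lambda>x. x - m" and M=\<mu> and S="\<integral>x. (norm (x - m))\<^sup>2 \<partial>\<mu>"] trace_partial_sum[OF assms] by simp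

lemma integrable_norm_square_bounded_trace:
  assumes "orthonormal_basis B" "exhausts F B" "\<And>n. (\<Sum>e\<in>F n. inner (C e) e) \<le> S"
  shows "integrable \<mu> (\<lambda>x. (norm (x - m))\<^sup>2)"
  using parseval_integral(1)[OF assms(1,2), of "\<lambda>x. x - m" \<mu> S] assms(3) by simp

lemma integrable_norm_square:
  assumes "trace_class_pos C"
  shows "integrable \<mu> (\<lambda>x. (norm (x - m))\<^sup>2)"
proof -
  from assms obtain B where B: "orthonormal_basis B" "(\<lambda>e. inner (C e) e) summable_on B"
    by (auto simp: trace_class_pos_def)
  from countable_exhausts[OF orthonormal_basis_countable[OF B(1)]] obtain F where F: "exhausts F B" .
  show ?thesis
    by (rule integrable_norm_square_bounded_trace[OF B(1) F finite_sum_le_infsum[OF B(2)]])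
      (use F in \<open>auto simp: exhausts_def\<close>)
qed

end

section \<open>Simultaneous diagonalisation of two forms\<close>

locale sym_form =
  fixes a :: "'v::real_vector \<Rightarrow> 'v \<Rightarrow> real"
  assumes sym: "a x y = a y x"
    and add_left: "a (x + y) z = a x z + a y z"
    and scale_left: "a (c *\<^sub>R x) z = c * a x z"
begin

lemma add_right: "a z (x + y) = a z x + a z y"
  and scale_right: "a z (c *\<^sub>R x) = c * a z x"
  using add_left[of x y z] scale_left[of c x z] sym by metis+

lemma zero_left: "a 0 z = 0"
  using scale_left[of 0 0 z] by simp

lemma diff_left: "a (x - y) z = a x z - a y z"
  using add_left[of "x - y" y z] by simp

lemma diff_right: "a z (x - y) = a z x - a z y"
  using diff_left[of x y z] sym by metis

lemma sum_left: "a (\<Sum>i\<in>I. f i) z = (\<Sum>i\<in>I. a (f i) z)"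
  by (induction I rule: infinite_finite_induct) (auto simp: zero_left add_left)

lemma sum_right: "a z (\<Sum>i\<in>I. f i) = (\<Sum>i\<in>I. a z (f i))"
  using sum_left[of f I z] by (simp only: sym[of z])

end

locale psd_form = sym_form +
  assumes nonneg: "0 \<le> a x x"
begin

text \<open>Otherwise the nonnegative form would be a nonconstant affine function of
  \<open>t\<close> along \<open>t *\<^sub>R x + y\<close>; the chosen \<open>t\<close> gives it the
  value -1.\<close>

lemma null_left:
  assumes "a x x = 0"
  shows "a x y = 0"
proof (rule ccontr)
  assume n: "a x y \<noteq> 0"
  define t where "t = - (a y y + 1) / (2 * a x y)"
  have "0 \<le> a (t *\<^sub>R x + y) (t *\<^sub>R x + y)" by (rule nonneg)
  also have "\<dots> = 2 * t * a x y + a y y"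
    using assms sym[of y x] by (simp add: add_left add_right scale_left scale_right)
  also have "\<dots> = -1" using n by (simp add: t_def field_simps)
  finally show False by simp
qed

text \<open>The form may be degenerate, so membership in a span is replaced by a Parseval identity:
  each element of \<open>D\<close> is a combination of the \<open>u i\<close> up to a null
  vector.\<close>

lemma gram_schmidt:
  assumes "finite D"
  shows "\<exists>n u. (\<forall>i<n. \<forall>j<n. a (u i) (u j) = (if i = j then 1 else 0))
    \<and> (\<forall>d\<in>D. a d d = (\<Sum>i<n::nat. (a d (u i))\<^sup>2))"
  using assms
proof (induction D rule: finite_induct)
  case empty
  show ?case by (intro exI[of _ 0]) auto
next
  case (insert d D)
  then obtain n :: nat and u where on: "\<And>i j. i < n \<Longrightarrow> j < n \<Longrightarrow> a (u i) (u j) = (if i = j then 1 else 0)"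
    and D: "\<And>d. d \<in> D \<Longrightarrow> a d d = (\<Sum>i<n. (a d (u i))\<^sup>2)" by blast
  define res where "res d = d - (\<Sum>i<n. a d (u i) *\<^sub>R u i)" for d
  have res_u: "a (res d) (u j) = 0" if "j < n" for d j
  proof -
    have "(\<Sum>i<n. a d (u i) * a (u i) (u j)) = (\<Sum>i<n. if i = j then a d (u i) else 0)"
      using on that by (intro sum.cong) auto
    then show ?thesis using that by (simp add: res_def diff_left sum_left scale_left)
  qed
  have res_res: "a (res d) (res e) = a (res d) e" for d e
    by (subst (2) res_def) (simp add: diff_right sum_right scale_right res_u)
  have res_sq: "a (res d) d = a d d - (\<Sum>i<n. (a d (u i))\<^sup>2)" for d
    by (simp add: res_def diff_left sum_left scale_left power2_eq_square sym[of d "u _"])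
  show ?case
  proof (cases "a (res d) (res d) = 0")
    case True
    then have "a d d = (\<Sum>i<n. (a d (u i))\<^sup>2)" by (simp add: res_res res_sq)
    then show ?thesis using on D by (intro exI[of _ n] exI[of _ u]) auto
  next
    case False
    define q where "q = a (res d) (res d)"
    have q: "q > 0" using False nonneg[of "res d"] by (simp add: q_def)
    define w where "w = (1 / sqrt q) *\<^sub>R res d"
    define u' where "u' = u(n := w)"
    have ww: "a w w = 1" using q by (simp add: w_def scale_left scale_right flip: q_def)
    have wu: "a w (u j) = 0" if "j < n" for j using res_u[OF that] by (simp add: w_def scale_left)
    have "a (u' i) (u' j) = (if i = j then 1 else 0)" if "i < Suc n" "j < Suc n" for i j
      using that on ww wu sym by (auto simp: u'_def less_Suc_eq)
    moreover have "a e e = (\<Sum>i<Suc n. (a e (u' i))\<^sup>2)" if "e \<in> insert d D" for e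
    proof -
      have s: "(\<Sum>i<Suc n. (a e (u' i))\<^sup>2) = (\<Sum>i<n. (a e (u i))\<^sup>2) + (a e w)\<^sup>2"
        by (simp add: u'_def)
      show ?thesis
      proof (cases "e \<in> D")
        case True
        \<comment> \<open>For an element treated before, the residual is null, hence orthogonal to
          \<open>res d\<close>, and the new vector \<open>w\<close> adds nothing to its sum. For
          \<open>d\<close> itself the new term is exactly the deficit \<open>q\<close>.\<close>
        then have "a (res e) (res e) = 0" using D by (simp add: res_res res_sq)
        then have "a (res e) (res d) = 0" by (rule null_left)
        then have "a (res d) e = 0" using res_res[of d e] sym by metis
        then have "a e w = 0" by (simp add: w_def scale_right sym[of e])
        then show ?thesis using D[OF True] s by simp
      next
        case False
        then have e: "e = d" using that by simp
        have "a e w = q / sqrt q" using sym[of d "res d"] res_res[of d d]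
          by (simp add: e w_def scale_right q_def)
        then have "(a e w)\<^sup>2 = q" using q by (simp add: power_divide power2_eq_square)
        then show ?thesis unfolding s using res_sq[of d] res_res[of d d] by (simp add: e q_def)
      qed
    qed
    ultimately show ?thesis by (intro exI[of _ "Suc n"] exI[of _ u']) auto
  qed
qed

end

text \<open>Among orthogonal matrices, those that maximise the weighted trace \<open>\<Sum> i \<cdot> b\<^sub>i\<^sub>i\<close> (distinct weights)
  diagonalise the form: otherwise a plane rotation in the offending pair would increase it.\<close>

definition orthogonal_mats :: "nat \<Rightarrow> (nat \<times> nat \<Rightarrow> real) set" where
  "orthogonal_mats n = {c. (\<forall>p k. p \<ge> n \<or> k \<ge> n \<longrightarrow> c (p, k) = 0)
    \<and> (\<forall>p<n. \<forall>q<n. (\<Sum>k<n. c (p, k) * c (q, k)) = (if p = q then 1 else 0))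
    \<and> (\<forall>k<n. \<forall>l<n. (\<Sum>p<n. c (p, k) * c (p, l)) = (if k = l then 1 else 0))}"

text \<open>The set is closed in the product topology, and the unit row lengths place it in a
  product of intervals, which is compact by Tychonoff's theorem.\<close>

lemma compact_orthogonal_mats: "compact (orthogonal_mats n)"
proof -
  have "compactin (product_topology (\<lambda>_. euclidean) UNIV) (PiE (UNIV :: (nat \<times> nat) set) (\<lambda>_. {-1..1::real}))"
    by (subst compactin_PiE) auto
  then have box: "compact (PiE (UNIV :: (nat \<times> nat) set) (\<lambda>_. {-1..1::real}))"
    by (simp add: euclidean_product_topology)
  have c: "continuous_on UNIV (\<lambda>c::nat \<times> nat \<Rightarrow> real. c z)" for z
    by simp
  have "closed (orthogonal_mats n)"
    unfolding orthogonal_mats_def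
    by (intro closed_Collect_conj closed_Collect_all closed_Collect_imp open_Collect_const
        closed_Collect_eq continuous_intros c)
  moreover have "orthogonal_mats n \<subseteq> PiE UNIV (\<lambda>_. {-1..1})"
  proof
    fix c assume c: "c \<in> orthogonal_mats n"
    have "c (p, k) \<in> {-1..1}" for p k
    proof (cases "p < n \<and> k < n")
      case True
      have "c (p, k) * c (p, k) \<le> (\<Sum>k<n. c (p, k) * c (p, k))"
        using True by (intro member_le_sum) auto
      also have "\<dots> = 1" using c True by (auto simp: orthogonal_mats_def)
      finally have "\<bar>c (p, k)\<bar> \<le> 1" by (simp add: abs_square_le_1 flip: power2_eq_square)
      then show ?thesis by auto
    qed (use c in \<open>auto simp: orthogonal_mats_def not_less\<close>)
    then show "c \<in> PiE UNIV (\<lambda>_. {-1..1})" by auto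
  qed
  ultimately show ?thesis
    using closed_Int_compact[OF _ box, of "orthogonal_mats n"] by (simp add: Int_absorb2)
qed

text \<open>A Givens rotation acting on rows \<open>i\<close> and \<open>j\<close>: row
  \<open>i\<close> receives plus sin times row \<open>j\<close>, row \<open>j\<close> receives minus
  sin times row \<open>i\<close>, and all other rows stay.\<close>

definition plane_rotation :: "nat \<Rightarrow> nat \<Rightarrow> real \<Rightarrow> (nat \<times> nat \<Rightarrow> real) \<Rightarrow> nat \<times> nat \<Rightarrow> real" where
  "plane_rotation i j \<theta> c = (\<lambda>(p, k).
     (if p = i \<or> p = j then cos \<theta> else 1) * c (p, k)
   + (if p = i then sin \<theta> else if p = j then - sin \<theta> else 0) * c (if p = i then j else if p = j then i else p, k))"

lemma plane_rotation_orthogonal: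
  assumes c: "c \<in> orthogonal_mats n" and ij: "i < n" "j < n" "i \<noteq> j"
  shows "plane_rotation i j \<theta> c \<in> orthogonal_mats n"
proof -
  have z: "c (p, k) = 0" if "p \<ge> n \<or> k \<ge> n" for p k using c that by (auto simp: orthogonal_mats_def)
  have r: "(\<Sum>k<n. c (p, k) * c (q, k)) = (if p = q then 1 else 0)" if "p < n" "q < n" for p q
    using c that by (auto simp: orthogonal_mats_def)
  have l: "(\<Sum>p<n. c (p, k) * c (p, l)) = (if k = l then 1 else 0)" if "k < n" "l < n" for k l
    using c that by (auto simp: orthogonal_mats_def)
  have sc: "sin \<theta> * sin \<theta> = 1 - cos \<theta> * cos \<theta>"
    using sin_squared_eq[of \<theta>] by (simp add: power2_eq_square)
  have rows: "(\<Sum>k<n. plane_rotation i j \<theta> c (p, k) * plane_rotation i j \<theta> c (q, k)) = (if p = q then 1 else 0)"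
    if "p < n" "q < n" for p q
  proof -
    define A where "A p = (if p = i \<or> p = j then cos \<theta> else 1)" for p
    define A' where "A' p = (if p = i then sin \<theta> else if p = j then - sin \<theta> else 0)" for p
    define s where "s p = (if p = i then j else if p = j then i else p)" for p
    have e: "plane_rotation i j \<theta> c (p, k) = A p * c (p, k) + A' p * c (s p, k)" for p k
      by (simp add: plane_rotation_def A_def A'_def s_def)
    have sn: "s p < n" if "p < n" for p using that ij by (simp add: s_def)
    have "(\<Sum>k<n. plane_rotation i j \<theta> c (p, k) * plane_rotation i j \<theta> c (q, k))
      = A p * A q * (\<Sum>k<n. c (p, k) * c (q, k)) + A p * A' q * (\<Sum>k<n. c (p, k) * c (s q, k))
      + A' p * A q * (\<Sum>k<n. c (s p, k) * c (q, k)) + A' p * A' q * (\<Sum>k<n. c (s p, k) * c (s q, k))"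
      unfolding e sum_distrib_left sum.distrib[symmetric] by (intro sum.cong) (auto simp: algebra_simps)
    also have "\<dots> = A p * A q * (if p = q then 1 else 0) + A p * A' q * (if p = s q then 1 else 0)
      + A' p * A q * (if s p = q then 1 else 0) + A' p * A' q * (if s p = s q then 1 else 0)"
      by (simp only: r that sn)
    also have "\<dots> = (if p = q then 1 else 0)"
    proof -
      consider "p = i" | "p = j" | "p \<noteq> i" "p \<noteq> j" by blast
      then show ?thesis
        using ij(3) by cases (auto simp: A_def A'_def s_def sc)
    qed
    finally show ?thesis .
  qed
  \<comment> \<open>Only two summands of a column product change, and the rotation preserves their
    sum.\<close>
  have cols: "(\<Sum>p<n. plane_rotation i j \<theta> c (p, k) * plane_rotation i j \<theta> c (p, l)) = (if k = l then 1 else 0)"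
    if "k < n" "l < n" for k l
  proof -
    have split: "(\<Sum>p<n. f p) = f i + f j + (\<Sum>p\<in>{..<n} - {i} - {j}. f p)" for f :: "nat \<Rightarrow> real"
      using ij by (subst sum.remove[of _ i], simp, simp, subst sum.remove[of _ j]) auto
    have "(\<Sum>p<n. plane_rotation i j \<theta> c (p, k) * plane_rotation i j \<theta> c (p, l)) = (\<Sum>p<n. c (p, k) * c (p, l))"
    proof -
      have "plane_rotation i j \<theta> c (i, k) * plane_rotation i j \<theta> c (i, l)
          + plane_rotation i j \<theta> c (j, k) * plane_rotation i j \<theta> c (j, l)
        = (cos \<theta> * cos \<theta> + sin \<theta> * sin \<theta>) * (c (i, k) * c (i, l) + c (j, k) * c (j, l))"
      proof -
        have "plane_rotation i j \<theta> c (i, k) = cos \<theta> * c (i, k) + sin \<theta> * c (j, k)"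
          "plane_rotation i j \<theta> c (j, k) = cos \<theta> * c (j, k) - sin \<theta> * c (i, k)" for k
          using ij by (auto simp: plane_rotation_def)
        from this[of k] this[of l] show ?thesis by algebra
      qed
      also have "cos \<theta> * cos \<theta> + sin \<theta> * sin \<theta> = 1" using sc by simp
      finally have pair: "plane_rotation i j \<theta> c (i, k) * plane_rotation i j \<theta> c (i, l)
          + plane_rotation i j \<theta> c (j, k) * plane_rotation i j \<theta> c (j, l)
        = c (i, k) * c (i, l) + c (j, k) * c (j, l)" by simp
      have rest: "(\<Sum>p\<in>{..<n} - {i} - {j}. plane_rotation i j \<theta> c (p, k) * plane_rotation i j \<theta> c (p, l))
        = (\<Sum>p\<in>{..<n} - {i} - {j}. c (p, k) * c (p, l))"
        by (intro sum.cong) (auto simp: plane_rotation_def)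
      show ?thesis unfolding split pair rest ..
    qed
    then show ?thesis using l that by simp
  qed
  show ?thesis
    using rows cols ij by (auto simp: orthogonal_mats_def plane_rotation_def z)
qed

lemma orthogonal_diagonalization:
  fixes \<beta> :: "nat \<Rightarrow> nat \<Rightarrow> real"
  assumes sym: "\<And>k l. \<beta> k l = \<beta> l k"
  shows "\<exists>c\<in>orthogonal_mats n. \<forall>i<n. \<forall>j<n. i \<noteq> j \<longrightarrow> (\<Sum>k<n. \<Sum>l<n. c (i, k) * c (j, l) * \<beta> k l) = 0"
proof -
  define b where "b c i j = (\<Sum>k<n. \<Sum>l<n. c (i, k) * c (j, l) * \<beta> k l)" for c :: "nat \<times> nat \<Rightarrow> real" and i j
  define f where "f c = (\<Sum>p<n. real p * b c p p)" for c
  have bsym: "b c i j = b c j i" for c i j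
    unfolding b_def by (subst sum.swap) (simp add: sym mult.commute)
  have cont: "continuous_on (orthogonal_mats n) f"
  proof -
    have "continuous_on A (\<lambda>c::nat \<times> nat \<Rightarrow> real. c z)" for z A
      by (rule continuous_on_subset[of UNIV]) auto
    then show ?thesis unfolding f_def b_def by (intro continuous_intros)
  qed
  have "(\<lambda>(p, k). if p = k \<and> p < n then 1 else 0) \<in> orthogonal_mats n"
  proof -
    have "(\<Sum>k<n. (if p = k then 1 else 0) * (if q = k then 1 else 0)) = (if p = q then 1 else (0::real))"
      if "p < n" for p q
    proof -
      have "(\<Sum>k<n. (if p = k then 1 else 0) * (if q = k then 1 else 0))
        = (\<Sum>k<n. if k = p then (if p = q then 1 else (0::real)) else 0)"
        by (intro sum.cong) auto
      then show ?thesis using that by simp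
    qed
    moreover have "(\<Sum>p<n. (if p = k \<and> p < n then 1 else 0) * (if p = l \<and> p < n then 1 else 0)) = (if k = l then 1 else (0::real))"
      if "k < n" for k l
    proof -
      have "(\<Sum>p<n. (if p = k \<and> p < n then 1 else 0) * (if p = l \<and> p < n then 1 else 0))
        = (\<Sum>p<n. if p = k then (if k = l then 1 else (0::real)) else 0)"
        by (intro sum.cong) (use that in auto)
      then show ?thesis using that by simp
    qed
    ultimately show ?thesis by (auto simp: orthogonal_mats_def)
  qed
  then have "orthogonal_mats n \<noteq> {}" by blast
  from continuous_attains_sup[OF compact_orthogonal_mats this cont]
  obtain c where c: "c \<in> orthogonal_mats n" and max: "\<And>d. d \<in> orthogonal_mats n \<Longrightarrow> f d \<le> f c" by blast
  have "b c i j = 0" if ij: "i < n" "j < n" "i \<noteq> j" for i j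
  proof -
    define R where "R \<theta> = plane_rotation i j \<theta> c" for \<theta>
    have Ri: "R \<theta> (i, k) = cos \<theta> * c (i, k) + sin \<theta> * c (j, k)"
      and Rj: "R \<theta> (j, k) = cos \<theta> * c (j, k) - sin \<theta> * c (i, k)"
      and Rp: "p \<noteq> i \<Longrightarrow> p \<noteq> j \<Longrightarrow> R \<theta> (p, k) = c (p, k)" for \<theta> p k
      using ij by (auto simp: R_def plane_rotation_def)
    have bi: "b (R \<theta>) i i = (cos \<theta>)\<^sup>2 * b c i i + 2 * (sin \<theta> * cos \<theta>) * b c i j + (sin \<theta>)\<^sup>2 * b c j j" for \<theta>
    proof -
      have "b (R \<theta>) i i = (cos \<theta>)\<^sup>2 * b c i i + (sin \<theta> * cos \<theta>) * b c i j + (sin \<theta> * cos \<theta>) * b c j i + (sin \<theta>)\<^sup>2 * b c j j"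
        unfolding b_def Ri sum_distrib_left sum.distrib[symmetric]
        by (intro sum.cong) (auto simp: algebra_simps power2_eq_square)
      then show ?thesis using bsym[of c j i] by simp
    qed
    have bj: "b (R \<theta>) j j = (cos \<theta>)\<^sup>2 * b c j j - 2 * (sin \<theta> * cos \<theta>) * b c i j + (sin \<theta>)\<^sup>2 * b c i i" for \<theta>
    proof -
      have "b (R \<theta>) j j = (cos \<theta>)\<^sup>2 * b c j j - (sin \<theta> * cos \<theta>) * b c i j - (sin \<theta> * cos \<theta>) * b c j i + (sin \<theta>)\<^sup>2 * b c i i"
        unfolding b_def Rj sum_distrib_left sum.distrib[symmetric] sum_subtractf[symmetric]
        by (intro sum.cong) (auto simp: algebra_simps power2_eq_square)
      then show ?thesis using bsym[of c j i] by simp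
    qed
    have split: "(\<Sum>p<n. g p) = g i + g j + (\<Sum>p\<in>{..<n} - {i} - {j}. g p)" for g :: "nat \<Rightarrow> real"
      using ij by (subst sum.remove[of _ i], simp, simp, subst sum.remove[of _ j]) auto
    have rest: "(\<Sum>p\<in>{..<n} - {i} - {j}. real p * b (R \<theta>) p p) = (\<Sum>p\<in>{..<n} - {i} - {j}. real p * b c p p)" for \<theta>
      by (intro sum.cong) (auto simp: b_def Rp)
    define h where "h \<theta> = i * b (R \<theta>) i i + j * b (R \<theta>) j j" for \<theta>
    have le: "h \<theta> \<le> h 0" for \<theta>
    proof -
      have "f (R \<theta>) \<le> f c" unfolding R_def by (intro max plane_rotation_orthogonal c ij)
      moreover have "R 0 = c" using Ri Rj Rp by (auto simp: R_def plane_rotation_def fun_eq_iff)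
      ultimately show ?thesis unfolding f_def split rest h_def by simp
    qed
    \<comment> \<open>The squares of sin and cos have no first-order term at 0, so only the mixed
      entry survives. The distinct weights \<open>i\<close> and \<open>j\<close> keep its
      coefficient nonzero.\<close>
    have "(h has_real_derivative 2 * (real i - real j) * b c i j) (at 0)"
      unfolding h_def bi bj by (auto intro!: derivative_eq_intros simp: algebra_simps)
    then have "2 * (real i - real j) * b c i j = 0"
      by (rule DERIV_local_max[of _ _ _ 1]) (use le in auto)
    then show ?thesis using ij by simp
  qed
  then show ?thesis using c by (intro bexI[of _ c]) (auto simp: b_def)
qed

text \<open>A Gram-Schmidt family is rotated by an orthogonal matrix that diagonalises
  \<open>b\<close>. Orthonormal rows keep the family orthonormal and orthonormal columns keep the
  Parseval identity on \<open>D\<close>, which is why \<open>orthogonal_mats\<close> records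
  both.\<close>

lemma (in psd_form) simultaneous_diagonalization:
  assumes b: "sym_form b" and "finite D"
  shows "\<exists>n u. (\<forall>i<n. \<forall>j<n. a (u i) (u j) = (if i = j then 1 else 0))
    \<and> (\<forall>i<n. \<forall>j<n. i \<noteq> j \<longrightarrow> b (u i) (u j) = 0)
    \<and> (\<forall>d\<in>D. a d d = (\<Sum>i<n::nat. (a d (u i))\<^sup>2))"
proof -
  interpret b: sym_form b by fact
  from gram_schmidt[OF \<open>finite D\<close>] obtain n :: nat and u
    where on: "\<And>i j. i < n \<Longrightarrow> j < n \<Longrightarrow> a (u i) (u j) = (if i = j then 1 else 0)"
      and D: "\<And>d. d \<in> D \<Longrightarrow> a d d = (\<Sum>i<n. (a d (u i))\<^sup>2)" by blast
  from orthogonal_diagonalization[of "\<lambda>k l. b (u k) (u l)" n] b.sym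
  obtain c where c: "c \<in> orthogonal_mats n"
    and dg: "\<And>i j. i < n \<Longrightarrow> j < n \<Longrightarrow> i \<noteq> j \<Longrightarrow> (\<Sum>k<n. \<Sum>l<n. c (i, k) * c (j, l) * b (u k) (u l)) = 0" by blast
  define v where "v i = (\<Sum>k<n. c (i, k) *\<^sub>R u k)" for i
  have "a (v i) (v j) = (if i = j then 1 else 0)" if "i < n" "j < n" for i j
  proof -
    have "a (v i) (v j) = (\<Sum>k<n. \<Sum>l<n. c (i, k) * (c (j, l) * a (u k) (u l)))"
      unfolding v_def[of i] sum_left scale_left
      unfolding v_def sum_right scale_right sum_distrib_left by (rule refl)
    also have "\<dots> = (\<Sum>k<n. \<Sum>l<n. if l = k then c (i, k) * c (j, k) else 0)"
      using on by (intro sum.cong) auto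
    also have "\<dots> = (\<Sum>k<n. c (i, k) * c (j, k))" by simp
    finally show ?thesis using c that by (simp add: orthogonal_mats_def)
  qed
  moreover have "b (v i) (v j) = 0" if "i < n" "j < n" "i \<noteq> j" for i j
  proof -
    have "b (v i) (v j) = (\<Sum>k<n. \<Sum>l<n. c (i, k) * (c (j, l) * b (u k) (u l)))"
      unfolding v_def[of i] b.sum_left b.scale_left
      unfolding v_def b.sum_right b.scale_right sum_distrib_left by (rule refl)
    then show ?thesis using dg[OF that] by (simp add: mult.assoc)
  qed
  moreover have "(\<Sum>i<n. (a d (v i))\<^sup>2) = (\<Sum>k<n. (a d (u k))\<^sup>2)" for d
  proof -
    have "(\<Sum>i<n. (a d (v i))\<^sup>2) = (\<Sum>i<n. \<Sum>k<n. \<Sum>l<n. (c (i, k) * c (i, l)) * (a d (u k) * a d (u l)))"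
      unfolding v_def sum_right scale_right power2_eq_square sum_product
      by (intro sum.cong refl) (simp add: algebra_simps)
    also have "\<dots> = (\<Sum>k<n. \<Sum>l<n. \<Sum>i<n. (c (i, k) * c (i, l)) * (a d (u k) * a d (u l)))"
      by (subst sum.swap) (intro sum.cong refl sum.swap)
    also have "\<dots> = (\<Sum>k<n. \<Sum>l<n. if l = k then (a d (u k))\<^sup>2 else 0)"
      using c by (intro sum.cong refl) (auto simp: orthogonal_mats_def power2_eq_square simp flip: sum_distrib_right)
    finally show ?thesis by simp
  qed
  ultimately show ?thesis using D by (intro exI[of _ n] exI[of _ v]) auto
qed

section \<open>Quadratic potentials\<close>

text \<open>The log-density, relative to the standard normal law, of \<open>\<xi>\<close> distributed as
  \<open>N(\<beta> s \<eta>, s)\<close>.  The mean is proportional to the variance so that the coefficient of \<open>\<xi> \<eta>\<close> is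
  \<open>\<beta>\<close>, whatever \<open>s\<close> is.\<close>

definition log_kernel :: "real \<Rightarrow> real \<Rightarrow> real \<Rightarrow> real \<Rightarrow> real" where
  "log_kernel \<beta> s \<xi> \<eta> = - ln s / 2 - (\<xi> - \<beta> * s * \<eta>)\<^sup>2 / (2 * s) + \<xi>\<^sup>2 / 2"

lemma borel_measurable_log_kernel [measurable (raw)]:
  assumes [measurable]: "f \<in> borel_measurable M" "g \<in> borel_measurable M"
  shows "(\<lambda>x. log_kernel \<beta> s (f x) (g x)) \<in> borel_measurable M"
  unfolding log_kernel_def by measurable

lemma normal_density_sqrt:
  "s > 0 \<Longrightarrow> normal_density a (sqrt s) x = 1 / (sqrt (2 * pi) * sqrt s) * exp (- (x - a)\<^sup>2 / (2 * s))"
  by (simp add: normal_density_def real_sqrt_mult)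

lemma exp_minus_half_ln:
  fixes s :: real
  shows "s > 0 \<Longrightarrow> exp (- ln s / 2) = 1 / sqrt s"
proof -
  assume s: "s > 0"
  then have "- ln s / 2 = - ln (sqrt s)" by (simp add: ln_sqrt)
  then have "exp (- ln s / 2) = inverse (exp (ln (sqrt s)))" by (simp only: exp_minus)
  then show ?thesis using s by (simp add: inverse_eq_divide)
qed

lemma exp_log_kernel_source:
  assumes "s > 0"
  shows "std_normal_density \<xi> * exp (log_kernel \<beta> s \<xi> \<eta>) = normal_density (\<beta> * s * \<eta>) (sqrt s) \<xi>"
proof -
  have "exp (log_kernel \<beta> s \<xi> \<eta>) = exp (- ln s / 2) * exp (- (\<xi> - \<beta> * s * \<eta>)\<^sup>2 / (2 * s)) * exp (\<xi>\<^sup>2 / 2)"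
    by (simp add: log_kernel_def flip: exp_add)
  moreover have "exp (- \<xi>\<^sup>2 / 2) * exp (\<xi>\<^sup>2 / 2) = 1" by (simp flip: exp_add)
  moreover have "(1 / a * x) * (1 / b * y * z) = (x * z) * (1 / (a * b) * y)" for a b x y z :: real
    by (simp add: field_simps)
  ultimately show ?thesis
    by (simp only: std_normal_density_def exp_minus_half_ln[OF assms] normal_density_sqrt[OF assms] mult_1_left)
qed

text \<open>If \<open>\<eta>\<close> has variance \<open>w\<close>, and \<open>\<xi>\<close> given
  \<open>\<eta>\<close> has mean \<open>\<beta> * s * \<eta>\<close> and variance \<open>s\<close>,
  then \<open>\<xi>\<close> has variance \<open>\<beta>\<^sup>2 * w * s\<^sup>2 + s\<close>. The
  hypothesis makes this 1, and Bayes' rule yields the law of \<open>\<eta>\<close> given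
  \<open>\<xi>\<close>.\<close>

lemma exp_log_kernel_target:
  assumes "s > 0" "w > 0" and fp: "\<beta>\<^sup>2 * w * s\<^sup>2 + s = 1"
  shows "normal_density 0 (sqrt w) \<eta> * exp (log_kernel \<beta> s \<xi> \<eta>) = normal_density (\<beta> * s * w * \<xi>) (sqrt (w * s)) \<eta>"
proof -
  have "exp (log_kernel \<beta> s \<xi> \<eta>) = exp (- ln s / 2) * exp (- (\<xi> - \<beta> * s * \<eta>)\<^sup>2 / (2 * s) + \<xi>\<^sup>2 / 2)"
    by (simp add: log_kernel_def flip: exp_add)
  moreover have "- \<eta>\<^sup>2 / (2 * w) + (- (\<xi> - \<beta> * s * \<eta>)\<^sup>2 / (2 * s) + \<xi>\<^sup>2 / 2) = - (\<eta> - \<beta> * s * w * \<xi>)\<^sup>2 / (2 * (w * s))"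
  proof -
    have e: "w * (\<beta>\<^sup>2 * s\<^sup>2) = 1 - s" using fp by (simp add: algebra_simps)
    have "(\<beta> * s * w * \<xi>)\<^sup>2 = (w * (\<beta>\<^sup>2 * s\<^sup>2)) * (w * \<xi>\<^sup>2)"
      "w * (\<beta> * s * \<eta>)\<^sup>2 = (w * (\<beta>\<^sup>2 * s\<^sup>2)) * \<eta>\<^sup>2"
      by (simp_all add: power2_eq_square algebra_simps)
    then have "- s * \<eta>\<^sup>2 - w * (\<xi> - \<beta> * s * \<eta>)\<^sup>2 + w * s * \<xi>\<^sup>2 = - (\<eta> - \<beta> * s * w * \<xi>)\<^sup>2"
      unfolding e power2_diff by (simp add: algebra_simps)
    then have "(- s * \<eta>\<^sup>2 - w * (\<xi> - \<beta> * s * \<eta>)\<^sup>2 + w * s * \<xi>\<^sup>2) / (2 * (w * s)) = - (\<eta> - \<beta> * s * w * \<xi>)\<^sup>2 / (2 * (w * s))"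
      by simp
    moreover have "(- s * \<eta>\<^sup>2 - w * (\<xi> - \<beta> * s * \<eta>)\<^sup>2 + w * s * \<xi>\<^sup>2) / (2 * (w * s))
        = - \<eta>\<^sup>2 / (2 * w) + (- (\<xi> - \<beta> * s * \<eta>)\<^sup>2 / (2 * s) + \<xi>\<^sup>2 / 2)"
      using assms(1,2) by (simp add: add_divide_distrib diff_divide_distrib)
    ultimately show ?thesis by simp
  qed
  then have "exp (- \<eta>\<^sup>2 / (2 * w)) * exp (- (\<xi> - \<beta> * s * \<eta>)\<^sup>2 / (2 * s) + \<xi>\<^sup>2 / 2) = exp (- (\<eta> - \<beta> * s * w * \<xi>)\<^sup>2 / (2 * (w * s)))"
    by (simp flip: exp_add)
  moreover have "(1 / (a * b) * x) * (1 / c * z) = 1 / (a * (b * c)) * (x * z)" for a b c x z :: real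
    by (simp add: field_simps)
  moreover have ws: "w * s > 0" using assms(1,2) by simp
  ultimately show ?thesis
    by (simp only: diff_zero exp_minus_half_ln[OF assms(1)] normal_density_sqrt[OF ws] normal_density_sqrt[OF assms(2)])
      (simp only: real_sqrt_mult[of w s])
qed

lemma nn_integral_normal_density: "\<sigma> > 0 \<Longrightarrow> (\<integral>\<^sup>+x. ennreal (normal_density a \<sigma> x) \<partial>lborel) = 1"
  by (subst nn_integral_eq_integral) auto

lemma nn_integral_log_kernel_source:
  assumes "s > 0"
  shows "(\<integral>\<^sup>+\<xi>. ennreal (exp (log_kernel \<beta> s \<xi> \<eta>)) \<partial>std_normal_distribution) = 1"
proof -
  have "(\<integral>\<^sup>+\<xi>. ennreal (exp (log_kernel \<beta> s \<xi> \<eta>)) \<partial>std_normal_distribution)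
      = (\<integral>\<^sup>+\<xi>. ennreal (std_normal_density \<xi>) * ennreal (exp (log_kernel \<beta> s \<xi> \<eta>)) \<partial>lborel)"
    by (rule nn_integral_density) measurable
  also have "\<dots> = (\<integral>\<^sup>+\<xi>. ennreal (normal_density (\<beta> * s * \<eta>) (sqrt s) \<xi>) \<partial>lborel)"
    by (simp only: ennreal_mult'[symmetric] normal_density_nonneg exp_log_kernel_source[OF assms])
  finally show ?thesis using assms by (simp add: nn_integral_normal_density)
qed

lemma char_log_kernel_source:
  assumes s: "s > 0"
  shows "(CLINT \<xi>|std_normal_distribution. exp (log_kernel \<beta> s \<xi> \<eta>) * iexp (p * \<xi>))
      = iexp (p * (\<beta> * s * \<eta>)) * of_real (exp (- p\<^sup>2 * s / 2))"
    and "complex_integrable std_normal_distribution (\<lambda>\<xi>. exp (log_kernel \<beta> s \<xi> \<eta>) * iexp (p * \<xi>))"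
proof -
  have e: "std_normal_density \<xi> *\<^sub>R (exp (log_kernel \<beta> s \<xi> \<eta>) * iexp (p * \<xi>))
      = normal_density (\<beta> * s * \<eta>) (sqrt s) \<xi> *\<^sub>R iexp (p * \<xi>)" for \<xi>
    unfolding scaleR_conv_of_real exp_log_kernel_source[OF s, symmetric] by simp
  have "(CLINT \<xi>|std_normal_distribution. exp (log_kernel \<beta> s \<xi> \<eta>) * iexp (p * \<xi>))
      = (CLINT \<xi>|lborel. std_normal_density \<xi> *\<^sub>R (exp (log_kernel \<beta> s \<xi> \<eta>) * iexp (p * \<xi>)))"
    by (rule integral_density) auto
  also have "\<dots> = (CLINT \<xi>|density lborel (normal_density (\<beta> * s * \<eta>) (sqrt s)). iexp (p * \<xi>))"
    unfolding e by (rule integral_density[symmetric]) auto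
  finally show "(CLINT \<xi>|std_normal_distribution. exp (log_kernel \<beta> s \<xi> \<eta>) * iexp (p * \<xi>))
      = iexp (p * (\<beta> * s * \<eta>)) * of_real (exp (- p\<^sup>2 * s / 2))"
    using s by (simp only: char_normal_density real_sqrt_gt_0_iff) (simp add: power_mult_distrib exp_of_real[symmetric])
  interpret D: prob_space "density lborel (normal_density (\<beta> * s * \<eta>) (sqrt s))"
    using s by (intro prob_space_normal_density) simp
  have "complex_integrable (density lborel (normal_density (\<beta> * s * \<eta>) (sqrt s))) (\<lambda>\<xi>. iexp (p * \<xi>))"
    by (intro D.integrable_const_bound[of _ 1]) auto
  then have "complex_integrable lborel (\<lambda>\<xi>. normal_density (\<beta> * s * \<eta>) (sqrt s) \<xi> *\<^sub>R iexp (p * \<xi>))"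
    by (subst (asm) integrable_density) auto
  then show "complex_integrable std_normal_distribution (\<lambda>\<xi>. exp (log_kernel \<beta> s \<xi> \<eta>) * iexp (p * \<xi>))"
    unfolding e[symmetric] by (subst integrable_density) auto
qed

lemma nn_integral_log_kernel_target:
  assumes "s > 0" "w \<ge> 0" "\<beta>\<^sup>2 * w * s\<^sup>2 + s = 1"
  shows "(\<integral>\<^sup>+\<eta>. ennreal (exp (log_kernel \<beta> s \<xi> \<eta>)) \<partial>(if w = 0 then return borel 0 else density lborel (normal_density 0 (sqrt w)))) = 1"
proof (cases "w = 0")
  \<comment> \<open>A degenerate target coordinate is 0 almost surely, and the equation gives
    \<open>s = 1\<close>; at these values the kernel is 0.\<close>
  case True
  then show ?thesis using assms by (simp add: nn_integral_return log_kernel_def)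
next
  case False
  then have w: "w > 0" using assms by simp
  then have "(\<integral>\<^sup>+\<eta>. ennreal (exp (log_kernel \<beta> s \<xi> \<eta>)) \<partial>density lborel (normal_density 0 (sqrt w))) = 1"
    by (subst nn_integral_density)
      (auto simp: exp_log_kernel_target[OF assms(1) w assms(3)] nn_integral_normal_density assms simp flip: ennreal_mult')
  with False show ?thesis by simp
qed

text \<open>\<open>X\<close> is not tied to \<open>u\<close> and \<open>s\<close>: the same family
  is later used with three target covariances and is adapted to the middle one.\<close>

locale ot_potential =
  src: gaussian_measure m\<^sub>0 C\<^sub>0 \<mu> + tgt: gaussian_measure m X \<nu>
  for m\<^sub>0 m :: "'a::{real_inner,second_countable_topology}" and C\<^sub>0 X \<mu> \<nu> +
  fixes \<epsilon> :: real and n :: nat and u :: "nat \<Rightarrow> 'a" and s :: "nat \<Rightarrow> real"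
  assumes \<epsilon>: "\<epsilon> > 0"
    and orthonormal: "\<And>i j. i < n \<Longrightarrow> j < n \<Longrightarrow> inner (C\<^sub>0 (u i)) (u j) = (if i = j then 1 else 0)"
    and s_pos: "\<And>i. i < n \<Longrightarrow> s i > 0"
    and src_moment: "integrable \<mu> (\<lambda>x. (norm (x - m\<^sub>0))\<^sup>2)"
    and tgt_moment: "integrable \<nu> (\<lambda>y. (norm (y - m))\<^sup>2)"
begin

sublocale pair_prob_space \<mu> \<nu> ..

text \<open>Then \<open>\<epsilon> * \<beta> = 2\<close>, so the mixed terms of
  \<open>\<epsilon> * G\<close> cancel those of the squared distance.\<close>

abbreviation \<beta> where "\<beta> \<equiv> 2 / \<epsilon>"

text \<open>These coordinates belong together because \<open>x - m\<^sub>0\<close> is expanded in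
  the vectors \<open>C\<^sub>0 (u i)\<close> with coefficients \<open>\<xi> i x\<close>; pairing the
  expansion with \<open>y - m\<close> produces the sum of the products
  \<open>\<xi> i x * \<eta> i y\<close>.\<close>

definition \<xi> where "\<xi> i x = inner (u i) (x - m\<^sub>0)"
definition \<eta> where "\<eta> i y = inner (C\<^sub>0 (u i)) (y - m)"
definition G where "G x y = (\<Sum>i<n. log_kernel \<beta> (s i) (\<xi> i x) (\<eta> i y))"

lemma measurable_coords [measurable]:
  "\<xi> i \<in> borel_measurable borel" "\<eta> i \<in> borel_measurable borel"
  unfolding \<xi>_def \<eta>_def by measurable

lemma measurable_G [measurable]: "(\<lambda>z. G (fst z) (snd z)) \<in> borel_measurable (borel \<Otimes>\<^sub>M borel)"
  unfolding G_def by measurable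

lemma distr_\<xi>: "i < n \<Longrightarrow> distr \<mu> borel (\<xi> i) = std_normal_distribution"
  using src.distr_centered[of "u i"] orthonormal[of i i] by (simp add: \<xi>_def[abs_def])

lemma indep_\<xi>: "src.indep_vars (\<lambda>_. borel) \<xi> {..<n}"
  unfolding \<xi>_def[abs_def] by (rule src.indep_vars_uncorrelated) (auto simp: orthonormal)

text \<open>Given \<open>y\<close>, the factors are independent and each turns the standard normal
  law of \<open>\<xi> i\<close> into another normal law. This holds for every target covariance,
  which keeps normalising constants out of the dual bound.\<close>

lemma nn_integral_exp_G_source: "(\<integral>\<^sup>+x. ennreal (exp (G x y)) \<partial>\<mu>) = 1"
proof -
  have "(\<integral>\<^sup>+x. ennreal (exp (G x y)) \<partial>\<mu>) = (\<integral>\<^sup>+x. (\<Prod>i<n. ennreal (exp (log_kernel \<beta> (s i) (\<xi> i x) (\<eta> i y)))) \<partial>\<mu>)"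
    unfolding G_def by (simp add: exp_sum prod_ennreal)
  also have "\<dots> = (\<Prod>i<n. \<integral>\<^sup>+x. ennreal (exp (log_kernel \<beta> (s i) (\<xi> i x) (\<eta> i y))) \<partial>\<mu>)"
    by (intro src.indep_vars_nn_integral src.indep_vars_compose2[OF indep_\<xi>]) auto
  also have "\<dots> = 1"
  proof (rule prod.neutral, safe)
    fix i assume i: "i < n"
    have "(\<integral>\<^sup>+x. ennreal (exp (log_kernel \<beta> (s i) (\<xi> i x) (\<eta> i y))) \<partial>\<mu>)
        = (\<integral>\<^sup>+r. ennreal (exp (log_kernel \<beta> (s i) r (\<eta> i y))) \<partial>distr \<mu> borel (\<xi> i))"
      by (subst nn_integral_distr) auto
    then show "(\<integral>\<^sup>+x. ennreal (exp (log_kernel \<beta> (s i) (\<xi> i x) (\<eta> i y))) \<partial>\<mu>) = 1"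
      using nn_integral_log_kernel_source[OF s_pos[OF i]] by (simp add: distr_\<xi>[OF i])
  qed
  finally show ?thesis .
qed

text \<open>Under the law with density \<open>exp (G x y)\<close> the coordinates are independent
  normals with means \<open>\<beta> * s i * \<eta> i y\<close> and variances \<open>s i\<close>. The
  dependence on \<open>y\<close> is kept for the later integration over the target.\<close>

lemma char_exp_G_source:
  "(CLINT x|\<mu>. exp (G x y) * iexp (\<Sum>i<n. p i * \<xi> i x))
    = iexp (\<Sum>i<n. p i * (\<beta> * s i * \<eta> i y)) * of_real (exp (- (\<Sum>i<n. (p i)\<^sup>2 * s i) / 2))"
proof -
  have e: "complex_of_real (exp (G x y)) * iexp (\<Sum>i<n. p i * \<xi> i x)
      = (\<Prod>i<n. complex_of_real (exp (log_kernel \<beta> (s i) (\<xi> i x) (\<eta> i y))) * iexp (p i * \<xi> i x))" for x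
    unfolding G_def prod.distrib by (simp add: exp_sum sum_distrib_left)
  have "(CLINT x|\<mu>. exp (G x y) * iexp (\<Sum>i<n. p i * \<xi> i x))
      = (\<Prod>i<n. CLINT x|\<mu>. exp (log_kernel \<beta> (s i) (\<xi> i x) (\<eta> i y)) * iexp (p i * \<xi> i x))"
    unfolding e
  proof (rule src.indep_vars_lebesgue_integral)
    show "src.indep_vars (\<lambda>_. borel) (\<lambda>i x. complex_of_real (exp (log_kernel \<beta> (s i) (\<xi> i x) (\<eta> i y))) * iexp (p i * \<xi> i x)) {..<n}"
      by (rule src.indep_vars_compose2[OF indep_\<xi>]) measurable
    fix i assume "i \<in> {..<n}"
    then have i: "i < n" by simp
    have "complex_integrable (distr \<mu> borel (\<xi> i)) (\<lambda>r. exp (log_kernel \<beta> (s i) r (\<eta> i y)) * iexp (p i * r))"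
      unfolding distr_\<xi>[OF i] by (rule char_log_kernel_source(2)[OF s_pos[OF i]])
    then show "complex_integrable \<mu> (\<lambda>x. exp (log_kernel \<beta> (s i) (\<xi> i x) (\<eta> i y)) * iexp (p i * \<xi> i x))"
      by (subst (asm) integrable_distr_eq) auto
  qed auto
  also have "\<dots> = (\<Prod>i<n. iexp (p i * (\<beta> * s i * \<eta> i y)) * of_real (exp (- (p i)\<^sup>2 * s i / 2)))"
  proof (rule prod.cong[OF refl])
    fix i assume "i \<in> {..<n}"
    then have i: "i < n" by simp
    have "(CLINT x|\<mu>. exp (log_kernel \<beta> (s i) (\<xi> i x) (\<eta> i y)) * iexp (p i * \<xi> i x))
        = (CLINT r|distr \<mu> borel (\<xi> i). exp (log_kernel \<beta> (s i) r (\<eta> i y)) * iexp (p i * r))"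
      by (subst integral_distr) auto
    also have "\<dots> = iexp (p i * (\<beta> * s i * \<eta> i y)) * of_real (exp (- (p i)\<^sup>2 * s i / 2))"
      unfolding distr_\<xi>[OF i] char_log_kernel_source(1)[OF s_pos[OF i]] ..
    finally show "(CLINT x|\<mu>. exp (log_kernel \<beta> (s i) (\<xi> i x) (\<eta> i y)) * iexp (p i * \<xi> i x))
        = iexp (p i * (\<beta> * s i * \<eta> i y)) * of_real (exp (- (p i)\<^sup>2 * s i / 2))" .
  qed
  also have "\<dots> = iexp (\<Sum>i<n. p i * (\<beta> * s i * \<eta> i y)) * of_real (exp (- (\<Sum>i<n. (p i)\<^sup>2 * s i) / 2))"
  proof -
    have "(\<Prod>i<n. complex_of_real (exp (- (p i)\<^sup>2 * s i / 2))) = of_real (exp (- (\<Sum>i<n. (p i)\<^sup>2 * s i) / 2))"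
      unfolding of_real_prod[symmetric] exp_sum[OF finite_lessThan, symmetric]
      by (simp add: sum_negf sum_divide_distrib)
    moreover have "(\<Prod>i<n. iexp (p i * (\<beta> * s i * \<eta> i y))) = iexp (\<Sum>i<n. p i * (\<beta> * s i * \<eta> i y))"
      by (simp add: exp_sum sum_distrib_left)
    ultimately show ?thesis unfolding prod.distrib by simp
  qed
  finally show ?thesis .
qed

end

lemma exp_le_quadratic:
  fixes z :: real
  assumes "\<bar>z\<bar> \<le> 1"
  shows "exp z \<le> 1 + z + z\<^sup>2"
proof (cases "z \<ge> 0")
  case True
  then show ?thesis using assms by (intro exp_bound) auto
next
  case False
  define y where "y = - z"
  have y: "y > 0" using False by (simp add: y_def)
  have q: "0 \<le> 1 - y + y\<^sup>2"
    using sum_squares_ge_zero[of "y - 1/2" 0] by (simp add: power2_eq_square algebra_simps)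
  \<comment> \<open>The product with the Taylor lower bound of \<open>exp y\<close> has no linear
    term, and what remains beyond 1 is nonnegative.\<close>
  have "1 \<le> (1 - y + y\<^sup>2) * (1 + y + y\<^sup>2 / 2)"
  proof -
    have "(1 - y + y\<^sup>2) * (1 + y + y\<^sup>2 / 2) = 1 + y\<^sup>2 / 2 + y ^ 3 / 2 + y ^ 4 / 2"
      by (simp add: power2_eq_square power3_eq_cube power4_eq_xxxx field_simps)
    then show ?thesis using y by simp
  qed
  also have "\<dots> \<le> (1 - y + y\<^sup>2) * exp y"
    using exp_lower_Taylor_quadratic[of y] y q by (intro mult_left_mono) auto
  finally have "exp (- y) \<le> 1 - y + y\<^sup>2" by (simp add: exp_minus field_simps)
  then show ?thesis by (simp add: y_def)
qed

text \<open>Negative reals are truncated to 0, so additivity fails for mixed signs. This direction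
  lets real lower bounds of either sign pass to \<open>ennreal\<close>.\<close>

lemma ennreal_add_le: "ennreal (x + y) \<le> ennreal x + ennreal y"
proof -
  have "ennreal (x + y) \<le> ennreal (max 0 x + max 0 y)" by (intro ennreal_leI) auto
  also have "\<dots> = ennreal (max 0 x) + ennreal (max 0 y)" by (intro ennreal_plus) auto
  finally show ?thesis by (simp add: ennreal_max_0')
qed

section \<open>Normalisation over the target and cosine integrals of the kernel\<close>

context ot_potential
begin

definition w where "w i = inner (X (C\<^sub>0 (u i))) (C\<^sub>0 (u i))"

text \<open>Here the family is tied to \<open>X\<close>: diagonality makes the
  \<open>\<eta> i\<close> independent under \<open>\<nu>\<close>, and the fixed-point equation
  normalises each factor.\<close>

lemma nn_integral_exp_G_target:
  assumes diag: "\<And>i j. i < n \<Longrightarrow> j < n \<Longrightarrow> i \<noteq> j \<Longrightarrow> inner (X (C\<^sub>0 (u i))) (C\<^sub>0 (u j)) = 0"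
    and fp: "\<And>i. i < n \<Longrightarrow> \<beta>\<^sup>2 * w i * (s i)\<^sup>2 + s i = 1"
  shows "(\<integral>\<^sup>+y. ennreal (exp (G x y)) \<partial>\<nu>) = 1"
proof -
  have ind: "tgt.indep_vars (\<lambda>_. borel) \<eta> {..<n}"
    unfolding \<eta>_def[abs_def] by (rule tgt.indep_vars_uncorrelated) (auto simp: diag)
  have "(\<integral>\<^sup>+y. ennreal (exp (G x y)) \<partial>\<nu>) = (\<integral>\<^sup>+y. (\<Prod>i<n. ennreal (exp (log_kernel \<beta> (s i) (\<xi> i x) (\<eta> i y)))) \<partial>\<nu>)"
    unfolding G_def by (simp add: exp_sum prod_ennreal)
  also have "\<dots> = (\<Prod>i<n. \<integral>\<^sup>+y. ennreal (exp (log_kernel \<beta> (s i) (\<xi> i x) (\<eta> i y))) \<partial>\<nu>)"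
    by (intro tgt.indep_vars_nn_integral tgt.indep_vars_compose2[OF ind]) auto
  also have "\<dots> = 1"
  proof (rule prod.neutral, safe)
    fix i assume i: "i < n"
    have "(\<integral>\<^sup>+y. ennreal (exp (log_kernel \<beta> (s i) (\<xi> i x) (\<eta> i y))) \<partial>\<nu>)
        = (\<integral>\<^sup>+r. ennreal (exp (log_kernel \<beta> (s i) (\<xi> i x) r)) \<partial>distr \<nu> borel (\<eta> i))"
      by (subst nn_integral_distr) auto
    also have "distr \<nu> borel (\<eta> i) = (if w i = 0 then return borel 0 else density lborel (normal_density 0 (sqrt (w i))))"
      using tgt.distr_centered[of "C\<^sub>0 (u i)"] by (simp add: \<eta>_def[abs_def] w_def)
    also have "(\<integral>\<^sup>+r. ennreal (exp (log_kernel \<beta> (s i) (\<xi> i x) r)) \<partial>\<dots>) = 1"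
      by (rule nn_integral_log_kernel_target[OF s_pos[OF i] _ fp[OF i]]) (simp add: w_def)
    finally show "(\<integral>\<^sup>+y. ennreal (exp (log_kernel \<beta> (s i) (\<xi> i x) (\<eta> i y))) \<partial>\<nu>) = 1" .
  qed
  finally show ?thesis .
qed

lemma sets_prod: "sets (\<mu> \<Otimes>\<^sub>M \<nu>) = sets (borel \<Otimes>\<^sub>M borel)"
  by (intro sets_pair_measure_cong) simp_all

lemma measurable_G_prod [measurable]: "(\<lambda>z. G (fst z) (snd z)) \<in> borel_measurable (\<mu> \<Otimes>\<^sub>M \<nu>)"
  using measurable_G by (simp cong: measurable_cong_sets[OF sets_prod refl])

lemma nn_integral_exp_G: "(\<integral>\<^sup>+z. ennreal (exp (G (fst z) (snd z))) \<partial>(\<mu> \<Otimes>\<^sub>M \<nu>)) = 1"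
  by (subst nn_integral_snd[symmetric]) (simp_all add: nn_integral_exp_G_source tgt.emeasure_space_1[simplified])

lemma integrable_exp_G: "integrable (\<mu> \<Otimes>\<^sub>M \<nu>) (\<lambda>z. exp (G (fst z) (snd z)))"
  and integral_exp_G: "(\<integral>z. exp (G (fst z) (snd z)) \<partial>(\<mu> \<Otimes>\<^sub>M \<nu>)) = 1"
  using nn_integral_exp_G by (auto intro!: integrableI_nonneg simp: integral_eq_nn_integral)

text \<open>Integrating over \<open>x\<close> first leaves a characteristic function of the target.
  The exponent contains the variance of the tested functional under the first marginal of
  \<open>exp G\<close>, to be compared with its variance under \<open>\<mu>\<close> in
  \<open>integral_cos_source\<close>.\<close>

lemma integral_exp_G_cos:
  "(\<integral>z. exp (G (fst z) (snd z)) * cos (\<Sum>i<n. p i * \<xi> i (fst z)) \<partial>(\<mu> \<Otimes>\<^sub>M \<nu>))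
    = exp (- ((\<Sum>i<n. (p i)\<^sup>2 * s i) + \<beta>\<^sup>2 * inner (X (\<Sum>i<n. (p i * s i) *\<^sub>R C\<^sub>0 (u i))) (\<Sum>i<n. (p i * s i) *\<^sub>R C\<^sub>0 (u i))) / 2)"
proof -
  let ?v = "\<Sum>i<n. (p i * s i) *\<^sub>R C\<^sub>0 (u i)"
  let ?r = "\<lambda>x. \<Sum>i<n. p i * \<xi> i x"
  let ?c = "exp (- (\<Sum>i<n. (p i)\<^sup>2 * s i) / 2)"
  let ?f = "\<lambda>x y. complex_of_real (exp (G x y)) * iexp (?r x)"
  have int: "complex_integrable (\<mu> \<Otimes>\<^sub>M \<nu>) (\<lambda>z. ?f (fst z) (snd z))"
    by (rule Bochner_Integration.integrable_bound[OF integrable_exp_G]) (auto simp: norm_mult)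
  have "(CLINT z|\<mu> \<Otimes>\<^sub>M \<nu>. ?f (fst z) (snd z)) = (CLINT y|\<nu>. CLINT x|\<mu>. ?f x y)"
    using integral_snd[of ?f] int by (simp add: case_prod_beta')
  also have "\<dots> = (CLINT y|\<nu>. iexp (inner (\<beta> *\<^sub>R ?v) (y - m)) * of_real ?c)"
  proof (intro Bochner_Integration.integral_cong refl)
    fix y
    have "(\<Sum>i<n. p i * (\<beta> * s i * \<eta> i y)) = inner (\<beta> *\<^sub>R ?v) (y - m)"
      by (simp add: \<eta>_def inner_sum_left sum_distrib_left ac_simps)
    then show "(CLINT x|\<mu>. ?f x y) = iexp (inner (\<beta> *\<^sub>R ?v) (y - m)) * of_real ?c"
      unfolding char_exp_G_source by simp
  qed
  also have "\<dots> = of_real (exp (- inner (X (\<beta> *\<^sub>R ?v)) (\<beta> *\<^sub>R ?v) / 2)) * of_real ?c"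
    by (subst integral_mult_left_zero, subst tgt.char_centered) (rule refl)
  also have "\<dots> = of_real (exp (- inner (X (\<beta> *\<^sub>R ?v)) (\<beta> *\<^sub>R ?v) / 2 + - (\<Sum>i<n. (p i)\<^sup>2 * s i) / 2))"
    by (simp only: exp_add of_real_mult)
  also have "- inner (X (\<beta> *\<^sub>R ?v)) (\<beta> *\<^sub>R ?v) / 2 + - (\<Sum>i<n. (p i)\<^sup>2 * s i) / 2 = - ((\<Sum>i<n. (p i)\<^sup>2 * s i) + \<beta>\<^sup>2 * inner (X ?v) ?v) / 2"
    by (simp only: blinfun.scaleR_right inner_scaleR_left inner_scaleR_right) (simp add: power2_eq_square)
  finally have "Re (CLINT z|\<mu> \<Otimes>\<^sub>M \<nu>. ?f (fst z) (snd z)) = exp (- ((\<Sum>i<n. (p i)\<^sup>2 * s i) + \<beta>\<^sup>2 * inner (X ?v) ?v) / 2)"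
    by (simp only: Re_complex_of_real)
  moreover have "Re (CLINT z|\<mu> \<Otimes>\<^sub>M \<nu>. ?f (fst z) (snd z)) = (\<integral>z. Re (?f (fst z) (snd z)) \<partial>(\<mu> \<Otimes>\<^sub>M \<nu>))"
    by (simp only: Bochner_Integration.integral_Re[OF int])
  moreover have "Re (?f x y) = exp (G x y) * cos (?r x)" for x y
    by (simp add: cis_conv_exp[symmetric] del: of_real_sum)
  ultimately show ?thesis by simp
qed

lemma integral_cos_source:
  "(\<integral>x. cos (\<Sum>i<n. p i * \<xi> i x) \<partial>\<mu>) = exp (- (\<Sum>i<n. (p i)\<^sup>2) / 2)"
proof -
  let ?h = "\<Sum>i<n. p i *\<^sub>R u i"
  have r: "(\<Sum>i<n. p i * \<xi> i x) = inner ?h (x - m\<^sub>0)" for x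
    by (simp add: \<xi>_def inner_sum_left)
  have "inner (C\<^sub>0 ?h) ?h = (\<Sum>i<n. \<Sum>j<n. p i * (p j * inner (C\<^sub>0 (u i)) (u j)))"
    unfolding blinfun.sum_right blinfun.scaleR_right inner_sum_left inner_scaleR_left
    unfolding inner_sum_right inner_scaleR_right sum_distrib_left by (rule refl)
  also have "\<dots> = (\<Sum>i<n. \<Sum>j<n. if j = i then (p i)\<^sup>2 else 0)"
    by (intro sum.cong refl) (auto simp: orthonormal power2_eq_square)
  finally have v: "inner (C\<^sub>0 ?h) ?h = (\<Sum>i<n. (p i)\<^sup>2)" by simp
  have "(CLINT x|\<mu>. iexp (inner ?h (x - m\<^sub>0))) = of_real (exp (- (\<Sum>i<n. (p i)\<^sup>2) / 2))"
    unfolding src.char_centered v ..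
  then have "Re (CLINT x|\<mu>. iexp (inner ?h (x - m\<^sub>0))) = exp (- (\<Sum>i<n. (p i)\<^sup>2) / 2)"
    by (simp only: Re_complex_of_real)
  moreover have "complex_integrable \<mu> (\<lambda>x. iexp (inner ?h (x - m\<^sub>0)))"
    by (intro src.integrable_const_bound[of _ 1]) auto
  then have "Re (CLINT x|\<mu>. iexp (inner ?h (x - m\<^sub>0))) = (\<integral>x. Re (iexp (inner ?h (x - m\<^sub>0))) \<partial>\<mu>)" by simp
  ultimately show ?thesis unfolding r by (simp add: cis_conv_exp[symmetric])
qed

end

section \<open>Integrals under couplings\<close>

lemma coupling_integral_fst:
  fixes f :: "'a \<Rightarrow> real"
  assumes "\<gamma> \<in> couplings \<mu> \<nu>" "integrable \<mu> f"
  shows "integrable \<gamma> (\<lambda>z. f (fst z))" "(\<integral>z. f (fst z) \<partial>\<gamma>) = (\<integral>x. f x \<partial>\<mu>)"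
proof -
  have m: "fst \<in> measurable \<gamma> \<mu>" and d: "distr \<gamma> \<mu> fst = \<mu>"
    using assms(1) by (auto simp: couplings_def cong: measurable_cong_sets)
  show "integrable \<gamma> (\<lambda>z. f (fst z))"
    using integrable_distr[OF m, of f] d assms(2) by simp
  show "(\<integral>z. f (fst z) \<partial>\<gamma>) = (\<integral>x. f x \<partial>\<mu>)"
    using integral_distr[OF m borel_measurable_integrable[OF assms(2)]] d by simp
qed

lemma coupling_integral_snd:
  fixes f :: "'a \<Rightarrow> real"
  assumes "\<gamma> \<in> couplings \<mu> \<nu>" "integrable \<nu> f"
  shows "integrable \<gamma> (\<lambda>z. f (snd z))" "(\<integral>z. f (snd z) \<partial>\<gamma>) = (\<integral>x. f x \<partial>\<nu>)"
proof -
  have m: "snd \<in> measurable \<gamma> \<nu>" and d: "distr \<gamma> \<nu> snd = \<nu>"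
    using assms(1) by (auto simp: couplings_def cong: measurable_cong_sets)
  show "integrable \<gamma> (\<lambda>z. f (snd z))"
    using integrable_distr[OF m, of f] d assms(2) by simp
  show "(\<integral>z. f (snd z) \<partial>\<gamma>) = (\<integral>x. f x \<partial>\<nu>)"
    using integral_distr[OF m borel_measurable_integrable[OF assms(2)]] d by simp
qed

section \<open>Cost plus potential under an arbitrary coupling\<close>

context ot_potential
begin

text \<open>The part of \<open>x - m\<^sub>0\<close> that the finite family does not resolve. It is
  built from source data only, so all targets share it.\<close>

definition resid where "resid x = (x - m\<^sub>0) - (\<Sum>i<n. \<xi> i x *\<^sub>R C\<^sub>0 (u i))"

text \<open>The integral of the cost plus \<open>\<epsilon> * G\<close> under any coupling, up to
  the residual term; the leading 1 in each summand is the second moment of \<open>\<xi> i\<close>.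
  For fixed \<open>s\<close> it is affine in the target covariance, through \<open>w i\<close> and
  the trace.\<close>

definition base where
  "base = (norm (m\<^sub>0 - m))\<^sup>2 + (\<integral>x. (norm (x - m\<^sub>0))\<^sup>2 \<partial>\<mu>) + (\<integral>y. (norm (y - m))\<^sup>2 \<partial>\<nu>)
    + (\<Sum>i<n. \<epsilon> / 2 * (1 - ln (s i) - 1 / s i - \<beta>\<^sup>2 * s i * w i))"

lemma measurable_resid [measurable]: "resid \<in> borel_measurable borel"
  unfolding resid_def[abs_def] by measurable

text \<open>After the cancellation \<open>\<epsilon> * \<beta> = 2\<close>, the inner product with
  \<open>resid x\<close> is the only term that still couples \<open>x\<close> and
  \<open>y\<close>.\<close>

lemma cost_plus_G:
  "(norm (x - y))\<^sup>2 + \<epsilon> * G x y = (norm (m\<^sub>0 - m))\<^sup>2 + 2 * inner (m\<^sub>0 - m) (x - m\<^sub>0) - 2 * inner (m\<^sub>0 - m) (y - m)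
    + (norm (x - m\<^sub>0))\<^sup>2 + (norm (y - m))\<^sup>2 - 2 * inner (resid x) (y - m)
    + (\<Sum>i<n. \<epsilon> / 2 * (- ln (s i) - (\<xi> i x)\<^sup>2 / s i + (\<xi> i x)\<^sup>2 - \<beta>\<^sup>2 * s i * (\<eta> i y)\<^sup>2))"
proof -
  have sq: "(norm (a + b - c))\<^sup>2 = (norm a)\<^sup>2 + (norm b)\<^sup>2 + (norm c)\<^sup>2 + 2 * inner a b - 2 * inner a c - 2 * inner b c"
    for a b c :: 'a
    by (simp add: power2_norm_eq_inner inner_add inner_diff inner_commute algebra_simps)
  have xy: "(norm (x - y))\<^sup>2 = (norm (m\<^sub>0 - m))\<^sup>2 + (norm (x - m\<^sub>0))\<^sup>2 + (norm (y - m))\<^sup>2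
      + 2 * inner (m\<^sub>0 - m) (x - m\<^sub>0) - 2 * inner (m\<^sub>0 - m) (y - m) - 2 * inner (x - m\<^sub>0) (y - m)"
    using sq[of "m\<^sub>0 - m" "x - m\<^sub>0" "y - m"] by simp
  have cross: "inner (x - m\<^sub>0) (y - m) = inner (resid x) (y - m) + (\<Sum>i<n. \<xi> i x * \<eta> i y)"
    unfolding resid_def \<eta>_def by (simp add: inner_diff_left inner_sum_left)
  have "\<epsilon> * log_kernel \<beta> (s i) a b = \<epsilon> / 2 * (- ln (s i) - a\<^sup>2 / s i + a\<^sup>2 - \<beta>\<^sup>2 * s i * b\<^sup>2) + 2 * (a * b)"
    if "i < n" for i a b
  proof -
    have "(a - q * r * b)\<^sup>2 / (2 * r) = a\<^sup>2 / (2 * r) - q * (a * b) + q\<^sup>2 * r * b\<^sup>2 / 2" if "r > 0" for q r :: real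
      using that by (simp add: field_simps power2_eq_square)
    from this[OF s_pos[OF that], of \<beta>]
    have "(a - \<beta> * s i * b)\<^sup>2 / (2 * s i) = a\<^sup>2 / (2 * s i) - \<beta> * (a * b) + \<beta>\<^sup>2 * s i * b\<^sup>2 / 2" .
    then have "\<epsilon> * log_kernel \<beta> (s i) a b = \<epsilon> * (- ln (s i) / 2 - (a\<^sup>2 / (2 * s i) - \<beta> * (a * b) + \<beta>\<^sup>2 * s i * b\<^sup>2 / 2) + a\<^sup>2 / 2)"
      by (simp only: log_kernel_def)
    also have "\<dots> = \<epsilon> / 2 * (- ln (s i) - a\<^sup>2 / s i + a\<^sup>2 - \<beta>\<^sup>2 * s i * b\<^sup>2) + (\<epsilon> * \<beta>) * (a * b)"
      by (simp add: algebra_simps)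
    finally show ?thesis using \<epsilon> by simp
  qed
  then have "\<epsilon> * G x y = (\<Sum>i<n. \<epsilon> / 2 * (- ln (s i) - (\<xi> i x)\<^sup>2 / s i + (\<xi> i x)\<^sup>2 - \<beta>\<^sup>2 * s i * (\<eta> i y)\<^sup>2) + 2 * (\<xi> i x * \<eta> i y))"
    unfolding G_def sum_distrib_left by (intro sum.cong) auto
  then show ?thesis unfolding xy cross sum.distrib sum_distrib_left by (simp add: algebra_simps flip: sum_distrib_left)
qed

lemma coupling_sets:
  assumes "\<gamma> \<in> couplings \<mu> \<nu>"
  shows "prob_space \<gamma>" "sets \<gamma> = sets (\<mu> \<Otimes>\<^sub>M \<nu>)" "sets \<gamma> = sets (borel \<Otimes>\<^sub>M borel)"
  using assms sets_prod by (auto simp: couplings_def)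

text \<open>A weighted Young inequality, uniform over couplings. For \<open>\<phi> = resid\<close>
  the second moment can be made small enough to be divided by a small \<open>l\<close>, while the
  target moment is multiplied by \<open>l\<close>.\<close>

lemma coupling_cross:
  assumes \<gamma>: "\<gamma> \<in> couplings \<mu> \<nu>"
    and \<phi> [measurable]: "\<phi> \<in> borel_measurable borel" and int: "integrable \<mu> (\<lambda>x. (norm (\<phi> x))\<^sup>2)"
  shows "integrable \<gamma> (\<lambda>z. inner (\<phi> (fst z)) (snd z - m))" (is ?int)
    and "l > 0 \<Longrightarrow> \<bar>2 * (\<integral>z. inner (\<phi> (fst z)) (snd z - m) \<partial>\<gamma>)\<bar>
      \<le> (\<integral>x. (norm (\<phi> x))\<^sup>2 \<partial>\<mu>) / l + l * (\<integral>y. (norm (y - m))\<^sup>2 \<partial>\<nu>)"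
proof -
  note [measurable_cong] = coupling_sets(3)[OF \<gamma>]
  note i1 = coupling_integral_fst[OF \<gamma> int] and i2 = coupling_integral_snd[OF \<gamma> tgt_moment]
  have bd: "\<bar>2 * inner a b\<bar> \<le> (norm a)\<^sup>2 / l + l * (norm b)\<^sup>2" if "l > 0" for a b :: 'a and l :: real
  proof -
    have "0 \<le> (norm a / sqrt l - sqrt l * norm b)\<^sup>2" by simp
    also have "\<dots> = (norm a)\<^sup>2 / l + l * (norm b)\<^sup>2 - 2 * (norm a * norm b)"
      using that by (simp add: power2_diff power_divide power_mult_distrib)
    finally show ?thesis using Cauchy_Schwarz_ineq2[of a b] by (simp add: abs_mult)
  qed
  show ?int
  proof (rule Bochner_Integration.integrable_bound)
    show "integrable \<gamma> (\<lambda>z. (norm (\<phi> (fst z)))\<^sup>2 + (norm (snd z - m))\<^sup>2)" using i1 i2 by simp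
    have "\<bar>inner a b\<bar> \<le> (norm a)\<^sup>2 + (norm b)\<^sup>2" for a b :: 'a
      using bd[of 1 a b] by (simp add: abs_mult)
    then show "AE z in \<gamma>. norm (inner (\<phi> (fst z)) (snd z - m)) \<le> norm ((norm (\<phi> (fst z)))\<^sup>2 + (norm (snd z - m))\<^sup>2)"
      by simp
  qed measurable
  then have i3: "integrable \<gamma> (\<lambda>z. 2 * inner (\<phi> (fst z)) (snd z - m))" by simp
  assume l: "l > 0"
  have "\<bar>\<integral>z. 2 * inner (\<phi> (fst z)) (snd z - m) \<partial>\<gamma>\<bar> \<le> (\<integral>z. \<bar>2 * inner (\<phi> (fst z)) (snd z - m)\<bar> \<partial>\<gamma>)"
    by (rule integral_abs_bound)
  also have "\<dots> \<le> (\<integral>z. (norm (\<phi> (fst z)))\<^sup>2 / l + l * (norm (snd z - m))\<^sup>2 \<partial>\<gamma>)"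
    using i1 i2 i3 bd[OF l] by (intro integral_mono integrable_abs Bochner_Integration.integrable_add) auto
  also have "\<dots> = (\<integral>x. (norm (\<phi> x))\<^sup>2 \<partial>\<mu>) / l + l * (\<integral>y. (norm (y - m))\<^sup>2 \<partial>\<nu>)"
    using i1 i2 by simp
  finally show "\<bar>2 * (\<integral>z. inner (\<phi> (fst z)) (snd z - m) \<partial>\<gamma>)\<bar>
      \<le> (\<integral>x. (norm (\<phi> x))\<^sup>2 \<partial>\<mu>) / l + l * (\<integral>y. (norm (y - m))\<^sup>2 \<partial>\<nu>)" by simp
qed

lemma coupling_cost_plus_G:
  assumes \<gamma>: "\<gamma> \<in> couplings \<mu> \<nu>" and int: "integrable \<mu> (\<lambda>x. (norm (resid x))\<^sup>2)"
  shows "integrable \<gamma> (\<lambda>z. (norm (fst z - snd z))\<^sup>2 + \<epsilon> * G (fst z) (snd z))"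
    and "(\<integral>z. (norm (fst z - snd z))\<^sup>2 + \<epsilon> * G (fst z) (snd z) \<partial>\<gamma>)
      = base - 2 * (\<integral>z. inner (resid (fst z)) (snd z - m) \<partial>\<gamma>)"
proof -
  interpret \<gamma>: prob_space \<gamma> by (rule coupling_sets(1)[OF \<gamma>])
  note cr = coupling_cross(1)[OF \<gamma> measurable_resid int]
  have f: "has_bochner_integral \<gamma> (\<lambda>z. inner h (fst z - m\<^sub>0)) 0"
    "has_bochner_integral \<gamma> (\<lambda>z. (inner h (fst z - m\<^sub>0))\<^sup>2) (inner (C\<^sub>0 h) h)" for h
    using coupling_integral_fst[OF \<gamma> src.integrable_linear[of h]] coupling_integral_fst[OF \<gamma> src.integrable_square[of h]]
    by (auto simp: has_bochner_integral_iff)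
  have s: "has_bochner_integral \<gamma> (\<lambda>z. inner h (snd z - m)) 0"
    "has_bochner_integral \<gamma> (\<lambda>z. (inner h (snd z - m))\<^sup>2) (inner (X h) h)" for h
    using coupling_integral_snd[OF \<gamma> tgt.integrable_linear[of h]] coupling_integral_snd[OF \<gamma> tgt.integrable_square[of h]]
    by (auto simp: has_bochner_integral_iff)
  have nf: "has_bochner_integral \<gamma> (\<lambda>z. (norm (fst z - m\<^sub>0))\<^sup>2) (\<integral>x. (norm (x - m\<^sub>0))\<^sup>2 \<partial>\<mu>)"
    using coupling_integral_fst[OF \<gamma> src_moment] by (simp add: has_bochner_integral_iff)
  have ns: "has_bochner_integral \<gamma> (\<lambda>z. (norm (snd z - m))\<^sup>2) (\<integral>y. (norm (y - m))\<^sup>2 \<partial>\<nu>)"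
    using coupling_integral_snd[OF \<gamma> tgt_moment] by (simp add: has_bochner_integral_iff)
  have cst: "has_bochner_integral \<gamma> (\<lambda>_. c) c" for c :: real
    by (simp add: has_bochner_integral_iff \<gamma>.prob_space)
  have x2: "has_bochner_integral \<gamma> (\<lambda>z. (\<xi> i (fst z))\<^sup>2) 1" if "i < n" for i
    using f(2)[of "u i"] orthonormal[OF that that] by (simp add: \<xi>_def)
  have y2: "has_bochner_integral \<gamma> (\<lambda>z. (\<eta> i (snd z))\<^sup>2) (w i)" for i
    using s(2)[of "C\<^sub>0 (u i)"] by (simp add: \<eta>_def w_def)
  have sm: "has_bochner_integral \<gamma>
      (\<lambda>z. \<Sum>i<n. \<epsilon> / 2 * (- ln (s i) - (\<xi> i (fst z))\<^sup>2 / s i + (\<xi> i (fst z))\<^sup>2 - \<beta>\<^sup>2 * s i * (\<eta> i (snd z))\<^sup>2))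
      (\<Sum>i<n. \<epsilon> / 2 * (- ln (s i) - 1 / s i + 1 - \<beta>\<^sup>2 * s i * w i))"
    by (intro has_bochner_integral_sum has_bochner_integral_mult_right has_bochner_integral_diff
        has_bochner_integral_add has_bochner_integral_divide_zero cst x2 y2) simp_all
  have "has_bochner_integral \<gamma> (\<lambda>z. (norm (fst z - snd z))\<^sup>2 + \<epsilon> * G (fst z) (snd z))
    ((norm (m\<^sub>0 - m))\<^sup>2 + 2 * 0 - 2 * 0 + (\<integral>x. (norm (x - m\<^sub>0))\<^sup>2 \<partial>\<mu>) + (\<integral>y. (norm (y - m))\<^sup>2 \<partial>\<nu>)
      - 2 * (\<integral>z. inner (resid (fst z)) (snd z - m) \<partial>\<gamma>)
      + (\<Sum>i<n. \<epsilon> / 2 * (- ln (s i) - 1 / s i + 1 - \<beta>\<^sup>2 * s i * w i)))"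
    unfolding cost_plus_G
    by (intro has_bochner_integral_add has_bochner_integral_diff has_bochner_integral_mult_right
        cst f s nf ns sm has_bochner_integral_integrable[OF cr])
  then show "integrable \<gamma> (\<lambda>z. (norm (fst z - snd z))\<^sup>2 + \<epsilon> * G (fst z) (snd z))"
    and "(\<integral>z. (norm (fst z - snd z))\<^sup>2 + \<epsilon> * G (fst z) (snd z) \<partial>\<gamma>)
      = base - 2 * (\<integral>z. inner (resid (fst z)) (snd z - m) \<partial>\<gamma>)"
    by (auto simp: has_bochner_integral_iff base_def algebra_simps)
qed

lemma coupling_integrable_cost:
  assumes \<gamma>: "\<gamma> \<in> couplings \<mu> \<nu>"
  shows "integrable \<gamma> (\<lambda>z. (norm (fst z - snd z))\<^sup>2)"
proof (rule Bochner_Integration.integrable_bound)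
  note [measurable_cong] = coupling_sets(3)[OF \<gamma>]
  interpret \<gamma>: prob_space \<gamma> by (rule coupling_sets(1)[OF \<gamma>])
  show "(\<lambda>z. (norm (fst z - snd z))\<^sup>2) \<in> borel_measurable \<gamma>" by measurable
  show "integrable \<gamma> (\<lambda>z. 3 * ((norm (m\<^sub>0 - m))\<^sup>2 + (norm (fst z - m\<^sub>0))\<^sup>2 + (norm (snd z - m))\<^sup>2))"
    using coupling_integral_fst(1)[OF \<gamma> src_moment] coupling_integral_snd(1)[OF \<gamma> tgt_moment] by simp
  have "(norm (x - y))\<^sup>2 \<le> 3 * ((norm (m\<^sub>0 - m))\<^sup>2 + (norm (x - m\<^sub>0))\<^sup>2 + (norm (y - m))\<^sup>2)" for x y
  proof -
    have "norm (x - y) = norm ((m\<^sub>0 - m) + (x - m\<^sub>0) - (y - m))" by simp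
    also have "\<dots> \<le> norm ((m\<^sub>0 - m) + (x - m\<^sub>0)) + norm (y - m)" by (rule norm_triangle_ineq4)
    also have "\<dots> \<le> norm (m\<^sub>0 - m) + norm (x - m\<^sub>0) + norm (y - m)"
      by (intro add_right_mono norm_triangle_ineq)
    finally have "norm (x - y) \<le> norm (m\<^sub>0 - m) + norm (x - m\<^sub>0) + norm (y - m)" .
    then have "(norm (x - y))\<^sup>2 \<le> (norm (m\<^sub>0 - m) + norm (x - m\<^sub>0) + norm (y - m))\<^sup>2"
      by (intro power_mono) auto
    also have "\<dots> \<le> 3 * ((norm (m\<^sub>0 - m))\<^sup>2 + (norm (x - m\<^sub>0))\<^sup>2 + (norm (y - m))\<^sup>2)"
    proof -
      have "(a + b + c)\<^sup>2 \<le> 3 * (a\<^sup>2 + b\<^sup>2 + c\<^sup>2)" for a b c :: real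
        using zero_le_power2[of "a - b"] zero_le_power2[of "a - c"] zero_le_power2[of "b - c"]
        by (simp add: power2_eq_square algebra_simps)
      then show ?thesis .
    qed
    finally show ?thesis .
  qed
  then show "AE z in \<gamma>. norm ((norm (fst z - snd z))\<^sup>2)
      \<le> norm (3 * ((norm (m\<^sub>0 - m))\<^sup>2 + (norm (fst z - m\<^sub>0))\<^sup>2 + (norm (snd z - m))\<^sup>2))"
    by (auto intro!: AE_I2)
qed

text \<open>Cost plus \<open>\<epsilon> * G\<close> is integrable by its explicit form; subtracting
  the integrable cost leaves \<open>G\<close>.\<close>

lemma coupling_integrable_G:
  assumes \<gamma>: "\<gamma> \<in> couplings \<mu> \<nu>" and int: "integrable \<mu> (\<lambda>x. (norm (resid x))\<^sup>2)"
  shows "integrable \<gamma> (\<lambda>z. G (fst z) (snd z))"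
    and "(\<integral>z. (norm (fst z - snd z))\<^sup>2 \<partial>\<gamma>) + \<epsilon> * (\<integral>z. G (fst z) (snd z) \<partial>\<gamma>)
      = base - 2 * (\<integral>z. inner (resid (fst z)) (snd z - m) \<partial>\<gamma>)"
proof -
  note i = coupling_cost_plus_G[OF assms] and c = coupling_integrable_cost[OF \<gamma>]
  have "integrable \<gamma> (\<lambda>z. (((norm (fst z - snd z))\<^sup>2 + \<epsilon> * G (fst z) (snd z)) - (norm (fst z - snd z))\<^sup>2) / \<epsilon>)"
    using i(1) c by (intro integrable_divide_zero Bochner_Integration.integrable_diff) auto
  then show g: "integrable \<gamma> (\<lambda>z. G (fst z) (snd z))" using \<epsilon> by simp
  show "(\<integral>z. (norm (fst z - snd z))\<^sup>2 \<partial>\<gamma>) + \<epsilon> * (\<integral>z. G (fst z) (snd z) \<partial>\<gamma>)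
      = base - 2 * (\<integral>z. inner (resid (fst z)) (snd z - m) \<partial>\<gamma>)"
    using i(2) g c by simp
qed

end

section \<open>Bounds for the transport cost\<close>

context ot_potential
begin

text \<open>Weak duality with \<open>G\<close> plus \<open>\<kappa>\<close> times a cosine, for any
  target. The gain is \<open>\<kappa>\<close> times the difference of the means of the cosine under
  \<open>\<mu>\<close> and under the first marginal of \<open>exp G\<close>, at the price
  \<open>\<kappa>\<^sup>2\<close>; \<open>\<kappa> = 0\<close> is the plain bound.\<close>

lemma OT_eps_lower_bound:
  assumes int: "integrable \<mu> (\<lambda>x. (norm (resid x))\<^sup>2)" and l: "l > 0" and \<kappa>: "\<bar>\<kappa>\<bar> \<le> 1"
    and v: "v = (\<Sum>i<n. (p i * s i) *\<^sub>R C\<^sub>0 (u i))"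
  shows "ennreal (base - ((\<integral>x. (norm (resid x))\<^sup>2 \<partial>\<mu>) / l + l * (\<integral>y. (norm (y - m))\<^sup>2 \<partial>\<nu>))
      + \<epsilon> * (\<kappa> * exp (- (\<Sum>i<n. (p i)\<^sup>2) / 2)
          - \<kappa> * exp (- ((\<Sum>i<n. (p i)\<^sup>2 * s i) + \<beta>\<^sup>2 * inner (X v) v) / 2) - \<kappa>\<^sup>2))
    \<le> OT_eps \<epsilon> \<mu> \<nu>"
  unfolding OT_eps_def
proof (rule INF_greatest)
  fix \<gamma> assume \<gamma>: "\<gamma> \<in> couplings \<mu> \<nu>"
  interpret \<gamma>: prob_space \<gamma> by (rule coupling_sets(1)[OF \<gamma>])
  let ?N = "\<mu> \<Otimes>\<^sub>M \<nu>"
  let ?E0 = "exp (- (\<Sum>i<n. (p i)\<^sup>2) / 2)"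
  let ?E1 = "exp (- ((\<Sum>i<n. (p i)\<^sup>2 * s i) + \<beta>\<^sup>2 * inner (X v) v) / 2)"
  let ?c = "\<lambda>x. cos (\<Sum>i<n. p i * \<xi> i x)"
  let ?G' = "\<lambda>z. G (fst z) (snd z) + \<kappa> * ?c (fst z)"
  \<comment> \<open>The cosine is a function of \<open>x\<close> alone, so every coupling gives it
    the same mean.\<close>
  have ci: "integrable \<mu> ?c" by (intro src.integrable_const_bound[of _ 1]) auto
  note cg = coupling_integral_fst[OF \<gamma> ci]
  note gi = coupling_integrable_G[OF \<gamma> int]
  have iG': "integrable \<gamma> ?G'" using gi(1) cg(1) by simp
  have eG': "(\<integral>z. ?G' z \<partial>\<gamma>) = (\<integral>z. G (fst z) (snd z) \<partial>\<gamma>) + \<kappa> * ?E0"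
    using gi(1) cg by (simp add: integral_cos_source)
  have kc: "\<bar>\<kappa> * cos a\<bar> \<le> \<bar>\<kappa>\<bar>" for a
    by (simp add: abs_mult mult_left_le)
  have iexp: "integrable ?N (\<lambda>z. exp (?G' z))"
  proof (rule Bochner_Integration.integrable_bound)
    show "integrable ?N (\<lambda>z. exp \<bar>\<kappa>\<bar> * exp (G (fst z) (snd z)))" using integrable_exp_G by simp
    have "exp (g + \<kappa> * cos a) \<le> exp \<bar>\<kappa>\<bar> * exp g" for g a
      using kc[of a] by (simp flip: exp_add)
    then show "AE z in ?N. norm (exp (?G' z)) \<le> norm (exp \<bar>\<kappa>\<bar> * exp (G (fst z) (snd z)))"
      by simp
  qed measurable
  have icos: "integrable ?N (\<lambda>z. exp (G (fst z) (snd z)) * ?c (fst z))"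
    by (rule Bochner_Integration.integrable_bound[OF integrable_exp_G]) (auto simp: abs_mult mult_left_le)
  have "(\<integral>z. exp (?G' z) \<partial>?N)
      \<le> (\<integral>z. exp (G (fst z) (snd z)) + \<kappa> * (exp (G (fst z) (snd z)) * ?c (fst z)) + \<kappa>\<^sup>2 * exp (G (fst z) (snd z)) \<partial>?N)"
  proof (rule integral_mono[OF iexp])
    show "integrable ?N (\<lambda>z. exp (G (fst z) (snd z)) + \<kappa> * (exp (G (fst z) (snd z)) * ?c (fst z)) + \<kappa>\<^sup>2 * exp (G (fst z) (snd z)))"
      using integrable_exp_G icos by simp
    have "exp (g + \<kappa> * cos a) \<le> exp g + \<kappa> * (exp g * cos a) + \<kappa>\<^sup>2 * exp g" for g a
    proof -
      have "exp (\<kappa> * cos a) \<le> 1 + \<kappa> * cos a + (\<kappa> * cos a)\<^sup>2"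
        using kc[of a] \<kappa> by (intro exp_le_quadratic) simp
      also have "(\<kappa> * cos a)\<^sup>2 \<le> \<kappa>\<^sup>2"
        by (simp add: power_mult_distrib mult_left_le abs_square_le_1)
      finally have "exp g * exp (\<kappa> * cos a) \<le> exp g * (1 + \<kappa> * cos a + \<kappa>\<^sup>2)" by simp
      then show ?thesis by (simp add: exp_add algebra_simps)
    qed
    then show "exp (?G' z) \<le> exp (G (fst z) (snd z)) + \<kappa> * (exp (G (fst z) (snd z)) * ?c (fst z)) + \<kappa>\<^sup>2 * exp (G (fst z) (snd z))" for z .
  qed
  also have "\<dots> = 1 + \<kappa> * ?E1 + \<kappa>\<^sup>2"
    using integrable_exp_G icos by (simp add: integral_exp_G integral_exp_G_cos v)
  finally have le: "(\<integral>z. exp (?G' z) \<partial>?N) \<le> 1 + \<kappa> * ?E1 + \<kappa>\<^sup>2" .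
  let ?g = "\<integral>z. G (fst z) (snd z) \<partial>\<gamma>"
  let ?B = "?g + \<kappa> * ?E0 - \<kappa> * ?E1 - \<kappa>\<^sup>2"
  have "ennreal ?B \<le> ennreal ((\<integral>z. ?G' z \<partial>\<gamma>) - (\<integral>z. exp (?G' z) \<partial>?N) + 1)"
    using le unfolding eG' by (intro ennreal_leI) simp
  also have "\<dots> \<le> KL \<gamma> ?N"
    by (rule KL_ge_exponential_dual[OF prob_space_axioms \<gamma>.prob_space_axioms _ iG' iexp]) measurable
  finally have kl: "ennreal ?B \<le> KL \<gamma> ?N" .
  let ?A = "\<integral>z. (norm (fst z - snd z))\<^sup>2 \<partial>\<gamma>"
  let ?err = "(\<integral>x. (norm (resid x))\<^sup>2 \<partial>\<mu>) / l + l * (\<integral>y. (norm (y - m))\<^sup>2 \<partial>\<nu>)"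
  have "base - ?err \<le> ?A + \<epsilon> * ?g"
    unfolding gi(2) using coupling_cross(2)[OF \<gamma> measurable_resid int l] by simp
  then have "base - ?err + \<epsilon> * (\<kappa> * ?E0 - \<kappa> * ?E1 - \<kappa>\<^sup>2) \<le> ?A + \<epsilon> * ?B"
    by (simp add: algebra_simps)
  then have "ennreal (base - ?err + \<epsilon> * (\<kappa> * ?E0 - \<kappa> * ?E1 - \<kappa>\<^sup>2)) \<le> ennreal (?A + \<epsilon> * ?B)"
    by (rule ennreal_leI)
  also have "\<dots> \<le> ennreal ?A + ennreal (\<epsilon> * ?B)" by (rule ennreal_add_le)
  also have "\<dots> = (\<integral>\<^sup>+ z. ennreal ((norm (fst z - snd z))\<^sup>2) \<partial>\<gamma>) + ennreal \<epsilon> * ennreal ?B"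
    using \<epsilon> coupling_integrable_cost[OF \<gamma>] by (simp add: nn_integral_eq_integral ennreal_mult')
  also have "\<dots> \<le> (\<integral>\<^sup>+ z. ennreal ((norm (fst z - snd z))\<^sup>2) \<partial>\<gamma>) + ennreal \<epsilon> * KL \<gamma> ?N"
    by (intro add_left_mono mult_left_mono kl) auto
  finally show "ennreal (base - ?err + \<epsilon> * (\<kappa> * ?E0 - \<kappa> * ?E1 - \<kappa>\<^sup>2))
      \<le> (\<integral>\<^sup>+ z. ennreal ((norm (fst z - snd z))\<^sup>2) \<partial>\<gamma>) + ennreal \<epsilon> * KL \<gamma> ?N" .
qed

text \<open>Integrating \<open>exp G\<close> over either variable gives 1, so both marginals keep
  their laws.\<close>

lemma density_exp_G_coupling:
  assumes tgt1: "\<And>x. (\<integral>\<^sup>+y. ennreal (exp (G x y)) \<partial>\<nu>) = 1"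
  shows "density (\<mu> \<Otimes>\<^sub>M \<nu>) (\<lambda>z. ennreal (exp (G (fst z) (snd z)))) \<in> couplings \<mu> \<nu>" (is "?\<gamma> \<in> _")
proof -
  let ?N = "\<mu> \<Otimes>\<^sub>M \<nu>"
  have "prob_space ?\<gamma>"
  proof (rule prob_spaceI)
    have "emeasure ?\<gamma> (space ?N) = (\<integral>\<^sup>+z. ennreal (exp (G (fst z) (snd z))) * indicator (space ?N) z \<partial>?N)"
      by (rule emeasure_density) measurable
    also have "\<dots> = (\<integral>\<^sup>+z. ennreal (exp (G (fst z) (snd z))) \<partial>?N)"
      by (intro nn_integral_cong) simp
    finally show "emeasure ?\<gamma> (space ?\<gamma>) = 1" by (simp add: nn_integral_exp_G)
  qed
  moreover have "distr ?\<gamma> \<mu> fst = \<mu>"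
  proof (rule measure_eqI)
    fix A assume A: "A \<in> sets (distr ?\<gamma> \<mu> fst)"
    then have [measurable]: "A \<in> sets \<mu>" by simp
    have "emeasure (distr ?\<gamma> \<mu> fst) A = emeasure ?\<gamma> (fst -` A \<inter> space ?N)"
      using A by (subst emeasure_distr) auto
    also have "\<dots> = (\<integral>\<^sup>+z. ennreal (exp (G (fst z) (snd z))) * indicator (fst -` A \<inter> space ?N) z \<partial>?N)"
      by (rule emeasure_density) measurable
    also have "\<dots> = (\<integral>\<^sup>+z. indicator A (fst z) * ennreal (exp (G (fst z) (snd z))) \<partial>?N)"
      by (intro nn_integral_cong) (auto simp: indicator_def)
    also have "\<dots> = (\<integral>\<^sup>+x. (\<integral>\<^sup>+y. indicator A x * ennreal (exp (G x y)) \<partial>\<nu>) \<partial>\<mu>)"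
      by (subst tgt.nn_integral_fst[symmetric]) simp_all
    also have "\<dots> = (\<integral>\<^sup>+x. indicator A x \<partial>\<mu>)"
      unfolding G_def by (subst nn_integral_cmult) (simp_all add: tgt1[unfolded G_def])
    finally show "emeasure (distr ?\<gamma> \<mu> fst) A = emeasure \<mu> A" using A by simp
  qed simp
  moreover have "distr ?\<gamma> \<nu> snd = \<nu>"
  proof (rule measure_eqI)
    fix A assume A: "A \<in> sets (distr ?\<gamma> \<nu> snd)"
    then have [measurable]: "A \<in> sets \<nu>" by simp
    have "emeasure (distr ?\<gamma> \<nu> snd) A = emeasure ?\<gamma> (snd -` A \<inter> space ?N)"
      using A by (subst emeasure_distr) auto
    also have "\<dots> = (\<integral>\<^sup>+z. ennreal (exp (G (fst z) (snd z))) * indicator (snd -` A \<inter> space ?N) z \<partial>?N)"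
      by (rule emeasure_density) measurable
    also have "\<dots> = (\<integral>\<^sup>+z. indicator A (snd z) * ennreal (exp (G (fst z) (snd z))) \<partial>?N)"
      by (intro nn_integral_cong) (auto simp: indicator_def)
    also have "\<dots> = (\<integral>\<^sup>+y. (\<integral>\<^sup>+x. indicator A y * ennreal (exp (G x y)) \<partial>\<mu>) \<partial>\<nu>)"
      by (subst nn_integral_snd[symmetric]) simp_all
    also have "\<dots> = (\<integral>\<^sup>+y. indicator A y \<partial>\<nu>)"
      unfolding G_def by (subst nn_integral_cmult) (simp_all add: nn_integral_exp_G_source[unfolded G_def])
    finally show "emeasure (distr ?\<gamma> \<nu> snd) A = emeasure \<nu> A" using A by simp
  qed simp
  ultimately show ?thesis by (simp add: couplings_def)
qed

text \<open>For the coupling with density \<open>exp G\<close> the relative entropy is exactly the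
  integral of \<open>G\<close>, so duality is attained up to the residual. A real
  \<open>V \<ge> 0\<close> is returned so that strict inequalities between reals can be carried over
  to \<open>ennreal\<close>.\<close>

lemma OT_eps_upper_bound:
  assumes tgt1: "\<And>x. (\<integral>\<^sup>+y. ennreal (exp (G x y)) \<partial>\<nu>) = 1"
    and int: "integrable \<mu> (\<lambda>x. (norm (resid x))\<^sup>2)" and l: "l > 0"
  obtains V where "0 \<le> V" "OT_eps \<epsilon> \<mu> \<nu> \<le> ennreal V"
    "V \<le> base + ((\<integral>x. (norm (resid x))\<^sup>2 \<partial>\<mu>) / l + l * (\<integral>y. (norm (y - m))\<^sup>2 \<partial>\<nu>))"
proof
  let ?N = "\<mu> \<Otimes>\<^sub>M \<nu>"
  let ?\<gamma> = "density ?N (\<lambda>z. ennreal (exp (G (fst z) (snd z))))"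
  note \<gamma> = density_exp_G_coupling[OF tgt1]
  note gi = coupling_integrable_G[OF \<gamma> int]
  let ?A = "\<integral>z. (norm (fst z - snd z))\<^sup>2 \<partial>?\<gamma>"
  let ?g = "\<integral>z. G (fst z) (snd z) \<partial>?\<gamma>"
  note kl = KL_density_exp[OF prob_space_axioms measurable_G_prod nn_integral_exp_G gi(1)]
  show "0 \<le> ?A + \<epsilon> * ?g" 
  proof -
    have "0 \<le> ?A" by (rule Bochner_Integration.integral_nonneg) simp
    then show ?thesis using kl(2) \<epsilon> by simp
  qed
  have "OT_eps \<epsilon> \<mu> \<nu> \<le> (\<integral>\<^sup>+ z. ennreal ((norm (fst z - snd z))\<^sup>2) \<partial>?\<gamma>) + ennreal \<epsilon> * KL ?\<gamma> ?N"
    unfolding OT_eps_def by (rule INF_lower[OF \<gamma>])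
  also have "\<dots> = ennreal ?A + ennreal \<epsilon> * ennreal ?g"
    unfolding kl(1) using coupling_integrable_cost[OF \<gamma>] by (simp add: nn_integral_eq_integral)
  also have "\<dots> = ennreal (?A + \<epsilon> * ?g)"
    using \<epsilon> kl(2) by (simp add: ennreal_plus ennreal_mult)
  finally show "OT_eps \<epsilon> \<mu> \<nu> \<le> ennreal (?A + \<epsilon> * ?g)" .
  show "?A + \<epsilon> * ?g \<le> base + ((\<integral>x. (norm (resid x))\<^sup>2 \<partial>\<mu>) / l + l * (\<integral>y. (norm (y - m))\<^sup>2 \<partial>\<nu>))"
    unfolding gi(2) using coupling_cross(2)[OF \<gamma> measurable_resid int l] by simp
qed

end

section \<open>Convexity\<close>

lemma (in psd_form) cauchy_schwarz: "(a x y)\<^sup>2 \<le> a x x * a y y"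
proof (cases "a x x = 0")
  case True
  then show ?thesis using null_left[OF True] by simp
next
  case False
  then have p: "a x x > 0" using nonneg[of x] by simp
  have "0 \<le> a (a x x *\<^sub>R y - a x y *\<^sub>R x) (a x x *\<^sub>R y - a x y *\<^sub>R x)" by (rule nonneg)
  also have "\<dots> = a x x * (a x x * a y y - (a x y)\<^sup>2)"
    by (simp add: diff_left diff_right scale_left scale_right sym[of y x] power2_eq_square algebra_simps)
  finally show ?thesis using p by (simp add: zero_le_mult_iff)
qed

lemma (in gaussian_measure) psd_form_covariance: "psd_form (\<lambda>x y. inner (C x) y)"
  by unfold_locales (auto simp: blinfun.add_right blinfun.scaleR_right inner_add_left symmetric)

text \<open>The positive root in rationalised form, valid also at \<open>q = 0\<close>. Dividing the
  equation by \<open>s\<close> gives \<open>1 / s = q * s + 1\<close>, and \<open>s \<le> 1\<close>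
  yields the bound.\<close>

lemma quadratic_root_bounds:
  fixes q :: real
  assumes "q \<ge> 0"
  obtains s where "s > 0" "q * s\<^sup>2 + s = 1" "1 / s \<le> 1 + q"
proof
  define r where "r = sqrt (1 + 4 * q)"
  have r: "r \<ge> 0" "r\<^sup>2 = 1 + 4 * q" using assms by (auto simp: r_def)
  let ?s = "2 / (1 + r)"
  show p: "?s > 0" using r by simp
  have "4 * q + 2 * (1 + r) = (1 + r)\<^sup>2" using r by (simp add: power2_eq_square algebra_simps)
  then have "(4 * q + 2 * (1 + r)) / (1 + r)\<^sup>2 = 1" using r by simp
  then have D: "4 * q / (1 + r)\<^sup>2 + 2 * (1 + r) / (1 + r)\<^sup>2 = 1" by (simp only: add_divide_distrib)
  have A: "q * ?s\<^sup>2 = 4 * q / (1 + r)\<^sup>2" by (simp add: power_divide)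
  have "1 + r \<noteq> 0" using r by simp
  then have E: "?s = 2 * (1 + r) / (1 + r)\<^sup>2"
    unfolding power2_eq_square by (rule nonzero_mult_divide_mult_cancel_right[symmetric])
  show e: "q * ?s\<^sup>2 + ?s = 1" unfolding A by (subst E) (rule D)
  have s1: "?s \<le> 1" using e assms by (smt (verit) mult_nonneg_nonneg zero_le_power2)
  have "1 = ?s * (q * ?s + 1)" using e by (simp add: power2_eq_square algebra_simps)
  then have "1 / ?s = q * ?s + 1" using p by (metis nonzero_mult_div_cancel_left less_numeral_extra(3))
  also have "\<dots> \<le> 1 + q" using mult_left_mono[OF s1 assms] by linarith
  finally show "1 / ?s \<le> 1 + q" .
qed

text \<open>The component of \<open>resid\<close> along \<open>e\<close> is a linear functional
  whose variance is the defect in the Parseval identity for \<open>e\<close>. It vanishes on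
  \<open>F N\<close> and is at most \<open>inner (C\<^sub>0 e) e\<close> elsewhere, so the second
  moment is bounded by a tail of the trace.\<close>

lemma (in ot_potential) resid_moment:
  assumes B: "orthonormal_basis B" and F: "exhausts F B"
    and complete: "\<And>e. e \<in> F N \<Longrightarrow> inner (C\<^sub>0 e) e = (\<Sum>i<n. (inner (C\<^sub>0 e) (u i))\<^sup>2)"
  shows "integrable \<mu> (\<lambda>x. (norm (resid x))\<^sup>2)"
    and "(\<integral>x. (norm (resid x))\<^sup>2 \<partial>\<mu>) \<le> (\<integral>x. (norm (x - m\<^sub>0))\<^sup>2 \<partial>\<mu>) - (\<Sum>e\<in>F N. inner (C\<^sub>0 e) e)"
proof -
  \<comment> \<open>The adjoint of the residual projection, acting on the test vector instead of
    \<open>x - m\<^sub>0\<close>.\<close>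
  define pr where "pr e = e - (\<Sum>i<n. inner (C\<^sub>0 (u i)) e *\<^sub>R u i)" for e
  define q where "q e = inner (C\<^sub>0 (pr e)) (pr e)" for e
  have er: "inner e (resid x) = inner (pr e) (x - m\<^sub>0)" for e x
    unfolding resid_def pr_def \<xi>_def
    by (simp only: inner_diff_right[of e] inner_diff_left inner_sum_left inner_sum_right inner_scaleR_left inner_scaleR_right)
      (simp add: inner_commute[of e] mult.commute)
  have q0: "q e \<ge> 0" for e by (simp add: q_def)
  interpret C: psd_form "\<lambda>x y. inner (C\<^sub>0 x) y" by (rule src.psd_form_covariance)
  have q: "q e = inner (C\<^sub>0 e) e - (\<Sum>i<n. (inner (C\<^sub>0 e) (u i))\<^sup>2)" for e
  proof -
    have pu: "inner (C\<^sub>0 (pr e)) (u j) = 0" if "j < n" for j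
    proof -
      have "(\<Sum>i<n. inner (C\<^sub>0 (u i)) e * inner (C\<^sub>0 (u i)) (u j)) = (\<Sum>i<n. if i = j then inner (C\<^sub>0 (u j)) e else 0)"
        by (intro sum.cong) (use that in \<open>auto simp: orthonormal\<close>)
      then show ?thesis using that unfolding pr_def C.diff_left C.sum_left C.scale_left
        by (simp add: src.symmetric)
    qed
    have "q e = inner (C\<^sub>0 (pr e)) e"
      unfolding q_def by (subst (2) pr_def) (simp only: C.diff_right C.sum_right C.scale_right, simp add: pu)
    also have "\<dots> = inner (C\<^sub>0 e) e - (\<Sum>i<n. (inner (C\<^sub>0 e) (u i))\<^sup>2)"
      unfolding pr_def C.diff_left C.sum_left C.scale_left by (simp add: power2_eq_square src.symmetric[of e "u _"])
    finally show ?thesis .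
  qed
  have le: "q e \<le> inner (C\<^sub>0 e) e" for e unfolding q by (simp add: sum_nonneg)
  have FB: "finite (F k)" for k using F by (auto simp: exhausts_def)
  have inc: "F j \<subseteq> F k" if "j \<le> k" for j k using F that by (auto simp: exhausts_def incseq_def)
  have bd: "(\<Sum>e\<in>F k. \<integral>x. (inner e (resid x))\<^sup>2 \<partial>\<mu>) \<le> (\<integral>x. (norm (x - m\<^sub>0))\<^sup>2 \<partial>\<mu>) - (\<Sum>e\<in>F N. inner (C\<^sub>0 e) e)" for k
  proof -
    let ?K = "max k N"
    have sub: "F k \<subseteq> F ?K" "F N \<subseteq> F ?K" by (auto intro!: inc)
    have "(\<Sum>e\<in>F k. \<integral>x. (inner e (resid x))\<^sup>2 \<partial>\<mu>) = (\<Sum>e\<in>F k. q e)" by (simp add: er q_def)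
    also have "\<dots> \<le> (\<Sum>e\<in>F ?K. q e)" by (intro sum_mono2 FB sub q0)
    also have "\<dots> = (\<Sum>e\<in>F ?K - F N. q e)"
      by (intro sum.mono_neutral_right FB) (auto simp: q complete)
    also have "\<dots> \<le> (\<Sum>e\<in>F ?K - F N. inner (C\<^sub>0 e) e)" by (intro sum_mono le)
    also have "\<dots> = (\<Sum>e\<in>F ?K. inner (C\<^sub>0 e) e) - (\<Sum>e\<in>F N. inner (C\<^sub>0 e) e)"
      by (intro sum_diff FB sub)
    also have "\<dots> \<le> (\<integral>x. (norm (x - m\<^sub>0))\<^sup>2 \<partial>\<mu>) - (\<Sum>e\<in>F N. inner (C\<^sub>0 e) e)"
      using src.trace_partial_sum[OF B F src_moment] by simp
    finally show ?thesis .
  qed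
  have "integrable \<mu> (\<lambda>x. (inner e (resid x))\<^sup>2)" for e by (simp add: er)
  note pi = parseval_integral[OF B F, of resid \<mu>, OF _ this bd]
  show "integrable \<mu> (\<lambda>x. (norm (resid x))\<^sup>2)"
    and "(\<integral>x. (norm (resid x))\<^sup>2 \<partial>\<mu>) \<le> (\<integral>x. (norm (x - m\<^sub>0))\<^sup>2 \<partial>\<mu>) - (\<Sum>e\<in>F N. inner (C\<^sub>0 e) e)"
    using pi(1,2) by simp_all
qed

lemma convex_norm_square:
  fixes a b :: "'a::real_inner"
  assumes "0 \<le> t" "t \<le> 1"
  shows "(norm (t *\<^sub>R a + (1 - t) *\<^sub>R b))\<^sup>2 \<le> t * (norm a)\<^sup>2 + (1 - t) * (norm b)\<^sup>2"
proof -
  have "t * (norm a)\<^sup>2 + (1 - t) * (norm b)\<^sup>2 - (norm (t *\<^sub>R a + (1 - t) *\<^sub>R b))\<^sup>2 = t * (1 - t) * (norm (a - b))\<^sup>2"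
    by (simp add: power2_norm_eq_inner inner_add inner_diff inner_commute algebra_simps)
  also have "\<dots> \<ge> 0" using assms by simp
  finally show ?thesis by simp
qed

text \<open>The touching point is \<open>Y\<close>; the lower bounds are taken at
  \<open>X\<^sub>1\<close> and \<open>X\<^sub>2\<close> with the same family, and only the first is
  perturbed. The bound on \<open>a\<close> does not mention \<open>\<delta>\<close>, so the gain can
  be estimated before the truncation is chosen.\<close>

lemma OT_eps_gaussian_convexity_defect:
  fixes \<epsilon> :: real
    and C\<^sub>0 X\<^sub>1 X\<^sub>2 :: "'a::{real_inner,second_countable_topology} \<Rightarrow>\<^sub>L 'a"
  assumes \<epsilon>: "\<epsilon> > 0" and C\<^sub>0: "C\<^sub>0 \<in> SymTr" and \<mu>: "is_gaussian m\<^sub>0 C\<^sub>0 \<mu>"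
    and t: "0 \<le> t" "t \<le> 1" and X: "X\<^sub>1 \<in> SymTr" "X\<^sub>2 \<in> SymTr"
    and \<nu>\<^sub>1: "is_gaussian m\<^sub>1 X\<^sub>1 \<nu>\<^sub>1" and \<nu>\<^sub>2: "is_gaussian m\<^sub>2 X\<^sub>2 \<nu>\<^sub>2"
    and \<nu>: "is_gaussian (t *\<^sub>R m\<^sub>1 + (1 - t) *\<^sub>R m\<^sub>2) (t *\<^sub>R X\<^sub>1 + (1 - t) *\<^sub>R X\<^sub>2) \<nu>"
    and \<delta>: "\<delta> > 0" and \<kappa>: "\<bar>\<kappa>\<bar> \<le> 1"
  defines "Y \<equiv> t *\<^sub>R X\<^sub>1 + (1 - t) *\<^sub>R X\<^sub>2"
  obtains V U\<^sub>1 U\<^sub>2 a where "0 \<le> V" "OT_eps \<epsilon> \<mu> \<nu> \<le> ennreal V"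
    "ennreal U\<^sub>1 \<le> OT_eps \<epsilon> \<mu> \<nu>\<^sub>1" "ennreal U\<^sub>2 \<le> OT_eps \<epsilon> \<mu> \<nu>\<^sub>2"
    "a \<le> (1 + (2 / \<epsilon>)\<^sup>2 * (norm Y * norm C\<^sub>0))\<^sup>2 * inner (C\<^sub>0 d) d"
    "V + t * \<epsilon> * (\<kappa> * exp (- a / 2) * (1 - exp (- (2 / \<epsilon>)\<^sup>2 * inner ((X\<^sub>1 - Y) (C\<^sub>0 d)) (C\<^sub>0 d) / 2)) - \<kappa>\<^sup>2)
      \<le> t * U\<^sub>1 + (1 - t) * U\<^sub>2 + \<delta>"
proof -
  define \<beta> where "\<beta> = 2 / \<epsilon>"
  define m where "m = t *\<^sub>R m\<^sub>1 + (1 - t) *\<^sub>R m\<^sub>2"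
  have Yap: "Y x = t *\<^sub>R X\<^sub>1 x + (1 - t) *\<^sub>R X\<^sub>2 x" for x
    by (simp add: Y_def plus_blinfun.rep_eq scaleR_blinfun.rep_eq)
  have Yin: "inner (Y x) y = t * inner (X\<^sub>1 x) y + (1 - t) * inner (X\<^sub>2 x) y" for x y
    by (simp add: Yap inner_add_left)
  have sp: "sym_pos_op C\<^sub>0" "sym_pos_op X\<^sub>1" "sym_pos_op X\<^sub>2" and tr: "trace_class_pos C\<^sub>0" "trace_class_pos X\<^sub>1" "trace_class_pos X\<^sub>2"
    using C\<^sub>0 X by (auto simp: SymTr_def)
  have spY: "sym_pos_op Y"
    unfolding sym_pos_op_def
  proof (intro conjI allI)
    fix x y
    show "inner (Y x) y = inner x (Y y)"
      using sp(2,3) unfolding sym_pos_op_def Yap by (simp add: inner_add_left inner_add_right)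
    show "0 \<le> inner (Y x) x"
      unfolding Yin using sp(2,3) t unfolding sym_pos_op_def by (intro add_nonneg_nonneg mult_nonneg_nonneg) auto
  qed
  interpret src: gaussian_measure m\<^sub>0 C\<^sub>0 \<mu> using \<mu> sp by unfold_locales
  interpret g\<^sub>1: gaussian_measure m\<^sub>1 X\<^sub>1 \<nu>\<^sub>1 using \<nu>\<^sub>1 sp by unfold_locales
  interpret g\<^sub>2: gaussian_measure m\<^sub>2 X\<^sub>2 \<nu>\<^sub>2 using \<nu>\<^sub>2 sp by unfold_locales
  interpret g: gaussian_measure m Y \<nu> using \<nu> spY by unfold_locales (simp add: m_def Y_def)
  define T\<^sub>0 where "T\<^sub>0 = (\<integral>x. (norm (x - m\<^sub>0))\<^sup>2 \<partial>\<mu>)"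
  define T\<^sub>1 where "T\<^sub>1 = (\<integral>x. (norm (x - m\<^sub>1))\<^sup>2 \<partial>\<nu>\<^sub>1)"
  define T\<^sub>2 where "T\<^sub>2 = (\<integral>x. (norm (x - m\<^sub>2))\<^sup>2 \<partial>\<nu>\<^sub>2)"
  define T where "T = (\<integral>x. (norm (x - m))\<^sup>2 \<partial>\<nu>)"
  note i0 = src.integrable_norm_square[OF tr(1)]
    and i1 = g\<^sub>1.integrable_norm_square[OF tr(2)] and i2 = g\<^sub>2.integrable_norm_square[OF tr(3)]
  from tr(1) obtain B :: "'a set" where B: "orthonormal_basis B" by (auto simp: trace_class_pos_def)
  from countable_exhausts[OF orthonormal_basis_countable[OF B]] obtain F where F: "exhausts F B" .
  have sumY: "(\<Sum>e\<in>F k. inner (Y e) e) = t * (\<Sum>e\<in>F k. inner (X\<^sub>1 e) e) + (1 - t) * (\<Sum>e\<in>F k. inner (X\<^sub>2 e) e)" for k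
    by (simp add: Yin sum.distrib sum_distrib_left)
  have i: "integrable \<nu> (\<lambda>x. (norm (x - m))\<^sup>2)"
  proof (rule g.integrable_norm_square_bounded_trace[OF B F])
    show "(\<Sum>e\<in>F k. inner (Y e) e) \<le> t * T\<^sub>1 + (1 - t) * T\<^sub>2" for k
      unfolding sumY using t g\<^sub>1.trace_partial_sum[OF B F i1] g\<^sub>2.trace_partial_sum[OF B F i2]
      by (intro add_mono mult_left_mono) (auto simp: T\<^sub>1_def T\<^sub>2_def)
  qed
  \<comment> \<open>The three second moments are limits of partial traces along the same basis, and
    partial traces are affine.\<close>
  have Taff: "T = t * T\<^sub>1 + (1 - t) * T\<^sub>2"
  proof (rule LIMSEQ_unique)
    show "(\<lambda>k. \<Sum>e\<in>F k. inner (Y e) e) \<longlonglongrightarrow> T" unfolding T_def by (rule g.trace_tendsto[OF B F i])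
    show "(\<lambda>k. \<Sum>e\<in>F k. inner (Y e) e) \<longlonglongrightarrow> t * T\<^sub>1 + (1 - t) * T\<^sub>2"
      unfolding sumY T\<^sub>1_def T\<^sub>2_def
      by (intro tendsto_intros g\<^sub>1.trace_tendsto[OF B F i1] g\<^sub>2.trace_tendsto[OF B F i2])
  qed
  have Tn: "0 \<le> T" "0 \<le> T\<^sub>1" "0 \<le> T\<^sub>2" unfolding T_def T\<^sub>1_def T\<^sub>2_def by simp_all
  \<comment> \<open>The error \<open>R / l + l * T\<close> enters once from above and once from
    below. This \<open>l\<close> keeps \<open>2 * (l * T)\<close> within
    \<open>\<delta> / 2\<close>; then \<open>N\<close> is chosen, depending on \<open>l\<close>,
    with trace tail below \<open>\<delta> * l / 4\<close>, which keeps \<open>2 * (R / l)\<close>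
    within \<open>\<delta> / 2\<close>.\<close>
  define l where "l = \<delta> / (4 * (1 + T))"
  have l: "l > 0" using \<delta> Tn by (simp add: l_def)
  have lT: "2 * (l * T) \<le> \<delta> / 2"
    using \<delta> Tn by (simp add: l_def field_simps)
  have "\<exists>N. \<bar>(\<Sum>e\<in>F N. inner (C\<^sub>0 e) e) - T\<^sub>0\<bar> < \<delta> * l / 4"
    using LIMSEQ_D[OF src.trace_tendsto[OF B F i0, folded T\<^sub>0_def], of "\<delta> * l / 4"] \<delta> l
    by (metis order_refl real_norm_def divide_pos_pos mult_pos_pos zero_less_numeral)
  then obtain N where "\<bar>(\<Sum>e\<in>F N. inner (C\<^sub>0 e) e) - T\<^sub>0\<bar> < \<delta> * l / 4" ..
  then have N: "T\<^sub>0 - (\<Sum>e\<in>F N. inner (C\<^sub>0 e) e) < \<delta> * l / 4" by linarith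
  interpret C: psd_form "\<lambda>x y. inner (C\<^sub>0 x) y" by (rule src.psd_form_covariance)
  interpret b: sym_form "\<lambda>x y. inner (Y (C\<^sub>0 x)) (C\<^sub>0 y)"
    by unfold_locales (auto simp: g.symmetric blinfun.add_right blinfun.scaleR_right inner_add_left)
  \<comment> \<open>\<open>F N\<close> controls the residual; \<open>d\<close> is included so that
    \<open>C\<^sub>0 d\<close> is an exact combination of the
    \<open>C\<^sub>0 (u i)\<close>.\<close>
  have "finite (insert d (F N))" using F by (simp add: exhausts_def)
  from C.simultaneous_diagonalization[OF b.sym_form_axioms this] obtain n :: nat and u
    where nu: "(\<forall>i<n. \<forall>j<n. inner (C\<^sub>0 (u i)) (u j) = (if i = j then 1 else 0))
      \<and> (\<forall>i<n. \<forall>j<n. i \<noteq> j \<longrightarrow> inner (Y (C\<^sub>0 (u i))) (C\<^sub>0 (u j)) = 0)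
      \<and> (\<forall>e\<in>insert d (F N). inner (C\<^sub>0 e) e = (\<Sum>i<n. (inner (C\<^sub>0 e) (u i))\<^sup>2))"
    by (elim exE) (rule that)
  note on = nu[THEN conjunct1, rule_format]
    and dg = nu[THEN conjunct2, THEN conjunct1, rule_format]
    and complete = nu[THEN conjunct2, THEN conjunct2, rule_format]
  define w where "w i = inner (Y (C\<^sub>0 (u i))) (C\<^sub>0 (u i))" for i
  have w0: "w i \<ge> 0" for i by (simp add: w_def)
  have "\<exists>s. s > 0 \<and> \<beta>\<^sup>2 * w i * s\<^sup>2 + s = 1 \<and> 1 / s \<le> 1 + \<beta>\<^sup>2 * w i" for i
    using quadratic_root_bounds[of "\<beta>\<^sup>2 * w i"] w0 by (metis mult_nonneg_nonneg zero_le_power2)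
  then obtain s where s: "\<And>i. s i > 0" "\<And>i. \<beta>\<^sup>2 * w i * (s i)\<^sup>2 + s i = 1" "\<And>i. 1 / s i \<le> 1 + \<beta>\<^sup>2 * w i"
    by metis
  \<comment> \<open>One family adapted to \<open>Y\<close>: up to the residual its potential is
    optimal there, and it is merely admissible for \<open>X\<^sub>1\<close> and
    \<open>X\<^sub>2\<close>.\<close>
  interpret P: ot_potential m\<^sub>0 m C\<^sub>0 Y \<mu> \<nu> \<epsilon> n u s
    using \<epsilon> on s(1) i0 i by unfold_locales auto
  interpret P\<^sub>1: ot_potential m\<^sub>0 m\<^sub>1 C\<^sub>0 X\<^sub>1 \<mu> \<nu>\<^sub>1 \<epsilon> n u s
    using \<epsilon> on s(1) i0 i1 by unfold_locales auto
  interpret P\<^sub>2: ot_potential m\<^sub>0 m\<^sub>2 C\<^sub>0 X\<^sub>2 \<mu> \<nu>\<^sub>2 \<epsilon> n u s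
    using \<epsilon> on s(1) i0 i2 by unfold_locales auto
  define R where "R = (\<integral>x. (norm (P.resid x))\<^sup>2 \<partial>\<mu>)"
  have ri: "integrable \<mu> (\<lambda>x. (norm (P.resid x))\<^sup>2)"
    and "R \<le> T\<^sub>0 - (\<Sum>e\<in>F N. inner (C\<^sub>0 e) e)"
    unfolding R_def T\<^sub>0_def using P.resid_moment[OF B F, of N] complete by auto
  then have "R / l \<le> \<delta> / 4" using N l by (simp add: field_simps)
  then have Rl: "2 * (R / l) \<le> \<delta> / 2" by linarith
  have tgt1: "(\<integral>\<^sup>+y. ennreal (exp (P.G x y)) \<partial>\<nu>) = 1" for x
    by (rule P.nn_integral_exp_G_target[OF dg]) (use s(2) in \<open>simp_all add: P.w_def w_def \<beta>_def\<close>)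
  from P.OT_eps_upper_bound[OF tgt1 ri l, folded R_def T_def]
  obtain V where V: "0 \<le> V" "OT_eps \<epsilon> \<mu> \<nu> \<le> ennreal V" "V \<le> P.base + (R / l + l * T)" by blast
  \<comment> \<open>Dividing by \<open>s i\<close> makes the direction \<open>v\<close> of the lower
    bound equal to \<open>C\<^sub>0 d\<close>, whatever the family is.\<close>
  define p where "p i = inner (C\<^sub>0 d) (u i) / s i" for i
  define a where "a = (\<Sum>i<n. (p i)\<^sup>2)"
  have ps: "p i * s i = inner (C\<^sub>0 d) (u i)" for i using s(1)[of i] by (simp add: p_def)
  let ?d' = "d - (\<Sum>i<n. inner (C\<^sub>0 d) (u i) *\<^sub>R u i)"
  have C\<^sub>0d: "C\<^sub>0 d = (\<Sum>i<n. (p i * s i) *\<^sub>R C\<^sub>0 (u i))"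
  proof -
    have pu: "inner (C\<^sub>0 ?d') (u j) = 0" if "j < n" for j
    proof -
      have "(\<Sum>i<n. inner (C\<^sub>0 d) (u i) * inner (C\<^sub>0 (u i)) (u j)) = (\<Sum>i<n. if i = j then inner (C\<^sub>0 d) (u j) else 0)"
        by (intro sum.cong) (use that in \<open>auto simp: on\<close>)
      then show ?thesis using that unfolding C.diff_left C.sum_left C.scale_left by simp
    qed
    have "inner (C\<^sub>0 ?d') ?d' = inner (C\<^sub>0 ?d') d"
      by (simp only: C.diff_right[of "?d'"] C.sum_right[of "?d'"] C.scale_right[of "?d'"]) (simp add: pu)
    also have "\<dots> = inner (C\<^sub>0 d) d - (\<Sum>i<n. (inner (C\<^sub>0 d) (u i))\<^sup>2)"
      unfolding C.diff_left C.sum_left C.scale_left by (simp add: power2_eq_square src.symmetric[of d "u _"])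
    also have "\<dots> = 0" using complete[of d] by simp
    \<comment> \<open>A null vector of the form lies in the kernel: it is tested against its own
      image.\<close>
    finally have "inner (C\<^sub>0 ?d') (C\<^sub>0 ?d') = 0" by (rule C.null_left)
    then have "C\<^sub>0 ?d' = 0" by simp
    then show ?thesis by (simp add: blinfun.diff_right blinfun.sum_right blinfun.scaleR_right ps)
  qed
  have low1: "ennreal (P\<^sub>1.base - (R / l + l * T\<^sub>1)
      + \<epsilon> * (\<kappa> * exp (- a / 2) - \<kappa> * exp (- ((\<Sum>i<n. (p i)\<^sup>2 * s i) + \<beta>\<^sup>2 * inner (X\<^sub>1 (C\<^sub>0 d)) (C\<^sub>0 d)) / 2) - \<kappa>\<^sup>2)) \<le> OT_eps \<epsilon> \<mu> \<nu>\<^sub>1"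
    using P\<^sub>1.OT_eps_lower_bound[OF ri l \<kappa> C\<^sub>0d] by (simp only: R_def T\<^sub>1_def a_def \<beta>_def)
  have low2: "ennreal (P\<^sub>2.base - (R / l + l * T\<^sub>2)) \<le> OT_eps \<epsilon> \<mu> \<nu>\<^sub>2"
    using P\<^sub>2.OT_eps_lower_bound[OF ri l, of 0 _ p] by (simp add: R_def T\<^sub>2_def)
  \<comment> \<open>With \<open>s\<close> common to all three, everything is affine except the
    squared distance of the means, which is convex.\<close>
  have base: "P.base \<le> t * P\<^sub>1.base + (1 - t) * P\<^sub>2.base"
  proof -
    have "m\<^sub>0 - m = t *\<^sub>R (m\<^sub>0 - m\<^sub>1) + (1 - t) *\<^sub>R (m\<^sub>0 - m\<^sub>2)" by (simp add: m_def algebra_simps)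
    then have mm: "(norm (m\<^sub>0 - m))\<^sup>2 \<le> t * (norm (m\<^sub>0 - m\<^sub>1))\<^sup>2 + (1 - t) * (norm (m\<^sub>0 - m\<^sub>2))\<^sup>2"
      using convex_norm_square[OF t] by metis
    have sums: "(\<Sum>i<n. \<epsilon> / 2 * (1 - ln (s i) - 1 / s i - (2 / \<epsilon>)\<^sup>2 * s i * P.w i))
      = t * (\<Sum>i<n. \<epsilon> / 2 * (1 - ln (s i) - 1 / s i - (2 / \<epsilon>)\<^sup>2 * s i * P\<^sub>1.w i))
      + (1 - t) * (\<Sum>i<n. \<epsilon> / 2 * (1 - ln (s i) - 1 / s i - (2 / \<epsilon>)\<^sup>2 * s i * P\<^sub>2.w i))"
    proof -
      have "c * (1 - A - D - E * (t * x + (1 - t) * y))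
        = t * (c * (1 - A - D - E * x)) + (1 - t) * (c * (1 - A - D - E * y))" for c A D E x y
        by (simp add: algebra_simps)
      then show ?thesis
        unfolding sum_distrib_left sum.distrib[symmetric] P.w_def P\<^sub>1.w_def P\<^sub>2.w_def Yin by (intro sum.cong refl)
    qed
    show ?thesis
      using mm Taff sums unfolding P.base_def P\<^sub>1.base_def P\<^sub>2.base_def T_def T\<^sub>1_def T\<^sub>2_def
      by (simp add: algebra_simps)
  qed
  \<comment> \<open>By the fixed-point equation, the functional has variance \<open>a\<close> under
    the first marginal of \<open>exp G\<close> when the target covariance is \<open>Y\<close>. At
    \<open>X\<^sub>1\<close> it therefore differs from \<open>a\<close> by
    \<open>\<beta>\<^sup>2\<close> times the form of \<open>X\<^sub>1 - Y\<close> at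
    \<open>C\<^sub>0 d\<close>.\<close>
  have var: "(\<Sum>i<n. (p i)\<^sup>2 * s i) = a - \<beta>\<^sup>2 * inner (Y (C\<^sub>0 d)) (C\<^sub>0 d)"
  proof -
    have "inner (Y (C\<^sub>0 d)) (C\<^sub>0 d) = (\<Sum>i<n. \<Sum>j<n. (p i * s i) * ((p j * s j) * inner (Y (C\<^sub>0 (u i))) (C\<^sub>0 (u j))))"
      unfolding C\<^sub>0d blinfun.sum_right blinfun.scaleR_right inner_sum_left inner_scaleR_left
      unfolding inner_sum_right inner_scaleR_right sum_distrib_left by (rule refl)
    also have "\<dots> = (\<Sum>i<n. \<Sum>j<n. if j = i then (p i)\<^sup>2 * (s i)\<^sup>2 * w i else 0)"
      by (intro sum.cong refl) (auto simp: dg w_def power2_eq_square)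
    also have "\<dots> = (\<Sum>i<n. (p i)\<^sup>2 * (s i)\<^sup>2 * w i)" by simp
    finally have q: "inner (Y (C\<^sub>0 d)) (C\<^sub>0 d) = (\<Sum>i<n. (p i)\<^sup>2 * (s i)\<^sup>2 * w i)" .
    have "(p i)\<^sup>2 * s i = (p i)\<^sup>2 - \<beta>\<^sup>2 * ((p i)\<^sup>2 * (s i)\<^sup>2 * w i)" for i
    proof -
      have "s i = 1 - \<beta>\<^sup>2 * w i * (s i)\<^sup>2" using s(2)[of i] by simp
      then have "(p i)\<^sup>2 * s i = (p i)\<^sup>2 * (1 - \<beta>\<^sup>2 * w i * (s i)\<^sup>2)" by (rule arg_cong)
      then show ?thesis by (simp add: algebra_simps)
    qed
    then show ?thesis unfolding q a_def sum_distrib_left sum_subtractf[symmetric] by (intro sum.cong refl)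
  qed
  \<comment> \<open>Cauchy-Schwarz for the form of \<open>C\<^sub>0\<close>, with \<open>u i\<close>
    normalised, bounds the squared norm of \<open>C\<^sub>0 (u i)\<close> by
    \<open>norm C\<^sub>0\<close>. This bounds \<open>w i\<close> and \<open>1 / s i\<close>
    uniformly, and the Parseval identity for \<open>d\<close> sums the coordinates.\<close>
  have amax: "a \<le> (1 + \<beta>\<^sup>2 * (norm Y * norm C\<^sub>0))\<^sup>2 * inner (C\<^sub>0 d) d"
  proof -
    have wb: "w i \<le> norm Y * norm C\<^sub>0" if "i < n" for i
    proof -
      let ?c = "C\<^sub>0 (u i)"
      have "(inner ?c ?c)\<^sup>2 \<le> inner (C\<^sub>0 (u i)) (u i) * inner (C\<^sub>0 ?c) ?c" by (rule C.cauchy_schwarz)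
      also have "\<dots> \<le> norm C\<^sub>0 * inner ?c ?c"
      proof -
        have "inner (C\<^sub>0 ?c) ?c \<le> norm (C\<^sub>0 ?c) * norm ?c" by (rule norm_cauchy_schwarz)
        also have "\<dots> \<le> (norm C\<^sub>0 * norm ?c) * norm ?c" by (intro mult_right_mono norm_blinfun) simp
        finally show ?thesis using on[OF that that] by (simp add: power2_norm_eq_inner[symmetric] power2_eq_square)
      qed
      finally have "inner ?c ?c * inner ?c ?c \<le> norm C\<^sub>0 * inner ?c ?c" by (simp add: power2_eq_square)
      then have cc: "inner ?c ?c \<le> norm C\<^sub>0"
        by (cases "inner ?c ?c = 0") (simp_all add: mult_le_cancel_right)
      have "w i \<le> norm (Y ?c) * norm ?c" unfolding w_def by (rule norm_cauchy_schwarz)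
      also have "\<dots> \<le> (norm Y * norm ?c) * norm ?c" by (intro mult_right_mono norm_blinfun) simp
      also have "\<dots> = norm Y * inner ?c ?c" by (simp add: power2_norm_eq_inner[symmetric] power2_eq_square)
      also have "\<dots> \<le> norm Y * norm C\<^sub>0" by (intro mult_left_mono cc) simp
      finally show ?thesis .
    qed
    have "a \<le> (\<Sum>i<n. (1 + \<beta>\<^sup>2 * (norm Y * norm C\<^sub>0))\<^sup>2 * (inner (C\<^sub>0 d) (u i))\<^sup>2)"
      unfolding a_def
    proof (intro sum_mono)
      fix i assume "i \<in> {..<n}"
      then have "\<beta>\<^sup>2 * w i \<le> \<beta>\<^sup>2 * (norm Y * norm C\<^sub>0)" by (intro mult_left_mono wb) auto
      then have "1 / s i \<le> 1 + \<beta>\<^sup>2 * (norm Y * norm C\<^sub>0)" using s(3)[of i] by linarith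
      then have "(1 / s i)\<^sup>2 \<le> (1 + \<beta>\<^sup>2 * (norm Y * norm C\<^sub>0))\<^sup>2" using s(1)[of i] by (intro power_mono) auto
      then have "(1 / s i)\<^sup>2 * (inner (C\<^sub>0 d) (u i))\<^sup>2 \<le> (1 + \<beta>\<^sup>2 * (norm Y * norm C\<^sub>0))\<^sup>2 * (inner (C\<^sub>0 d) (u i))\<^sup>2"
        by (intro mult_right_mono) auto
      then show "(p i)\<^sup>2 \<le> (1 + \<beta>\<^sup>2 * (norm Y * norm C\<^sub>0))\<^sup>2 * (inner (C\<^sub>0 d) (u i))\<^sup>2"
        by (simp add: p_def power_divide)
    qed
    also have "\<dots> = (1 + \<beta>\<^sup>2 * (norm Y * norm C\<^sub>0))\<^sup>2 * inner (C\<^sub>0 d) d"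
      using complete[of d] by (simp add: sum_distrib_left)
    finally show ?thesis .
  qed
  let ?gap = "\<kappa> * exp (- a / 2) * (1 - exp (- \<beta>\<^sup>2 * inner ((X\<^sub>1 - Y) (C\<^sub>0 d)) (C\<^sub>0 d) / 2)) - \<kappa>\<^sup>2"
  have gap: "\<kappa> * exp (- a / 2) - \<kappa> * exp (- ((\<Sum>i<n. (p i)\<^sup>2 * s i) + \<beta>\<^sup>2 * inner (X\<^sub>1 (C\<^sub>0 d)) (C\<^sub>0 d)) / 2) - \<kappa>\<^sup>2 = ?gap"
  proof -
    have "- ((\<Sum>i<n. (p i)\<^sup>2 * s i) + \<beta>\<^sup>2 * inner (X\<^sub>1 (C\<^sub>0 d)) (C\<^sub>0 d)) / 2
      = - a / 2 + - \<beta>\<^sup>2 * inner ((X\<^sub>1 - Y) (C\<^sub>0 d)) (C\<^sub>0 d) / 2"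
      unfolding var by (simp add: minus_blinfun.rep_eq inner_diff_left algebra_simps diff_divide_distrib add_divide_distrib)
    then show ?thesis by (simp only: exp_add) (simp add: algebra_simps)
  qed
  let ?U1 = "P\<^sub>1.base - (R / l + l * T\<^sub>1) + \<epsilon> * ?gap"
  let ?U2 = "P\<^sub>2.base - (R / l + l * T\<^sub>2)"
  show thesis
  proof (rule that[of V ?U1 ?U2 a])
    have "t * ?U1 + (1 - t) * ?U2 = (t * P\<^sub>1.base + (1 - t) * P\<^sub>2.base) - (R / l + l * T) + t * \<epsilon> * ?gap"
    proof -
      have "t * (b\<^sub>1 - (q + l * T\<^sub>1) + \<epsilon> * c) + (1 - t) * (b\<^sub>2 - (q + l * T\<^sub>2))
        = (t * b\<^sub>1 + (1 - t) * b\<^sub>2) - (q + l * (t * T\<^sub>1 + (1 - t) * T\<^sub>2)) + t * \<epsilon> * c" for b\<^sub>1 b\<^sub>2 q c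
        by (simp add: algebra_simps)
      then show ?thesis unfolding Taff .
    qed
    then have "V + t * \<epsilon> * ?gap \<le> t * ?U1 + (1 - t) * ?U2 + \<delta>"
      using V(3) base lT Rl by linarith
    then show "V + t * \<epsilon> * (\<kappa> * exp (- a / 2) * (1 - exp (- (2 / \<epsilon>)\<^sup>2 * inner ((X\<^sub>1 - Y) (C\<^sub>0 d)) (C\<^sub>0 d) / 2)) - \<kappa>\<^sup>2)
      \<le> t * ?U1 + (1 - t) * ?U2 + \<delta>" by (simp only: \<beta>_def)
  qed (use V low1[unfolded gap] low2 amax in \<open>simp_all only: \<beta>_def\<close>)
qed

section \<open>Removal of the error term, and strictness\<close>

lemma ennreal_convex_combination_le:
  assumes "0 \<le> t" "t \<le> 1" "ennreal x \<le> A" "ennreal y \<le> B"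
  shows "ennreal (t * x + (1 - t) * y) \<le> ennreal t * A + ennreal (1 - t) * B"
proof -
  have "ennreal (t * x + (1 - t) * y) \<le> ennreal (t * x) + ennreal ((1 - t) * y)" by (rule ennreal_add_le)
  also have "\<dots> = ennreal t * ennreal x + ennreal (1 - t) * ennreal y" using assms by (simp add: ennreal_mult')
  also have "\<dots> \<le> ennreal t * A + ennreal (1 - t) * B" using assms by (intro add_mono mult_left_mono) auto
  finally show ?thesis .
qed

lemma OT_eps_gaussian_convex:
  fixes \<epsilon> :: real
    and C\<^sub>0 X\<^sub>1 X\<^sub>2 :: "'a::{real_inner,second_countable_topology} \<Rightarrow>\<^sub>L 'a"
  assumes "\<epsilon> > 0" "C\<^sub>0 \<in> SymTr" "is_gaussian m\<^sub>0 C\<^sub>0 \<mu>"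
    and t: "0 \<le> t" "t \<le> 1" and "X\<^sub>1 \<in> SymTr" "X\<^sub>2 \<in> SymTr"
    and "is_gaussian m\<^sub>1 X\<^sub>1 \<nu>\<^sub>1" "is_gaussian m\<^sub>2 X\<^sub>2 \<nu>\<^sub>2"
    and "is_gaussian (t *\<^sub>R m\<^sub>1 + (1 - t) *\<^sub>R m\<^sub>2) (t *\<^sub>R X\<^sub>1 + (1 - t) *\<^sub>R X\<^sub>2) \<nu>"
  shows "OT_eps \<epsilon> \<mu> \<nu> \<le> ennreal t * OT_eps \<epsilon> \<mu> \<nu>\<^sub>1 + ennreal (1 - t) * OT_eps \<epsilon> \<mu> \<nu>\<^sub>2"
proof (rule ennreal_le_epsilon)
  fix \<delta> :: real assume \<delta>: "\<delta> > 0"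
  obtain V U\<^sub>1 U\<^sub>2 where V: "OT_eps \<epsilon> \<mu> \<nu> \<le> ennreal V" "V \<le> t * U\<^sub>1 + (1 - t) * U\<^sub>2 + \<delta>"
    and U: "ennreal U\<^sub>1 \<le> OT_eps \<epsilon> \<mu> \<nu>\<^sub>1" "ennreal U\<^sub>2 \<le> OT_eps \<epsilon> \<mu> \<nu>\<^sub>2"
    by (rule OT_eps_gaussian_convexity_defect[OF assms \<delta>, where \<kappa>=0 and d=0]) (auto intro!: that)
  note V(1)
  also have "ennreal V \<le> ennreal (t * U\<^sub>1 + (1 - t) * U\<^sub>2 + \<delta>)" by (intro ennreal_leI V(2))
  also have "\<dots> \<le> ennreal (t * U\<^sub>1 + (1 - t) * U\<^sub>2) + ennreal \<delta>" by (rule ennreal_add_le)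
  also have "\<dots> \<le> ennreal t * OT_eps \<epsilon> \<mu> \<nu>\<^sub>1 + ennreal (1 - t) * OT_eps \<epsilon> \<mu> \<nu>\<^sub>2 + ennreal \<delta>"
    by (intro add_right_mono ennreal_convex_combination_le t U)
  finally show "OT_eps \<epsilon> \<mu> \<nu> \<le> ennreal t * OT_eps \<epsilon> \<mu> \<nu>\<^sub>1 + ennreal (1 - t) * OT_eps \<epsilon> \<mu> \<nu>\<^sub>2 + ennreal \<delta>" .
qed

text \<open>If the form vanished on the range of \<open>C\<^sub>0\<close>, polarisation would make
  the composite \<open>C\<^sub>0 (X\<^sub>1 - X\<^sub>2) C\<^sub>0\<close> zero. Injectivity removes
  the left factor and, after transposing, the other one.\<close>

lemma sym_pos_op_detect_difference:
  fixes C\<^sub>0 X\<^sub>1 X\<^sub>2 :: "'a::real_inner \<Rightarrow>\<^sub>L 'a"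
  assumes "sym_pos_op C\<^sub>0" "sym_pos_op X\<^sub>1" "sym_pos_op X\<^sub>2"
    and inj: "\<And>x. C\<^sub>0 x = 0 \<Longrightarrow> x = 0" and "X\<^sub>1 \<noteq> X\<^sub>2"
  shows "\<exists>d. inner ((X\<^sub>1 - X\<^sub>2) (C\<^sub>0 d)) (C\<^sub>0 d) \<noteq> 0"
proof (rule ccontr)
  let ?D = "X\<^sub>1 - X\<^sub>2"
  assume "\<not> ?thesis"
  then have z: "inner (?D (C\<^sub>0 d)) (C\<^sub>0 d) = 0" for d by blast
  have C: "inner (C\<^sub>0 x) y = inner x (C\<^sub>0 y)" for x y using assms(1) unfolding sym_pos_op_def by blast
  have D: "inner (?D x) y = inner x (?D y)" for x y
    using assms(2,3) unfolding sym_pos_op_def minus_blinfun.rep_eq inner_diff_left inner_diff_right by simp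
  have polar: "inner (?D (C\<^sub>0 x)) (C\<^sub>0 y) = 0" for x y
  proof -
    have "inner (?D (C\<^sub>0 (x + y))) (C\<^sub>0 (x + y)) = inner (?D (C\<^sub>0 x)) (C\<^sub>0 x) + inner (?D (C\<^sub>0 y)) (C\<^sub>0 y)
        + inner (?D (C\<^sub>0 x)) (C\<^sub>0 y) + inner (?D (C\<^sub>0 y)) (C\<^sub>0 x)"
      by (simp only: blinfun.add_right inner_add_left inner_add_right)
    moreover have "inner (?D (C\<^sub>0 y)) (C\<^sub>0 x) = inner (?D (C\<^sub>0 x)) (C\<^sub>0 y)"
      unfolding D[of "C\<^sub>0 y"] by (rule inner_commute)
    ultimately show ?thesis using z by simp
  qed
  have zero: "?D (C\<^sub>0 x) = 0" for x
    by (rule inj) (metis polar C inner_eq_zero_iff)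
  have "?D x = 0" for x
  proof (rule inj)
    have "inner (C\<^sub>0 (?D x)) y = 0" for y using zero[of y] unfolding C D[of x] by simp
    then show "C\<^sub>0 (?D x) = 0" by (metis inner_eq_zero_iff)
  qed
  then have "X\<^sub>1 = X\<^sub>2" by (intro blinfun_eqI) (simp add: minus_blinfun.rep_eq)
  with \<open>X\<^sub>1 \<noteq> X\<^sub>2\<close> show False ..
qed

text \<open>The gain is linear in \<open>\<kappa>\<close> and the loss quadratic, so a small
  \<open>\<kappa>\<close> with the sign of \<open>r\<close> leaves a positive balance. It is bounded
  through \<open>A\<close> in place of \<open>a\<close>, hence before \<open>\<delta>\<close> is
  fixed.\<close>

lemma OT_eps_gaussian_strictly_convex:
  fixes \<epsilon> :: real
    and C\<^sub>0 X\<^sub>1 X\<^sub>2 :: "'a::{real_inner,second_countable_topology} \<Rightarrow>\<^sub>L 'a"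
  assumes \<epsilon>: "\<epsilon> > 0" and C\<^sub>0: "C\<^sub>0 \<in> SymTr" and \<mu>: "is_gaussian m\<^sub>0 C\<^sub>0 \<mu>"
    and t: "0 < t" "t < 1" and X: "X\<^sub>1 \<in> SymTr" "X\<^sub>2 \<in> SymTr"
    and \<nu>: "is_gaussian m\<^sub>1 X\<^sub>1 \<nu>\<^sub>1" "is_gaussian m\<^sub>2 X\<^sub>2 \<nu>\<^sub>2"
      "is_gaussian (t *\<^sub>R m\<^sub>1 + (1 - t) *\<^sub>R m\<^sub>2) (t *\<^sub>R X\<^sub>1 + (1 - t) *\<^sub>R X\<^sub>2) \<nu>"
    and inj: "\<And>x. C\<^sub>0 x = 0 \<Longrightarrow> x = 0" and ne: "X\<^sub>1 \<noteq> X\<^sub>2"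
  shows "OT_eps \<epsilon> \<mu> \<nu> < ennreal t * OT_eps \<epsilon> \<mu> \<nu>\<^sub>1 + ennreal (1 - t) * OT_eps \<epsilon> \<mu> \<nu>\<^sub>2"
proof -
  have t': "0 \<le> t" "t \<le> 1" using t by auto
  define Y where "Y = t *\<^sub>R X\<^sub>1 + (1 - t) *\<^sub>R X\<^sub>2"
  from sym_pos_op_detect_difference[OF _ _ _ inj ne] C\<^sub>0 X
  obtain d where d: "inner ((X\<^sub>1 - X\<^sub>2) (C\<^sub>0 d)) (C\<^sub>0 d) \<noteq> 0" by (auto simp: SymTr_def)
  have "X\<^sub>1 - Y = (1 - t) *\<^sub>R (X\<^sub>1 - X\<^sub>2)" by (simp add: Y_def algebra_simps)
  then have dY: "inner ((X\<^sub>1 - Y) (C\<^sub>0 d)) (C\<^sub>0 d) \<noteq> 0"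
    using d t by (simp add: scaleR_blinfun.rep_eq)
  define A where "A = (1 + (2 / \<epsilon>)\<^sup>2 * (norm Y * norm C\<^sub>0))\<^sup>2 * inner (C\<^sub>0 d) d"
  define r where "r = 1 - exp (- (2 / \<epsilon>)\<^sup>2 * inner ((X\<^sub>1 - Y) (C\<^sub>0 d)) (C\<^sub>0 d) / 2)"
  have r: "r \<noteq> 0" using dY \<epsilon> by (simp add: r_def)
  define D where "D = exp (- A / 2) * \<bar>r\<bar>"
  have D: "D > 0" using r by (simp add: D_def)
  \<comment> \<open>\<open>k \<le> D / 2\<close> keeps the loss below half of the gain
    \<open>k * D\<close>, and \<open>k \<le> 1\<close> meets the restriction on
    \<open>\<kappa>\<close> from the quadratic bound of \<open>exp\<close>.\<close>
  define k where "k = min 1 (D / 2)"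
  have k: "0 < k" "k \<le> 1" "k \<le> D / 2" using D by (auto simp: k_def)
  define \<kappa> where "\<kappa> = sgn r * k"
  have \<kappa>: "\<bar>\<kappa>\<bar> \<le> 1" using k r by (simp add: \<kappa>_def abs_mult)
  \<comment> \<open>Half of the guaranteed balance, so that it outweighs the truncation
    error.\<close>
  define \<delta> where "\<delta> = t * \<epsilon> * (k * (D / 2)) / 2"
  have \<delta>: "\<delta> > 0" using t \<epsilon> k D by (simp add: \<delta>_def)
  from OT_eps_gaussian_convexity_defect[OF \<epsilon> C\<^sub>0 \<mu> t' X \<nu> \<delta> \<kappa>, where d=d, folded Y_def, folded A_def r_def]
  obtain V U\<^sub>1 U\<^sub>2 a where V: "0 \<le> V" "OT_eps \<epsilon> \<mu> \<nu> \<le> ennreal V"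
    and U: "ennreal U\<^sub>1 \<le> OT_eps \<epsilon> \<mu> \<nu>\<^sub>1" "ennreal U\<^sub>2 \<le> OT_eps \<epsilon> \<mu> \<nu>\<^sub>2"
    and a: "a \<le> A" and gap: "V + t * \<epsilon> * (\<kappa> * exp (- a / 2) * r - \<kappa>\<^sup>2) \<le> t * U\<^sub>1 + (1 - t) * U\<^sub>2 + \<delta>" .
  have "k * (D / 2) \<le> \<kappa> * exp (- a / 2) * r - \<kappa>\<^sup>2"
  proof -
    have "D \<le> exp (- a / 2) * \<bar>r\<bar>" using a by (simp add: D_def mult_right_mono)
    then have "k * D \<le> k * (exp (- a / 2) * \<bar>r\<bar>)" using k by (intro mult_left_mono) auto
    also have "\<dots> = \<kappa> * exp (- a / 2) * r" by (simp add: \<kappa>_def abs_sgn mult.commute mult.left_commute)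
    finally have "k * D \<le> \<kappa> * exp (- a / 2) * r" .
    moreover have "\<kappa>\<^sup>2 \<le> k * (D / 2)"
      using k r by (simp add: \<kappa>_def power_mult_distrib power2_eq_square sgn_mult_self_eq mult_left_mono)
    ultimately show ?thesis by simp
  qed
  then have "t * \<epsilon> * (k * (D / 2)) \<le> t * \<epsilon> * (\<kappa> * exp (- a / 2) * r - \<kappa>\<^sup>2)"
    using t \<epsilon> by (intro mult_left_mono) auto
  then have "V < t * U\<^sub>1 + (1 - t) * U\<^sub>2" using gap \<delta> unfolding \<delta>_def by linarith
  then have "ennreal V < ennreal (t * U\<^sub>1 + (1 - t) * U\<^sub>2)" using V(1) by (simp add: ennreal_less_iff)
  with V(2) have "OT_eps \<epsilon> \<mu> \<nu> < ennreal (t * U\<^sub>1 + (1 - t) * U\<^sub>2)" by (rule order_le_less_trans)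
  also have "\<dots> \<le> ennreal t * OT_eps \<epsilon> \<mu> \<nu>\<^sub>1 + ennreal (1 - t) * OT_eps \<epsilon> \<mu> \<nu>\<^sub>2"
    by (intro ennreal_convex_combination_le t' U)
  finally show ?thesis .
qed

theorem mainTheorem6:
  fixes \<epsilon> :: real
    and m0 :: "'a::{real_inner,complete_space,second_countable_topology}"
    and C0 :: "'a \<Rightarrow>\<^sub>L 'a"
    and \<mu>0 :: "'a measure"
  assumes eps: "\<epsilon> > 0"
    and C0: "C0 \<in> SymTr"
    and mu0: "is_gaussian m0 C0 \<mu>0"
  shows
   "(\<forall>t m1 X1 m2 X2 \<nu>1 \<nu>2 \<nu>. 0 \<le> t \<and> t \<le> 1 \<and> X1 \<in> SymTr \<and> X2 \<in> SymTr
        \<and> is_gaussian m1 X1 \<nu>1 \<and> is_gaussian m2 X2 \<nu>2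
        \<and> is_gaussian (t *\<^sub>R m1 + (1 - t) *\<^sub>R m2) (t *\<^sub>R X1 + (1 - t) *\<^sub>R X2) \<nu>
      \<longrightarrow> OT_eps \<epsilon> \<mu>0 \<nu> \<le> ennreal t * OT_eps \<epsilon> \<mu>0 \<nu>1 + ennreal (1 - t) * OT_eps \<epsilon> \<mu>0 \<nu>2)
  \<and> (\<forall>t m1 X1 m2 X2 \<nu>1 \<nu>2 \<nu>. 0 \<le> t \<and> t \<le> 1 \<and> X1 \<in> SymTr \<and> X2 \<in> SymTr
        \<and> is_gaussian m1 X1 \<nu>1 \<and> is_gaussian m2 X2 \<nu>2
        \<and> is_gaussian (t *\<^sub>R m1 + (1 - t) *\<^sub>R m2) (t *\<^sub>R X1 + (1 - t) *\<^sub>R X2) \<nu>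
      \<longrightarrow> OT_eps \<epsilon> \<nu> \<mu>0 \<le> ennreal t * OT_eps \<epsilon> \<nu>1 \<mu>0 + ennreal (1 - t) * OT_eps \<epsilon> \<nu>2 \<mu>0)
  \<and> (\<forall>\<rho>0. is_gaussian 0 C0 \<rho>0 \<longrightarrow>
       (\<forall>t X1 X2 \<nu>1 \<nu>2 \<nu>. 0 \<le> t \<and> t \<le> 1 \<and> X1 \<in> SymTr \<and> X2 \<in> SymTr
          \<and> is_gaussian 0 X1 \<nu>1 \<and> is_gaussian 0 X2 \<nu>2
          \<and> is_gaussian 0 (t *\<^sub>R X1 + (1 - t) *\<^sub>R X2) \<nu>
        \<longrightarrow> OT_eps \<epsilon> \<rho>0 \<nu> \<le> ennreal t * OT_eps \<epsilon> \<rho>0 \<nu>1 + ennreal (1 - t) * OT_eps \<epsilon> \<rho>0 \<nu>2)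
     \<and> ((\<forall>x. blinfun_apply C0 x = 0 \<longrightarrow> x = 0) \<longrightarrow>
       (\<forall>t X1 X2 \<nu>1 \<nu>2 \<nu>. 0 < t \<and> t < 1 \<and> X1 \<in> SymTr \<and> X2 \<in> SymTr \<and> X1 \<noteq> X2
          \<and> is_gaussian 0 X1 \<nu>1 \<and> is_gaussian 0 X2 \<nu>2
          \<and> is_gaussian 0 (t *\<^sub>R X1 + (1 - t) *\<^sub>R X2) \<nu>
        \<longrightarrow> OT_eps \<epsilon> \<rho>0 \<nu> < ennreal t * OT_eps \<epsilon> \<rho>0 \<nu>1 + ennreal (1 - t) * OT_eps \<epsilon> \<rho>0 \<nu>2)))"
proof -
  have swap: "OT_eps \<epsilon> \<nu> \<mu>0 = OT_eps \<epsilon> \<mu>0 \<nu>" if "is_gaussian m X \<nu>" for m X \<nu>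
    using that mu0 by (intro OT_eps_swap) (auto simp: is_gaussian_def)
  have conv: "OT_eps \<epsilon> \<rho>0 \<nu> \<le> ennreal t * OT_eps \<epsilon> \<rho>0 \<nu>1 + ennreal (1 - t) * OT_eps \<epsilon> \<rho>0 \<nu>2"
    if "is_gaussian m C0 \<rho>0" "0 \<le> t \<and> t \<le> 1 \<and> X1 \<in> SymTr \<and> X2 \<in> SymTr \<and> is_gaussian m1 X1 \<nu>1
      \<and> is_gaussian m2 X2 \<nu>2 \<and> is_gaussian (t *\<^sub>R m1 + (1 - t) *\<^sub>R m2) (t *\<^sub>R X1 + (1 - t) *\<^sub>R X2) \<nu>"
    for m \<rho>0 t m1 X1 m2 X2 \<nu>1 \<nu>2 \<nu>
    using OT_eps_gaussian_convex[OF eps C0] that by blast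
  show ?thesis
  proof (intro conjI allI impI, goal_cases)
    case (1 t m1 X1 m2 X2 \<nu>1 \<nu>2 \<nu>)
    then show ?case by (rule conv[OF mu0])
  next
    case (2 t m1 X1 m2 X2 \<nu>1 \<nu>2 \<nu>)
    then have "OT_eps \<epsilon> \<nu> \<mu>0 = OT_eps \<epsilon> \<mu>0 \<nu>" "OT_eps \<epsilon> \<nu>1 \<mu>0 = OT_eps \<epsilon> \<mu>0 \<nu>1"
      "OT_eps \<epsilon> \<nu>2 \<mu>0 = OT_eps \<epsilon> \<mu>0 \<nu>2" by (blast intro: swap)+
    with conv[OF mu0 2] show ?case by simp
  next
    case (3 \<rho>0 t X1 X2 \<nu>1 \<nu>2 \<nu>)
    then show ?case by (intro conv[of 0 _ _ X1 X2 0 _ 0]) auto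
  next
    case (4 \<rho>0 t X1 X2 \<nu>1 \<nu>2 \<nu>)
    then show ?case
      by (intro OT_eps_gaussian_strictly_convex[OF eps C0, of 0 _ _ X1 X2 0 _ 0]) auto
  qed
qed

end
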